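(* Let $G$ be a Polish group, and let $\alpha:G\to \mathrm{Aut}(X,\lambda)$ be a boolean measure-preserving $G$-action on a standard $\sigma$-finite space $(X,\lambda)$. Let $\mathcal G\subseteq \mathrm L^\infty(X,\lambda)$ be the algebra of $G$-continuous functions. The following are equivalent: (1) $\mathcal G\cap \mathrm L^1(X,\lambda)$ is $\|\cdot\|_1$-dense in $\mathrm L^1(X,\lambda)$; (2) $\mathcal G\cap \mathrm L^2(X,\lambda)$ is $\|\cdot\|_2$-dense in $\mathrm L^2(X,\lambda)$; (3) one can endow $X$ with a locally compact Polish topology inducing its standard Borel space structure so that $\lambda$ is Radon and $\alpha$ lifts to a continuous measure-preserving $G$-action on $X$.
   Context: A standard Borel space is an uncountable measurable space whose $\sigma$-algebra is the Borel $\sigma$-algebra of some Polish topology. A standard $\sigma$-finite space $(X,\lambda)$ is a standard Borel space $X$ with a nontrivial (nonzero) atomless $\sigma$-finite Borel measure $\lambda$. $\mathrm{Aut}(X,\lambda)$ is the group of $\lambda$-preserving Borel bijections of $X$, two of them being identified when they coincide on a conull set. It is a Polish group for the weak topology: $T_n\to T$ iff $\lambda(T_n(A)\,\triangle\, T(A))\to 0$ for every Borel $A$ of finite measure. A boolean measure-preserving $G$-action on $(X,\lambda)$ is a continuous group homomorphism $\alpha:G\to\mathrm{Aut}(X,\lambda)$. It lifts to a continuous measure-preserving action on $X$ (for a given topology on $X$) if there is a genuine group action $\beta:G\times X\to X$, continuous as a map on $G\times X$, such that for every $g\in G$, $\beta(g,\cdot)$ preserves $\lambda$ and its class modulo null sets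 is $\alpha(g)$. $\mathrm L^p(X,\lambda)$ denotes complex-valued functions modulo a.e. equality. A function $f\in\mathrm L^\infty(X,\lambda)$ is $G$-continuous if $\|f-f\circ\alpha(g)^{-1}\|_\infty\to 0$ as $g\to e_G$, where $\|\cdot\|_\infty$ is the essential supremum norm. A Borel measure on a Hausdorff space is Radon if it is finite on compact sets, inner regular (by compact sets) on open sets, and outer regular (by open sets) on Borel sets. *)

theory Defs
  imports
    "HOL-Algebra.Group_Action"
    "HOL-Probability.Essential_Supremum"
begin

section \<open>Polish spaces, Polish groups, standard sigma-finite spaces\<close>

definition polish_topology :: "'a topology \<Rightarrow> bool" where
  "polish_topology T \<longleftrightarrow> completely_metrizable_space T \<and> separable_space T"

definition polish_group :: "('g, 'm) monoid_scheme \<Rightarrow> 'g topology \<Rightarrow> bool" where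
  "polish_group G TG \<longleftrightarrow>
     group G \<and> topspace TG = carrier G \<and> polish_topology TG \<and>
     continuous_map (prod_topology TG TG) TG (\<lambda>(g, h). g \<otimes>\<^bsub>G\<^esub> h) \<and>
     continuous_map TG TG (\<lambda>g. inv\<^bsub>G\<^esub> g)"

definition induces_borel_structure :: "'x topology \<Rightarrow> 'x measure \<Rightarrow> bool" where
  "induces_borel_structure T M \<longleftrightarrow>
     topspace T = space M \<and> sets M = sigma_sets (space M) {U. openin T U}"

definition standard_borel :: "'x measure \<Rightarrow> bool" where
  "standard_borel M \<longleftrightarrow>
     uncountable (space M) \<and> (\<exists>T. polish_topology T \<and> induces_borel_structure T M)"

definition atomless :: "'x measure \<Rightarrow> bool" where
  "atomless M \<longleftrightarrow>
     (\<forall>A\<in>sets M. 0 < emeasure M A \<longrightarrow>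
        (\<exists>B\<in>sets M. B \<subseteq> A \<and> 0 < emeasure M B \<and> emeasure M B < emeasure M A))"

definition standard_sigma_finite :: "'x measure \<Rightarrow> bool" where
  "standard_sigma_finite M \<longleftrightarrow>
     standard_borel M \<and> sigma_finite_measure M \<and> atomless M \<and> emeasure M (space M) \<noteq> 0"


section \<open>The automorphism group and its weak topology\<close>

text \<open>
  Bijections are taken in \<^const>\<open>Bij\<close>, hence extensional, so that composition is
  that of \<^const>\<open>BijGroup\<close>. Measurability of the inverse is automatic on a standard
  Borel space (Lusin-Souslin); it is part of the definition so that these bijections visibly
  form a group.
\<close>

definition mp_bij :: "'x measure \<Rightarrow> ('x \<Rightarrow> 'x) set" where
  "mp_bij M = {T \<in> Bij (space M).
     T \<in> measurable M M \<and> inv_into (space M) T \<in> measurable M M \<and>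
     (\<forall>A\<in>sets M. emeasure M (T ` A) = emeasure M A)}"

definition ae_equal :: "'x measure \<Rightarrow> (('x \<Rightarrow> 'x) \<times> ('x \<Rightarrow> 'x)) set" where
  "ae_equal M = {(S, T). S \<in> mp_bij M \<and> T \<in> mp_bij M \<and> (AE x in M. S x = T x)}"

definition aut_class :: "'x measure \<Rightarrow> ('x \<Rightarrow> 'x) \<Rightarrow> ('x \<Rightarrow> 'x) set" where
  "aut_class M T = ae_equal M `` {T}"

definition Aut :: "'x measure \<Rightarrow> ('x \<Rightarrow> 'x) set monoid" where
  "Aut M =
     \<lparr>carrier = mp_bij M // ae_equal M,
      monoid.mult = (\<lambda>a b. \<Union>S\<in>a. \<Union>T\<in>b. aut_class M (S \<otimes>\<^bsub>BijGroup (space M)\<^esub> T)),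
      one = aut_class M \<one>\<^bsub>BijGroup (space M)\<^esub>\<rparr>"

text \<open>
  The topology generated by the balls of the pseudometrics
  \<open>(S, T) \<mapsto> \<lambda>(S(A) \<triangle> T(A))\<close>, for \<open>A\<close> measurable of finite measure. The value does not
  depend on the representatives.
\<close>

definition weak_topology :: "'x measure \<Rightarrow> ('x \<Rightarrow> 'x) set topology" where
  "weak_topology M = topology_generated_by
     {{b \<in> carrier (Aut M). \<exists>T\<in>b. measure M (sym_diff (T ` A) (S ` A)) < \<epsilon>} | A S \<epsilon>.
        A \<in> sets M \<and> emeasure M A < \<infinity> \<and> S \<in> mp_bij M \<and> 0 < \<epsilon>}"

definition boolean_action ::
  "('g, 'm) monoid_scheme \<Rightarrow> 'g topology \<Rightarrow> 'x measure \<Rightarrow> ('g \<Rightarrow> ('x \<Rightarrow> 'x) set) \<Rightarrow> bool" where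
  "boolean_action G TG M \<alpha> \<longleftrightarrow>
     \<alpha> \<in> hom G (Aut M) \<and> continuous_map TG (weak_topology M) \<alpha>"

definition lifts_to_continuous_action ::
  "('g, 'm) monoid_scheme \<Rightarrow> 'g topology \<Rightarrow> 'x measure \<Rightarrow> 'x topology
     \<Rightarrow> ('g \<Rightarrow> ('x \<Rightarrow> 'x) set) \<Rightarrow> bool" where
  "lifts_to_continuous_action G TG M T \<alpha> \<longleftrightarrow>
     (\<exists>\<beta>. group_action G (space M) \<beta> \<and>
          continuous_map (prod_topology TG T) T (\<lambda>(g, x). \<beta> g x) \<and>
          (\<forall>g\<in>carrier G. \<beta> g \<in> mp_bij M \<and> aut_class M (\<beta> g) = \<alpha> g))"


section \<open>Lebesgue spaces and continuous vectors\<close>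

text \<open>
  Elements of the Lebesgue spaces are represented by measurable functions; every notion below is
  invariant under almost everywhere equality.
\<close>

definition Lp :: "'x measure \<Rightarrow> real \<Rightarrow> ('x \<Rightarrow> complex) set" where
  "Lp M p = {f \<in> borel_measurable M. integrable M (\<lambda>x. cmod (f x) powr p)}"

definition Lp_norm :: "'x measure \<Rightarrow> real \<Rightarrow> ('x \<Rightarrow> complex) \<Rightarrow> real" where
  "Lp_norm M p f = (\<integral>x. cmod (f x) powr p \<partial>M) powr (1 / p)"

definition Linf_norm :: "'x measure \<Rightarrow> ('x \<Rightarrow> complex) \<Rightarrow> ereal" where
  "Linf_norm M f = esssup M (\<lambda>x. ereal (cmod (f x)))"

definition Linf :: "'x measure \<Rightarrow> ('x \<Rightarrow> complex) set" where
  "Linf M = {f \<in> borel_measurable M. Linf_norm M f < \<infinity>}"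

definition G_continuous_functions ::
  "('g, 'm) monoid_scheme \<Rightarrow> 'g topology \<Rightarrow> 'x measure \<Rightarrow> ('g \<Rightarrow> ('x \<Rightarrow> 'x) set)
     \<Rightarrow> ('x \<Rightarrow> complex) set" where
  "G_continuous_functions G TG M \<alpha> = {f \<in> Linf M.
     \<forall>\<epsilon>>0. \<forall>\<^sub>F g in nhdsin TG \<one>\<^bsub>G\<^esub>. \<forall>T\<in>\<alpha> g.
       Linf_norm M (\<lambda>x. f x - f (inv_into (space M) T x)) < \<epsilon>}"

definition Lp_dense :: "'x measure \<Rightarrow> real \<Rightarrow> ('x \<Rightarrow> complex) set \<Rightarrow> bool" where
  "Lp_dense M p F \<longleftrightarrow>
     F \<subseteq> Lp M p \<and> (\<forall>f\<in>Lp M p. \<forall>\<epsilon>>0. \<exists>h\<in>F. Lp_norm M p (\<lambda>x. f x - h x) < \<epsilon>)"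


section \<open>Radon measures\<close>

definition radon :: "'x topology \<Rightarrow> 'x measure \<Rightarrow> bool" where
  "radon T M \<longleftrightarrow>
     (\<forall>K. compactin T K \<longrightarrow> emeasure M K < \<infinity>) \<and>
     (\<forall>U. openin T U \<longrightarrow>
        emeasure M U = (SUP K\<in>{K. compactin T K \<and> K \<subseteq> U}. emeasure M K)) \<and>
     (\<forall>A\<in>sets M. emeasure M A = (INF U\<in>{U. openin T U \<and> A \<subseteq> U}. emeasure M U))"

end

theory Submission
  imports Defs "HOL-Probability.Distribution_Functions"
begin

text \<open>
  From (3), compactly supported continuous functions are \<open>G\<close>-continuous by the tube lemma, and they
  are dense by Urysohn's lemma and regularity.

  Conversely, (1) and (2) both provide countably many \<open>G\<close>-continuous \<open>f\<^sub>n : X \<rightarrow> [0,1]\<close> with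
  \<open>\<lambda>(f\<^sub>n > \<delta>) < \<infinity>\<close> for all \<open>\<delta> > 0\<close> that generate the Borel structure modulo null sets. Sending \<open>x\<close>
  to the functions \<open>g \<mapsto> f\<^sub>n(g x)\<close> on \<open>G\<close> maps almost every point into the space \<open>Z\<close> of all sequences
  of functions \<open>z\<^sub>n : G \<rightarrow> [0,1]\<close> that are 1-Lipschitz for the right-invariant continuous
  pseudometrics \<open>\<rho>\<^sub>n(g, h) = \<parallel>f\<^sub>n \<circ> g - f\<^sub>n \<circ> h\<parallel>\<^sub>\<infinity>\<close>. Such functions are determined by their values
  on a countable dense subset of \<open>G\<close>, so \<open>Z\<close> is compact metrizable; \<open>G\<close> acts on it jointly continuously
  by right translation, fixing 0. Hence \<open>Y = Z - {0}\<close> is a locally compact Polish \<open>G\<close>-space, the push-forward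
  of \<open>\<lambda>\<close> is finite on its compact sets, and a.e. equivariance holds because it holds on a dense set.
  The map \<open>X \<rightarrow> Y\<close> has an a.e. inverse, so it is a Borel isomorphism between conull Borel sets; since
  these contain null Borel copies of the real line, a Schroeder-Bernstein argument on null sets
  turns it into a Borel isomorphism from \<open>X\<close> onto \<open>Y\<close>, along which topology and action are pulled back.
\<close>

section \<open>Borel embeddings into the real line\<close>

text \<open>The obstacle is that \<open>\<alpha>\<close> gives each group element only up to a null
  set, and this null set varies with the element: over an uncountable group, chosen representatives
  need not satisfy the group law simultaneously at any point. Hence the action is built on
  \<open>Y\<close>, where it is genuine by definition, and \<open>X\<close> is compared with it only
  for one group element at a time. Right invariance of the pseudometrics holds because the
  representatives preserve null sets; it makes right translation keep the Lipschitz condition. The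
  Lipschitz bound is uniform over all points of \<open>Z\<close>, and this equicontinuity upgrades
  coordinatewise closeness to joint continuity. The point 0 has to go because the superlevel sets of
  finite measure cover everything except 0. The null copies of the line are needed because the
  remainders outside the matched sets can have different cardinalities on the two sides. Borel
  injections always come with a measurable left inverse on the whole target: their images are then
  sets of fixed points, which are measurable for elementary reasons.\<close>

definition measurable_retract :: "'a measure \<Rightarrow> 'b measure \<Rightarrow> ('a \<Rightarrow> 'b) \<Rightarrow> ('b \<Rightarrow> 'a) \<Rightarrow> bool" where
  "measurable_retract A B i r \<longleftrightarrow>
     i \<in> A \<rightarrow>\<^sub>M B \<and> r \<in> B \<rightarrow>\<^sub>M A \<and> (\<forall>x\<in>space A. r (i x) = x)"

lemma measurable_retract_comp:
  assumes "measurable_retract A B i r" "measurable_retract B C j s"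
  shows "measurable_retract A C (j \<circ> i) (r \<circ> s)"
  using assms by (auto simp: measurable_retract_def measurable_space)

text \<open>Digits 0 and 1 in base 3 rule out carries and double expansions, so the bits can be read
  off again by \<open>floor\<close>. In base 2 this would fail at dyadic rationals.\<close>

definition ternary_sum :: "(nat \<Rightarrow> bool) \<Rightarrow> real" where
  "ternary_sum b = (\<Sum>k. of_bool (b k) / 3 ^ Suc k)"

lemma summable_ternary: "summable (\<lambda>k. of_bool (b k) / 3 ^ Suc k :: real)"
proof (rule summable_comparison_test')
  show "summable (\<lambda>k. (1/3::real) ^ k)" by (simp add: summable_geometric)
  show "norm (of_bool (b k) / 3 ^ Suc k :: real) \<le> (1/3) ^ k" if "k \<ge> 0" for k
    by (auto simp: field_simps)
qed

lemma ternary_sum_bounds: "0 \<le> ternary_sum b" "ternary_sum b < 1"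
proof -
  show "0 \<le> ternary_sum b" unfolding ternary_sum_def by (rule suminf_nonneg[OF summable_ternary]) auto
  have "ternary_sum b \<le> (\<Sum>k. 1/3 * (1/3::real) ^ k)"
    unfolding ternary_sum_def
  proof (rule suminf_le[OF _ summable_ternary])
    show "summable (\<lambda>k. 1/3 * (1/3::real) ^ k)" by (intro summable_mult summable_geometric) simp
  qed (auto simp: field_simps)
  also have "\<dots> = 1/2" by (subst suminf_mult) (auto simp: suminf_geometric summable_geometric)
  finally show "ternary_sum b < 1" by simp
qed

lemma ternary_sum_step: "3 * ternary_sum b = of_bool (b 0) + ternary_sum (b \<circ> Suc)"
proof -
  have "ternary_sum b = of_bool (b 0) / 3 + (\<Sum>k. of_bool (b (Suc k)) / 3 ^ Suc (Suc k))"
    unfolding ternary_sum_def using suminf_split_head[OF summable_ternary, of b] by simp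
  also have "(\<Sum>k. of_bool (b (Suc k)) / 3 ^ Suc (Suc k)) = (\<Sum>k. 1/3 * (of_bool ((b \<circ> Suc) k) / 3 ^ Suc k :: real))"
    by (simp add: field_simps)
  also have "\<dots> = 1/3 * ternary_sum (b \<circ> Suc)"
    unfolding ternary_sum_def by (rule suminf_mult[OF summable_ternary])
  finally show ?thesis by simp
qed

text \<open>Multiplying by the power of 3 moves the wanted digit just left of the point; what stays
  to the right is a ternary sum below 1, and all earlier digits contribute multiples of 3.\<close>

lemma floor_ternary_sum: "\<lfloor>3 ^ Suc k * ternary_sum b\<rfloor> mod 3 = of_bool (b k)"
proof (induction k arbitrary: b)
  case 0
  have "3 * ternary_sum b = of_int (of_bool (b 0)) + ternary_sum (b \<circ> Suc)"
    by (simp add: ternary_sum_step)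
  then have "\<lfloor>3 * ternary_sum b\<rfloor> = of_bool (b 0)"
    using ternary_sum_bounds[of "b \<circ> Suc"] by (simp add: floor_unique)
  then show ?case by simp
next
  case (Suc k)
  have "3 ^ Suc (Suc k) * ternary_sum b = 3 ^ Suc k * (3 * ternary_sum b)" by simp
  also have "\<dots> = of_int (3 ^ Suc k * of_bool (b 0)) + 3 ^ Suc k * ternary_sum (b \<circ> Suc)"
    by (simp add: ternary_sum_step distrib_left)
  finally have "\<lfloor>3 ^ Suc (Suc k) * ternary_sum b\<rfloor> = 3 ^ Suc k * of_bool (b 0) + \<lfloor>3 ^ Suc k * ternary_sum (b \<circ> Suc)\<rfloor>"
    by (simp only: floor_add_int[symmetric] add.commute)
  then show ?case using Suc[of "b \<circ> Suc"] by (auto simp: comp_def)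
qed

text \<open>Each coordinate is coded by its lower Dedekind cut: one bit for every pair of a
  coordinate and a rational \<open>q\<close>, telling whether \<open>q\<close> lies below it. The
  bits are packed into one real number, and a coordinate is recovered as the supremum of its
  cut.\<close>

lemma retract_countable_product_real:
  "\<exists>i r. measurable_retract (borel :: ('i::countable \<Rightarrow> real) measure) (borel :: real measure) i r"
proof -
  define bit where "bit x m = (case from_nat m of (a :: 'i, q :: rat) \<Rightarrow> of_rat q < (x a :: real))" for x m
  define i where "i x = ternary_sum (bit x)" for x
  define D where "D t k = (\<lfloor>3 ^ Suc k * t\<rfloor> mod 3 = 1)" for t :: real and k
  \<comment> \<open>The supremum is taken in the extended reals, so it is defined and measurable for
    every \<open>t\<close>; on numbers that code no point, \<open>real_of_ereal\<close> merely
    supplies some value.\<close>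
  define r where "r t a = real_of_ereal (SUP q :: rat. if D t (to_nat (a, q)) then ereal (of_rat q) else -\<infinity>)"
    for t and a :: 'i
  have coord [measurable]: "(\<lambda>x. x a) \<in> borel_measurable (borel :: ('i \<Rightarrow> real) measure)" for a
    by (rule measurable_product_then_coordinatewise) simp
  have bitm [measurable]: "Measurable.pred borel (\<lambda>x. bit x m)" for m
    unfolding bit_def by (cases "from_nat m :: 'i \<times> rat") simp
  have "i \<in> borel_measurable borel"
    unfolding i_def ternary_sum_def by measurable
  moreover have "r \<in> borel_measurable borel"
  proof (rule measurable_coordinatewise_then_product)
    fix a
    have [measurable]: "Measurable.pred borel (\<lambda>t. D t k)" for k
      unfolding D_def by measurable
    show "(\<lambda>t. r t a) \<in> borel_measurable borel"
      unfolding r_def by measurable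
  qed
  moreover have "r (i x) = x" for x
  proof
    fix a
    have "D (i x) m = bit x m" for m
      unfolding D_def i_def by (subst floor_ternary_sum) simp
    then have "(SUP q :: rat. if D (i x) (to_nat (a, q)) then ereal (of_rat q) else -\<infinity>) =
      (SUP q :: rat. if of_rat q < x a then ereal (of_rat q) else -\<infinity>)"
      by (simp add: bit_def)
    also have "\<dots> = ereal (x a)"
    proof (rule antisym)
      show "(SUP q :: rat. if of_rat q < x a then ereal (of_rat q) else -\<infinity>) \<le> ereal (x a)"
        by (rule SUP_least) auto
      show "ereal (x a) \<le> (SUP q :: rat. if of_rat q < x a then ereal (of_rat q) else -\<infinity>)"
      proof (rule dense_le)
        fix y assume "y < ereal (x a)"
        then obtain z where "y < ereal z" "z < x a" using ereal_dense2[of y "ereal (x a)"] by auto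
        moreover obtain q where "z < of_rat q" "of_rat q < x a" using of_rat_dense[OF \<open>z < x a\<close>] by auto
        ultimately have "y \<le> (if of_rat q < x a then ereal (of_rat q) else -\<infinity>)"
          using less_trans[of y "ereal z" "ereal (of_rat q)"] by simp
        then show "y \<le> (SUP q :: rat. if of_rat q < x a then ereal (of_rat q) else -\<infinity>)"
          by (rule order_trans) (rule SUP_upper, simp)
      qed
    qed
    finally show "r (i x) a = x a" by (simp add: r_def)
  qed
  ultimately show ?thesis unfolding measurable_retract_def by blast
qed

text \<open>A point is coded by its distances to a dense sequence. Completeness makes the set
  \<open>I\<close> of codes definable by countably many inequalities, so it is Borel, and the
  decoding map extends measurably by a constant.\<close>

lemma retract_polish_real:
  assumes T: "polish_topology T" "induces_borel_structure T M" and ne: "space M \<noteq> {}"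
  shows "\<exists>i r. measurable_retract M (borel :: real measure) i r"
proof -
  obtain S d where "Metric_space S d" and mc: "Metric_space.mcomplete S d" and TS: "T = Metric_space.mtopology S d"
    using T(1) unfolding polish_topology_def completely_metrizable_space_def by auto
  interpret Metric_space S d by fact
  have SM: "space M = S" and setsM: "sets M = sigma_sets (space M) {U. openin mtopology U}"
    using T(2) TS by (auto simp: induces_borel_structure_def)
  obtain C where C: "countable C" "C \<subseteq> S" "mtopology closure_of C = S"
    using T(1) TS by (auto simp: polish_topology_def separable_space_def)
  have "C \<noteq> {}" using C ne SM by auto
  define a where "a n = from_nat_into C n" for n
  have aS: "a n \<in> S" for n
    using from_nat_into[OF \<open>C \<noteq> {}\<close>] C(2) unfolding a_def by blast
  have dense: "\<exists>n. d x (a n) < e" if "x \<in> S" "e > 0" for x e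
  proof -
    have "\<exists>y\<in>C. y \<in> mball x e"
      using that C(3) unfolding metric_closure_of by auto
    then obtain y where "y \<in> C" "d x y < e" by auto
    then show ?thesis using from_nat_into_surj[OF C(1)] unfolding a_def by metis
  qed
  define i where "i x = (\<lambda>n. d x (a n))" for x
  \<comment> \<open>The second line says that \<open>y\<close> could be the list of distances to the
    sequence from one additional point; the first condition brings that point arbitrarily close to
    the sequence, so completeness already provides it in \<open>S\<close>.\<close>
  define I where "I = {y :: nat \<Rightarrow> real. (\<forall>k. \<exists>n. y n < 1 / real (Suc k)) \<and>
     (\<forall>m n. \<bar>y m - y n\<bar> \<le> d (a m) (a n) \<and> d (a m) (a n) \<le> y m + y n)}"
  have iI: "i x \<in> I" if "x \<in> S" for x
    unfolding I_def i_def using dense[OF that] that aS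
    using triangle[OF that aS aS] triangle[OF aS that aS] commute
    by (auto simp: abs_le_iff) (metis add.commute commute diff_le_eq)+
  have ex: "\<exists>x\<in>S. i x = y" if "y \<in> I" for y
  proof -
    have "\<forall>k. \<exists>n. y n < 1 / real (Suc k)" and y: "\<And>m n. \<bar>y m - y n\<bar> \<le> d (a m) (a n)" "\<And>m n. d (a m) (a n) \<le> y m + y n"
      using that by (auto simp: I_def)
    then obtain n where n: "\<And>k. y (n k) < 1 / real (Suc k)" by metis
    have y0: "0 \<le> y m" for m using y(2)[of m m] aS by auto
    have lim: "(\<lambda>k. y (n k)) \<longlonglongrightarrow> 0"
    proof (rule real_tendsto_sandwich[OF _ _ tendsto_const])
      show "(\<lambda>k. 1 / real (Suc k)) \<longlonglongrightarrow> 0" using LIMSEQ_inverse_real_of_nat by (simp add: inverse_eq_divide)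
    qed (use y0 n in \<open>auto intro!: always_eventually less_imp_le\<close>)
    \<comment> \<open>The distance of two members of the sequence is at most the sum of their
      \<open>y\<close>-values, so members with \<open>y\<close>-values tending to 0 form a Cauchy
      sequence; its limit has code \<open>y\<close>.\<close>
    have "MCauchy (\<lambda>k. a (n k))"
      unfolding MCauchy_def
    proof (intro conjI allI impI)
      show "range (\<lambda>k. a (n k)) \<subseteq> S" using aS by auto
      fix e :: real assume "e > 0"
      then obtain N where N: "\<And>k. k \<ge> N \<Longrightarrow> norm (y (n k)) < e/2"
        using LIMSEQ_D[OF lim, of "e/2"] by auto
      then show "\<exists>N. \<forall>k k'. N \<le> k \<longrightarrow> N \<le> k' \<longrightarrow> d (a (n k)) (a (n k')) < e"
        using y(2) by (intro exI[of _ N]) (smt (verit) field_sum_of_halves real_norm_def)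
    qed
    then obtain x where x: "limitin mtopology (\<lambda>k. a (n k)) x sequentially"
      using mc unfolding mcomplete_def by auto
    then have xS: "x \<in> S" and lx: "(\<lambda>k. d (a (n k)) x) \<longlonglongrightarrow> 0"
      unfolding limitin_metric_dist_null by auto
    have "d x (a m) = y m" for m
    proof (rule LIMSEQ_unique)
      have "norm (d (a (n k)) (a m) - d x (a m)) \<le> d (a (n k)) x" for k
        using triangle[OF aS xS aS, of "n k" m] triangle[OF xS aS aS, of m "n k"] commute[of x "a (n k)"] commute[of "a m" "a (n k)"]
        by (simp add: abs_le_iff)
      then show "(\<lambda>k. d (a (n k)) (a m)) \<longlonglongrightarrow> d x (a m)"
        by (intro LIM_zero_cancel[OF Lim_null_comparison[OF _ lx]]) simp
      have "norm (d (a (n k)) (a m) - y m) \<le> y (n k)" for k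
        using y(1)[of "n k" m] y(2)[of "n k" m] y(1)[of m "n k"] by (simp add: abs_le_iff)
      then show "(\<lambda>k. d (a (n k)) (a m)) \<longlonglongrightarrow> y m"
        by (intro LIM_zero_cancel[OF Lim_null_comparison[OF _ lim]]) simp
    qed
    then show ?thesis using xS by (auto simp: i_def)
  qed
  have inj: "x = x'" if h: "x \<in> S" "x' \<in> S" "i x = i x'" for x x'
  proof -
    have "d x x' \<le> 0"
    proof (rule field_le_epsilon)
      fix e :: real assume "e > 0"
      then obtain n where "d x (a n) < e/2" using dense[OF h(1), of "e/2"] by auto
      moreover have "d x (a n) = d x' (a n)" using h(3) unfolding i_def by metis
      ultimately show "d x x' \<le> 0 + e"
        using triangle[OF h(1) aS h(2), of n] commute[of x' "a n"] by simp
    qed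
    then show ?thesis using h by (metis order.antisym nonneg zero)
  qed
  obtain x0 where x0: "x0 \<in> S" using ne SM by auto
  define r where "r y = (if y \<in> I then (THE x. x \<in> S \<and> i x = y) else x0)" for y
  have ri: "r (i x) = x" if "x \<in> S" for x
    using iI[OF that] that inj unfolding r_def by auto
  have rS: "r y \<in> S" and ir: "y \<in> I \<Longrightarrow> i (r y) = y" for y
    using ex[of y] ri x0 by (metis r_def)+
  have openM: "openin mtopology U \<Longrightarrow> U \<in> sets M" for U unfolding setsM by auto
  have [measurable]: "(\<lambda>y. y n) \<in> borel_measurable (borel :: (nat \<Rightarrow> real) measure)" for n
    by (rule measurable_product_then_coordinatewise) simp
  have Im [measurable]: "I \<in> sets borel" unfolding I_def by measurable
  have "i \<in> borel_measurable M"
  proof (rule measurable_coordinatewise_then_product)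
    fix n
    have "{x \<in> space M. i x n < c} = mball (a n) c" for c
      using aS unfolding SM i_def by (auto simp: commute)
    then show "(\<lambda>x. i x n) \<in> borel_measurable M"
      unfolding borel_measurable_iff_less using openM by auto
  qed
  moreover have "r \<in> borel \<rightarrow>\<^sub>M M"
  proof (rule measurable_sigma_sets[OF setsM])
    show "{U. openin mtopology U} \<subseteq> Pow (space M)" using openin_subset[of mtopology] SM by auto
    show "r \<in> space borel \<rightarrow> space M" using rS SM by auto
    fix U assume "U \<in> {U. openin mtopology U}"
    then have U: "openin mtopology U" by simp
    \<comment> \<open>The balls of radius \<open>1 / real (Suc k)\<close> about the dense sequence
      form a countable base, and on \<open>I\<close> lying in such a ball is a condition on the
      single coordinate \<open>y n\<close>.\<close>
    have "r -` U \<inter> I = (\<Union>(n, k) \<in> {(n, k). mball (a n) (1 / real (Suc k)) \<subseteq> U}. {y \<in> I. y n < 1 / real (Suc k)})"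
    proof (intro equalityI subsetI)
      fix y assume y: "y \<in> r -` U \<inter> I"
      then obtain e where e: "e > 0" "mball (r y) e \<subseteq> U" using U unfolding openin_mtopology by auto
      obtain k where k: "1 / real (Suc k) < e / 2" using nat_approx_posE[of "e/2"] e(1) by (metis half_gt_zero)
      obtain n where n: "d (r y) (a n) < 1 / real (Suc k)" using dense[OF rS[of y], of "1 / real (Suc k)"] by auto
      have "mball (a n) (1 / real (Suc k)) \<subseteq> mball (r y) e"
      proof
        fix x assume "x \<in> mball (a n) (1 / real (Suc k))"
        then show "x \<in> mball (r y) e"
          using rS[of y] n k triangle[OF rS[of y] aS, of x n] by simp
      qed
      moreover have "y n = d (r y) (a n)" using ir y unfolding i_def by (metis IntD2)
      ultimately show "y \<in> (\<Union>(n, k) \<in> {(n, k). mball (a n) (1 / real (Suc k)) \<subseteq> U}. {y \<in> I. y n < 1 / real (Suc k)})"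
        using n e y by (intro UN_I[of "(n, k)"]) auto
    next
      fix y assume "y \<in> (\<Union>(n, k) \<in> {(n, k). mball (a n) (1 / real (Suc k)) \<subseteq> U}. {y \<in> I. y n < 1 / real (Suc k)})"
      then obtain n k where *: "mball (a n) (1 / real (Suc k)) \<subseteq> U" "y \<in> I" "y n < 1 / real (Suc k)" by auto
      then have "d (r y) (a n) < 1 / real (Suc k)" using ir unfolding i_def by metis
      then have "r y \<in> mball (a n) (1 / real (Suc k))" using aS rS commute by auto
      then show "y \<in> r -` U \<inter> I" using * by auto
    qed
    moreover have "countable {(n, k). mball (a n) (1 / real (Suc k)) \<subseteq> U}" by simp
    ultimately have "r -` U \<inter> I \<in> sets borel"
      by (auto intro!: sets.countable_UN'' )
    moreover have "r -` U - I \<in> sets borel"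
    proof (cases "x0 \<in> U")
      case True
      then have "r -` U - I = - I" by (auto simp: r_def)
      then show ?thesis by simp
    next
      case False
      then have "r -` U - I = {}" by (auto simp: r_def split: if_splits)
      then show ?thesis by (metis sets.empty_sets)
    qed
    moreover have "r -` U \<inter> space borel = (r -` U \<inter> I) \<union> (r -` U - I)" by auto
    ultimately show "r -` U \<inter> space borel \<in> sets borel" by (metis sets.Un)
  qed
  ultimately have "measurable_retract M borel i r"
    using ri SM unfolding measurable_retract_def by auto
  then show ?thesis using retract_countable_product_real measurable_retract_comp by blast
qed

text \<open>The classical argument, kept measurable: \<open>imi\<close> and \<open>imj\<close> say
  that the ranges of \<open>i\<close> and \<open>j\<close> are measurable, whence so is the image of
  every measurable set. Points whose chain of predecessors stops in \<open>A\<close> are moved by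
  \<open>i\<close>, all others by the inverse of \<open>j\<close>.\<close>

lemma measurable_schroeder_bernstein:
  assumes i: "measurable_retract A B i i'" and j: "measurable_retract B A j j'"
    and imi: "{b \<in> space B. i (i' b) = b} \<in> sets B"
    and imj: "{a \<in> space A. j (j' a) = a} \<in> sets A"
  shows "\<exists>\<theta> \<theta>'. measurable_retract A B \<theta> \<theta>' \<and> measurable_retract B A \<theta>' \<theta>"
proof -
  have [measurable]: "i \<in> A \<rightarrow>\<^sub>M B" "i' \<in> B \<rightarrow>\<^sub>M A" "j \<in> B \<rightarrow>\<^sub>M A" "j' \<in> A \<rightarrow>\<^sub>M B"
    and i'i: "\<And>x. x \<in> space A \<Longrightarrow> i' (i x) = x" and j'j: "\<And>y. y \<in> space B \<Longrightarrow> j' (j y) = y"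
    using i j by (auto simp: measurable_retract_def)
  have sp: "\<And>x. x \<in> space A \<Longrightarrow> i x \<in> space B" "\<And>x. x \<in> space A \<Longrightarrow> j' x \<in> space B"
    "\<And>y. y \<in> space B \<Longrightarrow> j y \<in> space A" "\<And>y. y \<in> space B \<Longrightarrow> i' y \<in> space A"
    by (auto dest: measurable_space[rotated] intro: measurable_space)
  \<comment> \<open>\<open>iS S\<close> and \<open>jS S\<close> are the images of \<open>S\<close>
    under \<open>i\<close> and \<open>j\<close>, written with the left inverses.\<close>
  define iS where "iS S = {b \<in> space B. i (i' b) = b} \<inter> (i' -` S \<inter> space B)" for S
  define jS where "jS S = {a \<in> space A. j (j' a) = a} \<inter> (j' -` S \<inter> space A)" for S
  have iS: "iS S \<in> sets B" if "S \<in> sets A" for S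
    using imi that unfolding iS_def by measurable
  have jS: "jS S \<in> sets A" if "S \<in> sets B" for S
    using imj that unfolding jS_def by measurable
  \<comment> \<open>\<open>C 0\<close> consists of the points without a predecessor under
    \<open>j\<close>; \<open>C k\<close> is its image after \<open>k\<close> round trips through
    \<open>B\<close>.\<close>
  define C where "C k = ((\<lambda>S. jS (iS S)) ^^ k) (space A - jS (space B))" for k
  have C: "C k \<in> sets A" for k
  proof (induction k)
    case 0
    then show ?case using jS[of "space B"] by (auto simp: C_def)
  next
    case (Suc k)
    then show ?case using iS jS by (simp add: C_def)
  qed
  define D where "D = (\<Union>k. C k)"
  have D: "D \<in> sets A" unfolding D_def using C by auto
  then have DA: "D \<subseteq> space A" by (rule sets.sets_into_space)
  have stepD: "j y \<in> D" if "y \<in> iS D" for y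
  proof -
    from that obtain k where "y \<in> iS (C k)" unfolding iS_def D_def by auto
    then have "j y \<in> C (Suc k)" using j'j sp unfolding C_def by (auto simp: jS_def iS_def)
    then show ?thesis unfolding D_def by auto
  qed
  have nD: "x \<in> space A \<Longrightarrow> x \<notin> D \<Longrightarrow> j (j' x) = x" for x
    unfolding D_def using sp by (auto simp: C_def jS_def dest!: spec[of _ 0])
  have backD: "y \<in> iS D" if "y \<in> space B" "j y \<in> D" for y
  proof -
    from that obtain k where k: "j y \<in> C k" unfolding D_def by auto
    then have "k \<noteq> 0" using that(1) sp(3)[OF that(1)] j'j[OF that(1)] by (auto simp: C_def jS_def intro!: gr0I)
    then obtain l where "k = Suc l" by (cases k) auto
    with k have "y \<in> iS (C l)" using that j'j by (auto simp: C_def jS_def)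
    then show ?thesis unfolding iS_def D_def by auto
  qed
  define \<theta> where "\<theta> x = (if x \<in> D then i x else j' x)" for x
  define \<theta>' where "\<theta>' y = (if y \<in> iS D then i' y else j y)" for y
  have "\<theta> \<in> A \<rightarrow>\<^sub>M B" unfolding \<theta>_def using D by measurable
  moreover have "\<theta>' \<in> B \<rightarrow>\<^sub>M A" unfolding \<theta>'_def using iS[OF D] by measurable
  moreover have "\<theta>' (\<theta> x) = x" if x: "x \<in> space A" for x
  proof (cases "x \<in> D")
    case True
    then have "i x \<in> iS D" using x sp i'i by (auto simp: iS_def)
    then show ?thesis using True x i'i by (simp add: \<theta>_def \<theta>'_def)
  next
    case False
    then have "j' x \<notin> iS D" using stepD nD[OF x] by metis
    then show ?thesis using False nD x by (simp add: \<theta>_def \<theta>'_def)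
  qed
  moreover have "\<theta> (\<theta>' y) = y" if y: "y \<in> space B" for y
  proof (cases "y \<in> iS D")
    case True
    then have "i' y \<in> D" "i (i' y) = y" by (auto simp: iS_def)
    then show ?thesis using True by (simp add: \<theta>_def \<theta>'_def)
  next
    case False
    then have "j y \<notin> D" using backD y by blast
    then show ?thesis using False y j'j by (simp add: \<theta>_def \<theta>'_def)
  qed
  ultimately show ?thesis unfolding measurable_retract_def by blast
qed

text \<open>The diagonal of a measurable space need not be measurable; the injection
  \<open>\<iota>\<close> turns the equation into one between real functions.\<close>

lemma measurable_retract_fixpoints:
  fixes \<iota> :: "'a \<Rightarrow> real"
  assumes \<iota>: "measurable_retract M borel \<iota> r" and [measurable]: "f \<in> M \<rightarrow>\<^sub>M M"
  shows "{x \<in> space M. f x = x} \<in> sets M"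
proof -
  have [measurable]: "\<iota> \<in> M \<rightarrow>\<^sub>M borel" and r: "\<And>x. x \<in> space M \<Longrightarrow> r (\<iota> x) = x"
    using \<iota> by (auto simp: measurable_retract_def)
  have "{x \<in> space M. f x = x} = {x \<in> space M. \<iota> (f x) = \<iota> x}"
    using r measurable_space[OF \<open>f \<in> M \<rightarrow>\<^sub>M M\<close>] by metis
  also have "\<dots> \<in> sets M" by measurable
  finally show ?thesis .
qed

section \<open>Null Borel copies of the real line inside sets of positive measure\<close>

lemma (in finite_borel_measure) ex_cdf_eq:
  assumes cont: "\<And>x. measure M {x} = 0" and u: "0 < u" "u < measure M (space M)"
  shows "\<exists>t. cdf M t = u \<and> (\<forall>s<t. cdf M s < u)"
proof -
  have cts: "isCont (cdf M) x" for x using isCont_cdf cont by simp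
  have "\<forall>\<^sub>F x in at_bot. cdf M x < u" using cdf_lim_at_bot u(1) by (rule order_tendstoD)
  then obtain a where a: "\<And>x. x \<le> a \<Longrightarrow> cdf M x < u" unfolding eventually_at_bot_linorder by blast
  have "\<forall>\<^sub>F x in at_top. u < cdf M x" using cdf_lim_at_top u(2) by (rule order_tendstoD)
  then obtain b where b: "u < cdf M b" unfolding eventually_at_top_linorder by blast
  have ab: "a \<le> b" using cdf_nondecreasing[of b a] a[of a] b by (cases "a \<le> b") auto
  \<comment> \<open>The leftmost solution is wanted: strictly smaller values to its left will place
    it in the support of the measure.\<close>
  define S where "S = {t. cdf M t = u}"
  have "S \<noteq> {}" using IVT[of "cdf M" a u b] cts a[of a] b ab unfolding S_def by force
  moreover have bd: "bdd_below S" unfolding S_def by (rule bdd_belowI[of _ a]) (metis a linear mem_Collect_eq less_irrefl)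
  moreover have "closed S" unfolding S_def
    by (intro closed_Collect_eq continuous_at_imp_continuous_on ballI cts continuous_on_const)
  ultimately have I: "Inf S \<in> S" by (rule closed_contains_Inf)
  have "cdf M s < u" if s: "s < Inf S" for s
  proof -
    have "cdf M s \<le> u" using cdf_nondecreasing[of s "Inf S"] s I by (simp add: S_def)
    moreover have "cdf M s \<noteq> u" using cInf_lower[OF _ bd, of s] s by (auto simp: S_def)
    ultimately show ?thesis by simp
  qed
  then show ?thesis using I by (auto simp: S_def)
qed

text \<open>Pushed to the reals, the atomless measure has an injective quantile function, which
  embeds the line into \<open>X1\<close>. The plane embeds into the line, and among its uncountably
  many disjoint vertical lines one must be null. Being null, the copy can later be rearranged
  without changing anything almost everywhere.\<close>

lemma null_copy_of_real:
  fixes \<iota> :: "'x \<Rightarrow> real"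
  assumes \<iota>: "measurable_retract M borel \<iota> r"
    and X1 [measurable]: "X1 \<in> sets M" and pos: "emeasure M X1 > 0" and fin: "emeasure M X1 < \<infinity>"
    and single: "\<And>x. x \<in> space M \<Longrightarrow> emeasure M {x} = 0"
  shows "\<exists>E R. measurable_retract (borel :: real measure) M E R \<and> range E \<subseteq> X1 \<and>
     {x \<in> space M. E (R x) = x} \<in> null_sets M"
proof -
  have \<iota>m [measurable]: "\<iota> \<in> M \<rightarrow>\<^sub>M borel" and rm [measurable]: "r \<in> borel \<rightarrow>\<^sub>M M"
    and r: "\<And>x. x \<in> space M \<Longrightarrow> r (\<iota> x) = x"
    using \<iota> by (auto simp: measurable_retract_def)
  have rs: "r t \<in> space M" for t using measurable_space[OF rm] by simp
  have X1s: "X1 \<subseteq> space M" using X1 by (rule sets.sets_into_space)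
  define push where "push X f = distr (restrict_space M X) borel f" for X and f :: "'x \<Rightarrow> real"
  have em: "emeasure (push X f) B = emeasure M (f -` B \<inter> X)"
    if [measurable]: "X \<in> sets M" "f \<in> borel_measurable M" and B: "B \<in> sets borel" for X f B
  proof -
    have X: "X \<subseteq> space M" using sets.sets_into_space[OF that(1)] .
    have "emeasure (push X f) B = emeasure (restrict_space M X) (f -` B \<inter> X)"
      unfolding push_def using X B by (subst emeasure_distr) (auto simp: space_restrict_space2 measurable_restrict_space1)
    also have "\<dots> = emeasure M (f -` B \<inter> X)"
      by (subst emeasure_restrict_space) (use that in auto)
    finally show ?thesis .
  qed
  have fb: "finite_borel_measure (push X f)" if "X \<in> sets M" "f \<in> borel_measurable M" "X \<subseteq> X1" for X f
  proof (intro finite_borel_measure.intro finite_borel_measure_axioms.intro finite_measureI)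
    have "emeasure M X \<le> emeasure M X1" using that X1 by (intro emeasure_mono) auto
    then show "emeasure (push X f) (space (push X f)) \<noteq> \<infinity>"
      using em[OF that(1,2), of UNIV] fin by (auto simp: push_def)
  qed (simp add: push_def)
  \<comment> \<open>This is the image of \<open>X1\<close> under \<open>\<iota>\<close>, in a form
    that is visibly Borel.\<close>
  define B0 where "B0 = {t. \<iota> (r t) = t \<and> r t \<in> X1}"
  have B0 [measurable]: "B0 \<in> sets borel" unfolding B0_def by measurable
  interpret P: finite_borel_measure "push X1 \<iota>" by (rule fb) auto
  have "\<iota> -` B0 \<inter> X1 = X1" using r X1s by (auto simp: B0_def)
  then have "0 < emeasure (push X1 \<iota>) B0" using em[of X1 \<iota> B0] pos by simp
  also have "emeasure (push X1 \<iota>) B0 = (SUP K \<in> {K. K \<subseteq> B0 \<and> compact K}. emeasure (push X1 \<iota>) K)"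
    by (rule inner_regular[OF _ _ B0]) (simp_all add: push_def P.emeasure_finite[unfolded push_def])
  finally obtain K where K: "K \<subseteq> B0" "compact K" "0 < emeasure (push X1 \<iota>) K"
    unfolding less_SUP_iff by auto
  have Kb [measurable]: "K \<in> sets borel" using K(2) by (simp add: borel_compact)
  define X2 where "X2 = \<iota> -` K \<inter> X1"
  have "X2 = (\<iota> -` K \<inter> space M) \<inter> X1" using X1s by (auto simp: X2_def)
  then have X2 [measurable]: "X2 \<in> sets M" by simp
  interpret N: finite_borel_measure "push X2 \<iota>" by (rule fb[OF X2 \<iota>m]) (auto simp: X2_def)
  define m where "m = measure (push X2 \<iota>) (space (push X2 \<iota>))"
  have "\<iota> -` UNIV \<inter> X2 = \<iota> -` K \<inter> X1" by (auto simp: X2_def)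
  then have "emeasure (push X2 \<iota>) UNIV > 0" using em[OF X2 \<iota>m, of UNIV] em[OF X1 \<iota>m Kb] K(3) by simp
  moreover have "space (push X2 \<iota>) = UNIV" by (simp add: push_def)
  ultimately have m: "m > 0" unfolding m_def using N.emeasure_eq_measure[of UNIV] by simp
  have single': "measure (push X2 \<iota>) {t} = 0" for t
  proof -
    have "\<iota> -` {t} \<inter> X2 \<subseteq> {r t}" using r X1s by (auto simp: X2_def)
    moreover have "{r t} \<in> sets M"
    proof -
      have "{r t} = \<iota> -` {\<iota> (r t)} \<inter> space M" using r rs by auto metis
      then show ?thesis by simp
    qed
    ultimately have "emeasure M (\<iota> -` {t} \<inter> X2) \<le> emeasure M {r t}" by (rule emeasure_mono)
    then show ?thesis using em[of X2 \<iota> "{t}"] single[OF rs] by (simp add: measure_def)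
  qed
  \<comment> \<open>Compactness of \<open>K\<close> makes every value of the quantile function \<open>Q\<close> a point of \<open>K\<close>.\<close>
  define F where "F = cdf (push X2 \<iota>)"
  define Q where "Q u = (SOME t. F t = u \<and> (\<forall>s<t. F s < u))" for u
  have Q: "F (Q u) = u" "s < Q u \<Longrightarrow> F s < u" if "0 < u" "u < m" for u s
    using someI_ex[OF N.ex_cdf_eq[OF single', of u]] that unfolding Q_def F_def m_def by auto
  have Fmono: "F s \<le> F t" if "s \<le> t" for s t using N.cdf_nondecreasing that by (simp add: F_def)
  have QK: "Q u \<in> K" if u: "0 < u" "u < m" for u
  proof (rule ccontr)
    assume "Q u \<notin> K"
    moreover have "open (- K)" using K(2) compact_imp_closed by auto
    ultimately obtain e where e: "e > 0" "ball (Q u) e \<subseteq> - K" by (auto elim: openE)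
    \<comment> \<open>An interval ending at \<open>Q u\<close> misses \<open>K\<close> and carries
      no mass, so the distribution function would reach \<open>u\<close> before
      \<open>Q u\<close>.\<close>
    have "{Q u - e/2<..Q u} \<subseteq> ball (Q u) e" using e(1) by (auto simp: dist_real_def)
    then have "\<iota> -` {Q u - e/2<..Q u} \<inter> X2 = {}" using e(2) by (auto simp: X2_def)
    then have "emeasure (push X2 \<iota>) {Q u - e/2<..Q u} = 0"
      using em[of X2 \<iota> "{Q u - e/2<..Q u}"] by simp
    then have "F (Q u) = F (Q u - e/2)"
      using N.cdf_diff_eq[of "Q u - e/2" "Q u"] e(1) by (simp add: F_def measure_def)
    then show False using Q(1)[OF u] Q(2)[OF u, of "Q u - e/2"] e(1) by simp
  qed
  \<comment> \<open>\<open>g\<close> is an increasing bijection from the reals onto the open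
    interval from 0 to \<open>m\<close>, on which quantiles exist; \<open>R0\<close> below applies
    \<open>F\<close> and then the inverse of \<open>g\<close>.\<close>
  define g where "g t = m * (1/2 + arctan t / pi)" for t
  have g: "0 < g t" "g t < m" for t
  proof -
    have "- (1/2) < arctan t / pi" "arctan t / pi < 1/2"
      using arctan_bounded[of t] by (auto simp: field_simps)
    then have "0 < 1/2 + arctan t / pi" "1/2 + arctan t / pi < 1" by linarith+
    then show "0 < g t" "g t < m" using m by (auto simp: g_def)
  qed
  define E0 where "E0 t = Q (g t)" for t
  define R0 where "R0 s = tan (pi * (F s / m - 1/2))" for s
  have "mono E0"
  proof
    fix s t :: real assume st: "s \<le> t"
    show "E0 s \<le> E0 t"
    proof (rule ccontr)
      assume "\<not> E0 s \<le> E0 t"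
      then have "F (Q (g t)) < g s" using Q(2)[OF g, of "Q (g t)" s] by (simp add: E0_def)
      moreover have "g s \<le> g t" using st m by (auto simp: g_def arctan_le_iff intro!: divide_right_mono)
      ultimately show False using Q(1)[OF g] by simp
    qed
  qed
  then have [measurable]: "E0 \<in> borel_measurable borel" by (rule borel_measurable_mono)
  have "mono F" using Fmono by (auto simp: mono_def)
  then have [measurable]: "F \<in> borel_measurable borel" by (rule borel_measurable_mono)
  have [measurable]: "(sin :: real \<Rightarrow> real) \<in> borel_measurable borel" "(cos :: real \<Rightarrow> real) \<in> borel_measurable borel"
    by (auto intro!: borel_measurable_continuous_onI continuous_intros)
  have [measurable]: "R0 \<in> borel_measurable borel" unfolding R0_def tan_def by measurable
  have R0E0: "R0 (E0 t) = t" for t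
  proof -
    have "pi * (F (E0 t) / m - 1/2) = arctan t"
      unfolding E0_def Q(1)[OF g] using m by (simp add: g_def)
    then show ?thesis by (simp add: R0_def tan_arctan)
  qed
  define E1 where "E1 t = r (E0 t)" for t
  define R1 where "R1 x = R0 (\<iota> x)" for x
  have E0K: "E0 t \<in> B0" for t using QK[OF g] K(1) unfolding E0_def by auto
  have R1E1: "R1 (E1 t) = t" and E1X: "E1 t \<in> X1" for t
    using E0K[of t] R0E0 by (auto simp: B0_def E1_def R1_def)
  have [measurable]: "E1 \<in> borel \<rightarrow>\<^sub>M M" "R1 \<in> borel_measurable M"
    unfolding E1_def R1_def by measurable
  obtain j j' where jj: "measurable_retract (borel :: (bool \<Rightarrow> real) measure) (borel :: real measure) j j'"
    using retract_countable_product_real by blast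
  then have [measurable]: "j \<in> borel_measurable borel" "j' \<in> borel_measurable borel" and j'j: "\<And>x. j' (j x) = x"
    by (auto simp: measurable_retract_def)
  have j'm [measurable]: "(\<lambda>t. j' t b) \<in> borel_measurable borel" for b
    by (rule measurable_product_then_coordinatewise) measurable
  \<comment> \<open>The plane embeds into \<open>X1\<close>, and all but countably many of its vertical lines become null sets.\<close>
  define \<kappa> where "\<kappa> = push X1 (\<lambda>x. j' (R1 x) True)"
  interpret k: finite_borel_measure \<kappa> unfolding \<kappa>_def by (rule fb) auto
  have "countable {x. measure \<kappa> {x} \<noteq> 0}" by (rule k.countable_support)
  then have "{x. measure \<kappa> {x} \<noteq> 0} \<noteq> UNIV" using uncountable_UNIV_real by metis
  then obtain c where c: "measure \<kappa> {c} = 0" by auto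
  define E where "E z = E1 (j (\<lambda>b. if b then c else z))" for z
  define R where "R x = j' (R1 x) False" for x
  have "(\<lambda>z. (\<lambda>b. if b then c else z)) \<in> borel_measurable borel"
    by (rule measurable_coordinatewise_then_product) measurable
  then have Em [measurable]: "E \<in> borel \<rightarrow>\<^sub>M M" unfolding E_def by measurable
  have Rm [measurable]: "R \<in> M \<rightarrow>\<^sub>M borel" unfolding R_def by measurable
  have RE: "R (E z) = z" for z by (simp add: R_def E_def R1E1 j'j)
  have im: "{x \<in> space M. E (R x) = x} \<in> sets M"
    by (rule measurable_retract_fixpoints[OF \<iota>]) measurable
  have sub: "{x \<in> space M. E (R x) = x} \<subseteq> (\<lambda>x. j' (R1 x) True) -` {c} \<inter> X1"
  proof
    fix x assume "x \<in> {x \<in> space M. E (R x) = x}"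
    then have "E (R x) = x" by simp
    then have "x = E1 (j (\<lambda>b. if b then c else R x))" by (simp add: E_def)
    then have "x \<in> X1" "R1 x = j (\<lambda>b. if b then c else R x)" using E1X R1E1 by metis+
    then show "x \<in> (\<lambda>x. j' (R1 x) True) -` {c} \<inter> X1" by (simp add: j'j)
  qed
  have "emeasure M ((\<lambda>x. j' (R1 x) True) -` {c} \<inter> X1) = emeasure \<kappa> {c}"
    unfolding \<kappa>_def by (rule em[symmetric]) auto
  also have "\<dots> = 0" using c k.emeasure_eq_measure by simp
  finally have 0: "emeasure M ((\<lambda>x. j' (R1 x) True) -` {c} \<inter> X1) = 0" .
  have "(\<lambda>x. j' (R1 x) True) -` {c} \<inter> X1 = ((\<lambda>x. j' (R1 x) True) -` {c} \<inter> space M) \<inter> X1" using X1s by auto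
  also have "\<dots> \<in> sets M" by measurable
  finally have "(\<lambda>x. j' (R1 x) True) -` {c} \<inter> X1 \<in> null_sets M" using 0 by auto
  then have "{x \<in> space M. E (R x) = x} \<in> null_sets M"
    by (rule null_sets_subset[OF _ im sub])
  moreover have "measurable_retract borel M E R" using RE Em Rm by (simp add: measurable_retract_def)
  moreover have "range E \<subseteq> X1" using E1X by (auto simp: E_def)
  ultimately show ?thesis by blast
qed

section \<open>Measure-preserving bijections\<close>

lemma bij_betw_image_vimage:
  assumes T: "bij_betw T S S" and A: "A \<subseteq> S"
  shows "T ` (T -` A \<inter> S) = A" "T ` A = inv_into S T -` A \<inter> S" "inv_into S T ` A = T -` A \<inter> S"
proof -
  have TS: "T ` S = S" "inj_on T S" using T by (auto simp: bij_betw_def)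
  have iS: "inv_into S T x \<in> S" "T (inv_into S T x) = x" if "x \<in> S" for x
    using that TS(1) inv_into_into[of x T S] f_inv_into_f[of x T S] by auto
  have iT: "inv_into S T (T x) = x" if "x \<in> S" for x
    using TS(2) that by (rule inv_into_f_f)
  show "T ` (T -` A \<inter> S) = A"
  proof
    show "A \<subseteq> T ` (T -` A \<inter> S)"
    proof
      fix x assume "x \<in> A"
      then show "x \<in> T ` (T -` A \<inter> S)" using iS[of x] A by (intro image_eqI[of _ _ "inv_into S T x"]) auto
    qed
  qed auto
  show "T ` A = inv_into S T -` A \<inter> S"
  proof
    show "T ` A \<subseteq> inv_into S T -` A \<inter> S" using iT A TS(1) by auto
    show "inv_into S T -` A \<inter> S \<subseteq> T ` A"
    proof
      fix x assume "x \<in> inv_into S T -` A \<inter> S"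
      then show "x \<in> T ` A" using iS[of x] by (intro image_eqI[of _ _ "inv_into S T x"]) auto
    qed
  qed
  show "inv_into S T ` A = T -` A \<inter> S"
  proof
    show "inv_into S T ` A \<subseteq> T -` A \<inter> S" using iS A by auto
    show "T -` A \<inter> S \<subseteq> inv_into S T ` A"
    proof
      fix x assume "x \<in> T -` A \<inter> S"
      then show "x \<in> inv_into S T ` A" using iT[of x] by (intro image_eqI[of _ _ "T x"]) auto
    qed
  qed
qed

lemma mp_bijD:
  assumes "T \<in> mp_bij M"
  shows "T \<in> M \<rightarrow>\<^sub>M M" "inv_into (space M) T \<in> M \<rightarrow>\<^sub>M M" "bij_betw T (space M) (space M)"
    "T \<in> extensional (space M)" "\<And>A. A \<in> sets M \<Longrightarrow> emeasure M (T ` A) = emeasure M A"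
  using assms by (auto simp: mp_bij_def Bij_def)

lemma mp_bij_simps:
  assumes "T \<in> mp_bij M" "x \<in> space M"
  shows "T x \<in> space M" "inv_into (space M) T x \<in> space M"
    "inv_into (space M) T (T x) = x" "T (inv_into (space M) T x) = x"
  using measurable_space[OF mp_bijD(1)[OF assms(1)] assms(2)] measurable_space[OF mp_bijD(2)[OF assms(1)] assms(2)]
    mp_bijD(3)[OF assms(1)] assms(2)
  by (auto simp: bij_betw_inv_into_left bij_betw_inv_into_right)

lemma mp_bij_image:
  assumes T: "T \<in> mp_bij M" and A: "A \<in> sets M"
  shows "T ` A = inv_into (space M) T -` A \<inter> space M" "T ` A \<in> sets M"
proof -
  have "A \<subseteq> space M" using A by (rule sets.sets_into_space)
  then show *: "T ` A = inv_into (space M) T -` A \<inter> space M"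
    by (rule bij_betw_image_vimage(2)[OF mp_bijD(3)[OF T]])
  show "T ` A \<in> sets M" unfolding * using mp_bijD(2)[OF T] A by (rule measurable_sets)
qed

lemma mp_bij_inv:
  assumes T: "T \<in> mp_bij M"
  shows "restrict (inv_into (space M) T) (space M) \<in> mp_bij M"
proof -
  let ?R = "restrict (inv_into (space M) T) (space M)"
  have b: "bij_betw ?R (space M) (space M)"
    using bij_betw_inv_into[OF mp_bijD(3)[OF T]] by (simp cong: bij_betw_cong)
  have inv: "inv_into (space M) ?R x = T x" if "x \<in> space M" for x
    using inv_into_f_eq[OF bij_betw_imp_inj_on[OF b], of "T x" x] that mp_bij_simps[OF T] by simp
  have "?R \<in> M \<rightarrow>\<^sub>M M" using mp_bijD(2)[OF T] by (simp cong: measurable_cong)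
  moreover have "inv_into (space M) ?R \<in> M \<rightarrow>\<^sub>M M"
    using mp_bijD(1)[OF T] inv by (simp cong: measurable_cong)
  moreover have "emeasure M (?R ` A) = emeasure M A" if A: "A \<in> sets M" for A
  proof -
    have As: "A \<subseteq> space M" using A by (rule sets.sets_into_space)
    have "?R ` A = T -` A \<inter> space M"
      using bij_betw_image_vimage(3)[OF mp_bijD(3)[OF T] As] As by (simp add: subset_iff)
    moreover have "T -` A \<inter> space M \<in> sets M" using mp_bijD(1)[OF T] A by (rule measurable_sets)
    moreover have "T ` (T -` A \<inter> space M) = A"
      by (rule bij_betw_image_vimage(1)[OF mp_bijD(3)[OF T] As])
    ultimately show ?thesis using mp_bijD(5)[OF T] by metis
  qed
  ultimately show ?thesis using b by (auto simp: mp_bij_def Bij_def)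
qed

lemma mp_bij_AE:
  assumes T: "T \<in> mp_bij M" and P: "AE x in M. P x"
  shows "AE x in M. P (T x)" "AE x in M. P (inv_into (space M) T x)"
proof -
  have *: "AE x in M. P (S x)" if S: "S \<in> mp_bij M" for S
  proof -
    obtain N where N: "{x \<in> space M. \<not> P x} \<subseteq> N" "emeasure M N = 0" "N \<in> sets M"
      using P by (rule AE_E)
    have Ns: "N \<subseteq> space M" using N(3) by (rule sets.sets_into_space)
    have "S ` (S -` N \<inter> space M) = N"
      by (rule bij_betw_image_vimage(1)[OF mp_bijD(3)[OF S] Ns])
    moreover have "S -` N \<inter> space M \<in> sets M" using mp_bijD(1)[OF S] N(3) by (rule measurable_sets)
    moreover have "{x \<in> space M. \<not> P (S x)} \<subseteq> S -` N \<inter> space M"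
      using N(1) mp_bij_simps(1)[OF S] by (auto dest: subsetD)
    ultimately show ?thesis
      using N(2) mp_bijD(5)[OF S, of "S -` N \<inter> space M"] by (intro AE_I[of M _ "S -` N \<inter> space M"]) simp_all
  qed
  show "AE x in M. P (T x)" by (rule *[OF T])
  have "AE x in M. P (restrict (inv_into (space M) T) (space M) x)" by (rule *[OF mp_bij_inv[OF T]])
  then show "AE x in M. P (inv_into (space M) T x)" by (simp cong: AE_cong)
qed

lemma mp_bij_AE_iff:
  assumes T: "T \<in> mp_bij M"
  shows "(AE x in M. P (T x)) \<longleftrightarrow> (AE x in M. P x)"
proof
  assume "AE x in M. P (T x)"
  then have "AE x in M. P (T (inv_into (space M) T x))" by (rule mp_bij_AE(2)[OF T])
  then show "AE x in M. P x" using mp_bij_simps(4)[OF T] by (simp cong: AE_cong)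
qed (rule mp_bij_AE(1)[OF T])

lemma mp_bij_emeasure_vimage:
  assumes T: "T \<in> mp_bij M" and A: "A \<in> sets M"
  shows "emeasure M (T -` A \<inter> space M) = emeasure M A"
    and "emeasure M (inv_into (space M) T -` A \<inter> space M) = emeasure M A"
proof -
  have As: "A \<subseteq> space M" using A by (rule sets.sets_into_space)
  have "T ` (T -` A \<inter> space M) = A"
    by (rule bij_betw_image_vimage(1)[OF mp_bijD(3)[OF T] As])
  moreover have "T -` A \<inter> space M \<in> sets M" using mp_bijD(1)[OF T] A by (rule measurable_sets)
  ultimately show "emeasure M (T -` A \<inter> space M) = emeasure M A" using mp_bijD(5)[OF T] by metis
  show "emeasure M (inv_into (space M) T -` A \<inter> space M) = emeasure M A"
    using mp_bijD(5)[OF T A] mp_bij_image(1)[OF T A] by simp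
qed

text \<open>The equation may be evaluated at the inverse image of \<open>x\<close> under
  \<open>T\<close>, because \<open>T\<close> preserves null sets; injectivity of \<open>S\<close>
  does the rest.\<close>

lemma AE_inv_into_eq:
  assumes S: "bij_betw S (space M) (space M)" and T: "T \<in> mp_bij M" and eq: "AE x in M. S x = T x"
  shows "AE x in M. inv_into (space M) S x = inv_into (space M) T x"
proof -
  have "AE x in M. S (inv_into (space M) T x) = T (inv_into (space M) T x)"
    using eq by (rule mp_bij_AE(2)[OF T])
  then show ?thesis
  proof (rule AE_mp, intro AE_I2 impI)
    fix x assume x: "x \<in> space M" and "S (inv_into (space M) T x) = T (inv_into (space M) T x)"
    then have "S (inv_into (space M) T x) = x" using mp_bij_simps[OF T] by simp
    then show "inv_into (space M) S x = inv_into (space M) T x"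
      using inv_into_f_eq[OF bij_betw_imp_inj_on[OF S]] mp_bij_simps(2)[OF T x] by metis
  qed
qed

text \<open>An image under a bijection is a preimage under its inverse, and the two inverses agree
  almost everywhere. Thus the constructed action inherits measure preservation from the
  representatives.\<close>

lemma mp_bij_of_AE:
  assumes S: "S \<in> Bij (space M)" "S \<in> M \<rightarrow>\<^sub>M M" "inv_into (space M) S \<in> M \<rightarrow>\<^sub>M M"
    and T: "T \<in> mp_bij M" and eq: "AE x in M. S x = T x"
  shows "S \<in> mp_bij M"
proof -
  have b: "bij_betw S (space M) (space M)" using S(1) by (simp add: Bij_def)
  have "emeasure M (S ` A) = emeasure M A" if A: "A \<in> sets M" for A
  proof -
    have As: "A \<subseteq> space M" using A by (rule sets.sets_into_space)
    have "S ` A = inv_into (space M) S -` A \<inter> space M"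
      by (rule bij_betw_image_vimage(2)[OF b As])
    also have "emeasure M \<dots> = emeasure M (inv_into (space M) T -` A \<inter> space M)"
    proof (rule emeasure_eq_AE)
      show "AE x in M. (x \<in> inv_into (space M) S -` A \<inter> space M) = (x \<in> inv_into (space M) T -` A \<inter> space M)"
        using AE_inv_into_eq[OF b T eq] by eventually_elim auto
      show "inv_into (space M) S -` A \<inter> space M \<in> sets M" using S(3) A by (rule measurable_sets)
      show "inv_into (space M) T -` A \<inter> space M \<in> sets M" using mp_bijD(2)[OF T] A by (rule measurable_sets)
    qed
    also have "\<dots> = emeasure M A" by (rule mp_bij_emeasure_vimage(2)[OF T A])
    finally show ?thesis .
  qed
  then show ?thesis using S by (auto simp: mp_bij_def)
qed

lemma mp_bij_compose:
  assumes S: "S \<in> mp_bij M" and T: "T \<in> mp_bij M"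
  shows "compose (space M) S T \<in> mp_bij M"
proof -
  let ?C = "compose (space M) S T"
  have B: "?C \<in> Bij (space M)"
    using S T by (intro compose_Bij) (auto simp: mp_bij_def)
  then have b: "bij_betw ?C (space M) (space M)" by (simp add: Bij_def)
  have "?C \<in> M \<rightarrow>\<^sub>M M"
    using measurable_comp[OF mp_bijD(1)[OF T] mp_bijD(1)[OF S]] by (simp add: compose_def cong: measurable_cong)
  moreover have "inv_into (space M) ?C \<in> M \<rightarrow>\<^sub>M M"
  proof -
    have "inv_into (space M) ?C x = (inv_into (space M) T \<circ> inv_into (space M) S) x" if "x \<in> space M" for x
      using inv_into_f_eq[OF bij_betw_imp_inj_on[OF b]] mp_bij_simps[OF S that] that
        mp_bij_simps[OF T, of "inv_into (space M) S x"] by (simp add: compose_eq)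
    then show ?thesis
      using measurable_comp[OF mp_bijD(2)[OF S] mp_bijD(2)[OF T]] by (simp cong: measurable_cong)
  qed
  moreover have "emeasure M (?C ` A) = emeasure M A" if A: "A \<in> sets M" for A
  proof -
    have "?C ` A = S ` T ` A" using sets.sets_into_space[OF A] by (force simp: compose_def)
    then show ?thesis using mp_bijD(5)[OF T A] mp_bijD(5)[OF S mp_bij_image(2)[OF T A]] by simp
  qed
  ultimately show ?thesis using B by (auto simp: mp_bij_def)
qed

lemma aut_class_iff: "S \<in> aut_class M T \<longleftrightarrow> S \<in> mp_bij M \<and> T \<in> mp_bij M \<and> (AE x in M. T x = S x)"
  by (auto simp: aut_class_def ae_equal_def)

lemma aut_class_eqI:
  assumes "S \<in> mp_bij M" "T \<in> mp_bij M" "AE x in M. S x = T x"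
  shows "aut_class M S = aut_class M T"
proof (rule Set.set_eqI)
  fix U
  have "(AE x in M. S x = U x) \<longleftrightarrow> (AE x in M. T x = U x)"
  proof
    assume "AE x in M. S x = U x" with assms(3) show "AE x in M. T x = U x" by eventually_elim simp
  next
    assume "AE x in M. T x = U x" with assms(3) show "AE x in M. S x = U x" by eventually_elim simp
  qed
  then show "U \<in> aut_class M S \<longleftrightarrow> U \<in> aut_class M T" using assms(1,2) by (auto simp: aut_class_iff)
qed

text \<open>The representatives are chosen independently of each other, so the group law survives
  only almost everywhere, with a null set depending on the pair.\<close>

lemma hom_Aut_representatives:
  assumes G: "group G" and \<alpha>: "\<alpha> \<in> hom G (Aut M)"
  obtains S where "\<And>g. g \<in> carrier G \<Longrightarrow> S g \<in> mp_bij M"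
    and "\<And>g. g \<in> carrier G \<Longrightarrow> \<alpha> g = aut_class M (S g)"
    and "\<And>g h. g \<in> carrier G \<Longrightarrow> h \<in> carrier G \<Longrightarrow> AE x in M. S (g \<otimes>\<^bsub>G\<^esub> h) x = S g (S h x)"
    and "AE x in M. S \<one>\<^bsub>G\<^esub> x = x"
proof -
  interpret group G by fact
  have "\<exists>T\<in>mp_bij M. \<alpha> g = aut_class M T" if "g \<in> carrier G" for g
    using \<alpha> that by (auto simp: hom_def Aut_def aut_class_def elim!: quotientE dest!: PiE funcset_mem)
  then obtain S where S: "\<And>g. g \<in> carrier G \<Longrightarrow> S g \<in> mp_bij M"
    "\<And>g. g \<in> carrier G \<Longrightarrow> \<alpha> g = aut_class M (S g)" by metis
  have mult: "AE x in M. S (g \<otimes>\<^bsub>G\<^esub> h) x = S g (S h x)" if gh: "g \<in> carrier G" "h \<in> carrier G" for g h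
  proof -
    let ?C = "compose (space M) (S g) (S h)"
    have "\<alpha> (g \<otimes>\<^bsub>G\<^esub> h) = \<alpha> g \<otimes>\<^bsub>Aut M\<^esub> \<alpha> h" using \<alpha> gh by (auto simp: hom_def)
    also have "\<dots> = (\<Union>P\<in>\<alpha> g. \<Union>Q\<in>\<alpha> h. aut_class M (P \<otimes>\<^bsub>BijGroup (space M)\<^esub> Q))" by (simp add: Aut_def)
    finally have "\<alpha> (g \<otimes>\<^bsub>G\<^esub> h) = (\<Union>P\<in>\<alpha> g. \<Union>Q\<in>\<alpha> h. aut_class M (P \<otimes>\<^bsub>BijGroup (space M)\<^esub> Q))" .
    moreover have "S g \<in> \<alpha> g" "S h \<in> \<alpha> h"
      using S[OF gh(1)] S[OF gh(2)] by (simp_all add: aut_class_iff)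
    \<comment> \<open>The product of two classes is a union over all their representatives; the term
      of the chosen ones already identifies the class.\<close>
    ultimately have "aut_class M (S g \<otimes>\<^bsub>BijGroup (space M)\<^esub> S h) \<subseteq> \<alpha> (g \<otimes>\<^bsub>G\<^esub> h)" by blast
    moreover have "S g \<otimes>\<^bsub>BijGroup (space M)\<^esub> S h = ?C"
      using S(1)[OF gh(1)] S(1)[OF gh(2)] by (simp add: BijGroup_def mp_bij_def)
    moreover have "?C \<in> aut_class M ?C"
      using mp_bij_compose[OF S(1) S(1), OF gh] by (simp add: aut_class_iff)
    ultimately have "?C \<in> aut_class M (S (g \<otimes>\<^bsub>G\<^esub> h))" using S(2) gh by auto
    then have "AE x in M. S (g \<otimes>\<^bsub>G\<^esub> h) x = ?C x" by (simp add: aut_class_iff)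
    then show ?thesis by (rule AE_mp) (auto simp: compose_eq)
  qed
  \<comment> \<open>An injective map that is idempotent almost everywhere is the identity almost everywhere.\<close>
  have one: "AE x in M. S \<one>\<^bsub>G\<^esub> x = x"
    using mult[OF one_closed one_closed]
  proof (rule AE_mp, intro AE_I2 impI)
    fix x assume x: "x \<in> space M" and "S (\<one>\<^bsub>G\<^esub> \<otimes>\<^bsub>G\<^esub> \<one>\<^bsub>G\<^esub>) x = S \<one>\<^bsub>G\<^esub> (S \<one>\<^bsub>G\<^esub> x)"
    then show "S \<one>\<^bsub>G\<^esub> x = x" using mp_bij_simps[OF S(1)[OF one_closed]] by (metis l_one one_closed)
  qed
  show ?thesis by (rule that[OF S mult one])
qed

section \<open>A compact space of functions on the group\<close>

text \<open>Only group and topology enter here: \<open>\<rho>\<close> abstracts the essential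
  supremum distances between translates. Right invariance makes right translations isometries, and
  continuity of \<open>\<rho>\<close> makes 1-Lipschitz functions continuous on
  \<open>G\<close>.\<close>

locale invariant_pseudometrics = group G for G :: "('g, 'm) monoid_scheme" (structure) +
  fixes TG :: "'g topology" and \<rho> :: "nat \<Rightarrow> 'g \<Rightarrow> 'g \<Rightarrow> real" and d :: "nat \<Rightarrow> 'g"
  assumes topspace_G: "topspace TG = carrier G"
    and continuous_mult: "continuous_map (prod_topology TG TG) TG (\<lambda>(g, h). g \<otimes> h)"
    and rho_refl: "g \<in> carrier G \<Longrightarrow> \<rho> n g g = 0"
    and rho_sym: "g \<in> carrier G \<Longrightarrow> h \<in> carrier G \<Longrightarrow> \<rho> n g h = \<rho> n h g"
    and rho_triangle: "g \<in> carrier G \<Longrightarrow> h \<in> carrier G \<Longrightarrow> k \<in> carrier G \<Longrightarrow> \<rho> n g k \<le> \<rho> n g h + \<rho> n h k"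
    and rho_invariant: "g \<in> carrier G \<Longrightarrow> h \<in> carrier G \<Longrightarrow> k \<in> carrier G \<Longrightarrow> \<rho> n (g \<otimes> k) (h \<otimes> k) = \<rho> n g h"
    and rho_continuous: "g \<in> carrier G \<Longrightarrow> 0 < e \<Longrightarrow> \<exists>U. openin TG U \<and> g \<in> U \<and> (\<forall>h\<in>U. \<rho> n h g < e)"
    and d_closed [simp]: "d i \<in> carrier G"
    and d_dense: "openin TG U \<Longrightarrow> U \<noteq> {} \<Longrightarrow> \<exists>i. d i \<in> U"
begin

text \<open>The coordinate \<open>z (n, i)\<close> is the value of the \<open>n\<close>-th function at \<open>d i\<close>, and \<open>extend\<close> is
  McShane's formula for the Lipschitz extension to \<open>G\<close>.\<close>

definition Z :: "(nat \<times> nat \<Rightarrow> real) set" where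
  "Z = {z. (\<forall>k. 0 \<le> z k \<and> z k \<le> 1) \<and> (\<forall>n i j. z (n, i) - z (n, j) \<le> \<rho> n (d i) (d j))}"

definition extend :: "(nat \<times> nat \<Rightarrow> real) \<Rightarrow> nat \<Rightarrow> 'g \<Rightarrow> real" where
  "extend z n g = (INF i. z (n, i) + \<rho> n g (d i))"

text \<open>Right translation sends a function \<open>z\<close> to
  \<open>h \<mapsto> z (h \<otimes> g)\<close>, sampled again along \<open>d\<close>. Translating on
  the right is what makes this a left action.\<close>

definition act :: "'g \<Rightarrow> (nat \<times> nat \<Rightarrow> real) \<Rightarrow> nat \<times> nat \<Rightarrow> real" where
  "act g z = (\<lambda>(n, i). extend z n (d i \<otimes> g))"

lemma rho_nonneg: "g \<in> carrier G \<Longrightarrow> h \<in> carrier G \<Longrightarrow> 0 \<le> \<rho> n g h"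
  using rho_triangle[of g h g n] rho_refl[of g n] rho_sym[of g h n] by simp

lemma ex_d_close:
  assumes "g \<in> carrier G" "0 < e"
  shows "\<exists>i. \<rho> n (d i) g < e"
proof -
  obtain U where "openin TG U" "g \<in> U" "\<forall>h\<in>U. \<rho> n h g < e" using rho_continuous[OF assms] by blast
  then show ?thesis using d_dense[of U] by blast
qed

lemma extend_bdd: "z \<in> Z \<Longrightarrow> g \<in> carrier G \<Longrightarrow> bdd_below (range (\<lambda>i. z (n, i) + \<rho> n g (d i)))"
  by (rule bdd_belowI[of _ 0]) (auto simp: Z_def intro!: add_nonneg_nonneg rho_nonneg)

lemma extend_d: "z \<in> Z \<Longrightarrow> extend z n (d i) = z (n, i)"
proof (rule antisym)
  assume z: "z \<in> Z"
  show "extend z n (d i) \<le> z (n, i)"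
    unfolding extend_def using cINF_lower[OF extend_bdd[OF z d_closed, of n i], of i] rho_refl[of "d i" n] by simp
  show "z (n, i) \<le> extend z n (d i)"
    unfolding extend_def by (rule cINF_greatest) (use z in \<open>auto simp: Z_def algebra_simps\<close>)
qed

lemma extend_lipschitz:
  assumes z: "z \<in> Z" and gh: "g \<in> carrier G" "h \<in> carrier G"
  shows "\<bar>extend z n g - extend z n h\<bar> \<le> \<rho> n g h"
proof -
  have *: "extend z n g \<le> extend z n h + \<rho> n g h" if "g \<in> carrier G" "h \<in> carrier G" for g h
  proof -
    have "extend z n g - \<rho> n g h \<le> extend z n h"
      unfolding extend_def[of z n h]
    proof (rule cINF_greatest)
      fix i
      have "extend z n g \<le> z (n, i) + \<rho> n g (d i)"
        unfolding extend_def by (rule cINF_lower[OF extend_bdd[OF z that(1)]]) simp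
      then show "extend z n g - \<rho> n g h \<le> z (n, i) + \<rho> n h (d i)"
        using rho_triangle[OF that d_closed, of n i] by simp
    qed simp
    then show ?thesis by simp
  qed
  show ?thesis using *[OF gh] *[OF gh(2,1)] rho_sym[OF gh] by (simp add: abs_le_iff)
qed

text \<open>Two 1-Lipschitz functions that agree on a dense sequence are equal. This recognises
  other Lipschitz functions, in particular right translates, as values of
  \<open>extend\<close>.\<close>

lemma extend_unique:
  assumes z: "z \<in> Z" and g: "g \<in> carrier G"
    and lip: "\<And>g h. g \<in> carrier G \<Longrightarrow> h \<in> carrier G \<Longrightarrow> \<bar>f g - f h\<bar> \<le> \<rho> n g h"
    and fd: "\<And>i. f (d i) = z (n, i)"
  shows "extend z n g = f g"
proof -
  have "\<bar>extend z n g - f g\<bar> \<le> 0 + e" if e: "e > 0" for e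
  proof -
    obtain i where i: "\<rho> n (d i) g < e / 2" using ex_d_close[OF g, of "e/2"] e by auto
    have "\<bar>extend z n (d i) - extend z n g\<bar> \<le> \<rho> n (d i) g" "\<bar>f (d i) - f g\<bar> \<le> \<rho> n (d i) g"
      using extend_lipschitz[OF z d_closed g] lip[OF d_closed g] by auto
    then show ?thesis using i extend_d[OF z] fd[of i] by (simp add: abs_le_iff)
  qed
  then have "\<bar>extend z n g - f g\<bar> \<le> 0" by (rule field_le_epsilon)
  then show ?thesis by simp
qed

lemma extend_range:
  assumes z: "z \<in> Z" and g: "g \<in> carrier G"
  shows "0 \<le> extend z n g" "extend z n g \<le> 1"
proof -
  have "0 \<le> extend z n g \<and> extend z n g \<le> 1 + e" if e: "e > 0" for e
  proof -
    obtain i where i: "\<rho> n (d i) g < e" using ex_d_close[OF g e] by auto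
    have "extend z n g \<le> z (n, i) + \<rho> n (d i) g"
      using extend_lipschitz[OF z d_closed g, of n i] extend_d[OF z, of n i] by (simp add: abs_le_iff)
    moreover have "0 \<le> extend z n g" unfolding extend_def
      by (rule cINF_greatest) (use z g in \<open>auto simp: Z_def intro!: add_nonneg_nonneg rho_nonneg\<close>)
    ultimately show ?thesis using z i by (auto simp: Z_def intro: order_trans[OF _ add_mono])
  qed
  then show "0 \<le> extend z n g" "extend z n g \<le> 1" by (auto intro: field_le_epsilon zero_less_one)
qed

lemma act_Z:
  assumes z: "z \<in> Z" and g: "g \<in> carrier G"
  shows "act g z \<in> Z"
proof -
  have "extend z n (d i \<otimes> g) - extend z n (d j \<otimes> g) \<le> \<rho> n (d i) (d j)" for n i j
    using extend_lipschitz[OF z, of "d i \<otimes> g" "d j \<otimes> g" n] g rho_invariant[of "d i" "d j" g n] by (simp add: abs_le_iff)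
  then show ?thesis using extend_range[OF z] g by (auto simp: Z_def act_def)
qed

lemma extend_act:
  assumes z: "z \<in> Z" and g: "g \<in> carrier G" "h \<in> carrier G"
  shows "extend (act g z) n h = extend z n (h \<otimes> g)"
proof (rule extend_unique[OF act_Z[OF z g(1)] g(2), where f = "\<lambda>h. extend z n (h \<otimes> g)"])
  fix h k assume "h \<in> carrier G" "k \<in> carrier G"
  then show "\<bar>extend z n (h \<otimes> g) - extend z n (k \<otimes> g)\<bar> \<le> \<rho> n h k"
    using extend_lipschitz[OF z, of "h \<otimes> g" "k \<otimes> g" n] rho_invariant[of h k g n] g by simp
qed (simp add: act_def)

lemma act_mult:
  assumes "z \<in> Z" "g \<in> carrier G" "h \<in> carrier G"
  shows "act (g \<otimes> h) z = act g (act h z)"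
  using assms by (auto simp: act_def[of g "act h z"] extend_act m_assoc) (simp add: act_def)

lemma act_one: "z \<in> Z \<Longrightarrow> act \<one> z = z"
  by (auto simp: act_def extend_d)

lemma zero_Z: "(\<lambda>_. 0) \<in> Z"
  by (auto simp: Z_def intro: rho_nonneg)

lemma act_zero: "g \<in> carrier G \<Longrightarrow> act g (\<lambda>_. 0) = (\<lambda>_. 0)"
  using extend_unique[OF zero_Z, where f = "\<lambda>_. 0"] rho_nonneg by (auto simp: act_def fun_eq_iff)

definition Y :: "(nat \<times> nat \<Rightarrow> real) set" where "Y = Z - {\<lambda>_. 0}"

text \<open>Zero is fixed by every group element, so by invertibility nothing else is moved to
  it.\<close>

lemma act_Y:
  assumes "z \<in> Y" "g \<in> carrier G"
  shows "act g z \<in> Y"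
proof -
  have z: "z \<in> Z" "z \<noteq> (\<lambda>_. 0)" using assms by (auto simp: Y_def)
  have "act (inv g) (act g z) = z" using act_mult[OF z(1), of "inv g" g] act_one[OF z(1)] assms(2) by simp
  then have "act g z \<noteq> (\<lambda>_. 0)" using act_zero[of "inv g"] assms(2) z(2) by auto
  then show ?thesis using act_Z[OF z(1) assms(2)] by (simp add: Y_def)
qed

lemma closed_Z: "closed Z"
proof -
  have c: "continuous_on UNIV (\<lambda>z :: nat \<times> nat \<Rightarrow> real. z k)" for k by (rule continuous_on_product_coordinates)
  show ?thesis unfolding Z_def
    by (intro closed_Collect_conj closed_Collect_all closed_Collect_le continuous_intros c)
qed

lemma compact_Z: "compact Z"
proof -
  have "compactin (product_topology (\<lambda>_::nat \<times> nat. euclideanreal) UNIV) (PiE UNIV (\<lambda>_. {0..1}))"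
    unfolding compactin_PiE by auto
  then have "compact (PiE UNIV (\<lambda>_::nat \<times> nat. {0..1::real}))"
    unfolding euclidean_product_topology by (simp add: compactin_euclidean_iff)
  moreover have "Z \<subseteq> PiE UNIV (\<lambda>_. {0..1})" by (auto simp: Z_def)
  ultimately show ?thesis using closed_Z by (metis compact_Int_closed inf.absorb_iff2)
qed

lemma Y_open_in_Z: "openin (top_of_set Z) Y"
proof -
  have "Y = Z \<inter> - {\<lambda>_. 0}" by (auto simp: Y_def)
  then show ?thesis by (metis closed_singleton open_Compl openin_open_Int)
qed

lemma locally_compact_Y: "locally_compact_space (top_of_set Y)"
proof -
  have lcZ: "locally_compact_space (top_of_set Z)"
    using compact_Z by (intro compact_imp_locally_compact_space) (simp add: compact_space_subtopology compactin_euclidean_iff)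
  have "locally_compact_space (subtopology (top_of_set Z) Y)"
    by (rule locally_compact_space_open_subset[OF disjI1[OF Hausdorff_space_subtopology[OF Hausdorff_space_euclidean]] lcZ Y_open_in_Z])
  then show ?thesis by (simp add: subtopology_subtopology Y_def Int_absorb1 Diff_subset)
qed

lemma polish_Y: "polish_topology (top_of_set Y)"
proof -
  have "completely_metrizable_space (top_of_set Z)"
    using closed_Z by (intro completely_metrizable_space_closedin completely_metrizable_space_euclidean) auto
  then have "completely_metrizable_space (subtopology (top_of_set Z) Y)"
    using Y_open_in_Z by (rule completely_metrizable_space_openin)
  then have "completely_metrizable_space (top_of_set Y)"
    by (simp add: subtopology_subtopology Y_def Int_absorb1 Diff_subset)
  moreover have "separable_space (top_of_set Y)"
  proof (intro second_countable_imp_separable_space second_countable_subtopology)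
    obtain B :: "(nat \<times> nat \<Rightarrow> real) set set" where B: "countable B" "topological_basis B"
      using ex_countable_basis by blast
    show "second_countable (euclidean :: (nat \<times> nat \<Rightarrow> real) topology)"
      unfolding second_countable_def
      using B topological_basis_open[OF B(2)] topological_basisE[OF B(2)]
      by (intro exI[of _ B]) (auto, metis)
  qed
  ultimately show ?thesis by (simp add: polish_topology_def)
qed

lemma borel_Y [measurable]: "Y \<in> sets borel"
  unfolding Y_def using closed_Z by (intro sets.Diff borel_closed closed_singleton)

text \<open>All elements of \<open>Z\<close> share the same Lipschitz bound, so the value at points
  near \<open>d i \<otimes> g0\<close> is controlled, uniformly in \<open>z\<close>, by the single
  coordinate \<open>z (n, j)\<close> for which \<open>d j\<close> is close to that point.\<close>

lemma continuous_act: "continuous_map (prod_topology TG (top_of_set Z)) (top_of_set Z) (\<lambda>(g, z). act g z)"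
proof -
  have co: "continuous_map (prod_topology TG (top_of_set Z)) euclideanreal (\<lambda>x. case_prod act x (n, i))" for n i
    unfolding Met_TC.continuous_map_to_metric[unfolded mtopology_is_euclidean]
  proof (intro ballI allI impI)
    fix x and e :: real assume x: "x \<in> topspace (prod_topology TG (top_of_set Z))" and e: "e > 0"
    obtain g0 z0 where x_eq: "x = (g0, z0)" by force
    have g0: "g0 \<in> carrier G" and z0: "z0 \<in> Z" using x topspace_G by (auto simp: x_eq)
    have dg: "d i \<otimes> g0 \<in> carrier G" using g0 by simp
    \<comment> \<open>Four errors below \<open>e/5\<close> will be added: one for moving
      \<open>g\<close>, one each for passing to \<open>d j\<close> with \<open>z\<close> and with
      \<open>z0\<close>, and one for comparing \<open>z\<close> with \<open>z0\<close>
      there.\<close>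
    obtain j where j: "\<rho> n (d j) (d i \<otimes> g0) < e/5" using ex_d_close[OF dg, of "e/5"] e by auto
    obtain U where U: "openin TG U" "d i \<otimes> g0 \<in> U" "\<forall>h\<in>U. \<rho> n h (d i \<otimes> g0) < e/5"
      using rho_continuous[OF dg, of "e/5"] e by auto
    define V where "V = {g \<in> topspace TG. d i \<otimes> g \<in> U}"
    have "continuous_map TG (prod_topology TG TG) (\<lambda>g. (d i, g))"
      by (intro continuous_map_pairedI continuous_map_id[unfolded id_def]) (simp add: topspace_G)
    then have "continuous_map TG TG (\<lambda>g. d i \<otimes> g)"
      using continuous_map_compose[OF _ continuous_mult] by (fastforce simp: comp_def)
    then have V: "openin TG V" unfolding V_def by (rule openin_continuous_map_preimage) (rule U(1))
    define W where "W = {z :: nat \<times> nat \<Rightarrow> real. \<bar>z (n, j) - z0 (n, j)\<bar> < e/5} \<inter> Z"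
    have "open {z :: nat \<times> nat \<Rightarrow> real. \<bar>z (n, j) - z0 (n, j)\<bar> < e/5}"
      by (intro open_Collect_less continuous_intros continuous_on_product_coordinates)
    then have W: "openin (top_of_set Z) W" unfolding W_def by (metis Int_commute openin_open_Int)
    show "\<exists>U. openin (prod_topology TG (top_of_set Z)) U \<and> x \<in> U \<and>
        (\<forall>y\<in>U. case_prod act y (n, i) \<in> Met_TC.mball (case_prod act x (n, i)) e)"
    proof (intro exI conjI ballI)
      show "openin (prod_topology TG (top_of_set Z)) (V \<times> W)" using V W by (simp add: openin_prod_Times_iff)
      show "x \<in> V \<times> W" using g0 z0 U(2) e by (simp add: x_eq V_def W_def topspace_G)
      fix y assume "y \<in> V \<times> W"
      then obtain g z where y: "y = (g, z)" "g \<in> V" "z \<in> W" by auto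
      have g: "g \<in> carrier G" "d i \<otimes> g \<in> U" and z: "z \<in> Z" "\<bar>z (n, j) - z0 (n, j)\<bar> < e/5"
        using y by (auto simp: V_def W_def topspace_G)
      have dg': "d i \<otimes> g \<in> carrier G" using g by simp
      have "\<bar>extend z n (d i \<otimes> g) - extend z n (d i \<otimes> g0)\<bar> < e/5"
        using extend_lipschitz[OF z(1) dg' dg, of n] U(3) g(2) by fastforce
      moreover have "\<bar>extend z n (d j) - extend z n (d i \<otimes> g0)\<bar> < e/5"
        using extend_lipschitz[OF z(1) d_closed dg, of n j] j by simp
      moreover have "\<bar>extend z0 n (d j) - extend z0 n (d i \<otimes> g0)\<bar> < e/5"
        using extend_lipschitz[OF z0 d_closed dg, of n j] j by simp
      moreover have "extend z n (d j) = z (n, j)" "extend z0 n (d j) = z0 (n, j)" using extend_d z(1) z0 by auto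
      ultimately have "\<bar>extend z n (d i \<otimes> g) - extend z0 n (d i \<otimes> g0)\<bar> < e" using z(2) by linarith
      then show "case_prod act y (n, i) \<in> Met_TC.mball (case_prod act x (n, i)) e"
        by (simp add: y x_eq act_def dist_real_def abs_minus_commute)
    qed
  qed
  have "continuous_map (prod_topology TG (top_of_set Z)) (product_topology (\<lambda>_. euclideanreal) UNIV) (case_prod act)"
    by (rule continuous_map_coordinatewise_then_product) (use co in auto)
  then show ?thesis
    unfolding euclidean_product_topology continuous_map_in_subtopology
    using act_Z by (auto simp: topspace_G case_prod_unfold)
qed

text \<open>Open sets of a metrizable space are increasing countable unions of closed sets. Removing
  0 from the ambient open set beforehand keeps their intersections with the compact \<open>Z\<close>
  inside \<open>Y\<close>.\<close>

lemma sigma_compact_open: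
  assumes "openin (top_of_set Y) U"
  shows "\<exists>K. incseq K \<and> (\<forall>m. compact (K m) \<and> K m \<subseteq> U) \<and> (\<Union>m. K m) = U"
proof -
  obtain O' where O': "open O'" "U = Y \<inter> O'" using assms by (auto simp: openin_open)
  have "open (O' - {\<lambda>_. 0})" using O'(1) by (simp add: open_Diff)
  then have "fsigma_in euclidean (O' - {\<lambda>_. 0})"
    by (intro open_imp_fsigma_in) (auto simp: metrizable_space_euclidean)
  then obtain C where C: "\<And>m::nat. closedin euclidean (C m)" "\<And>m. C m \<subseteq> C (Suc m)" "(\<Union>m. C m) = O' - {\<lambda>_. 0}"
    unfolding fsigma_in_ascending by auto
  show ?thesis
  proof (intro exI conjI allI)
    show "incseq (\<lambda>m. C m \<inter> Z)" using C(2) by (intro incseq_SucI) auto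
    show "compact (C m \<inter> Z)" for m using compact_Z C(1) by (metis closed_Int_compact closed_closedin)
    show "C m \<inter> Z \<subseteq> U" for m using C(3) by (auto simp: O' Y_def)
    show "(\<Union>m. C m \<inter> Z) = U" using C(3) by (auto simp: O' Y_def)
  qed
qed

end

section \<open>Borel isomorphisms that agree almost everywhere with a given map\<close>

lemma measurable_retract_image_product:
  fixes i :: "'a \<Rightarrow> 'i::countable \<Rightarrow> real"
  assumes [measurable]: "i \<in> borel_measurable A" "i' \<in> borel \<rightarrow>\<^sub>M A"
  shows "{b. i (i' b) = b} \<in> sets borel"
proof -
  define p where "p k b = b k" for k and b :: "'i \<Rightarrow> real"
  have [measurable]: "p k \<in> borel_measurable borel" for k
    unfolding p_def by (rule measurable_product_then_coordinatewise) simp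
  define g where "g k b = i (i' b) k" for k b
  have [measurable]: "g k \<in> borel_measurable borel" for k
    unfolding g_def by (rule measurable_product_then_coordinatewise) measurable
  have "{b. i (i' b) = b} = {b \<in> space borel. \<forall>k. g k b = p k b}" by (auto simp: g_def p_def fun_eq_iff)
  also have "\<dots> \<in> sets borel"
    by (intro sets.sets_Collect_countable_All borel_measurable_eq) measurable
  finally show ?thesis .
qed

text \<open>The map \<open>\<pi>\<close> is already a bijection from a conull set \<open>X0\<close>
  onto a Borel set \<open>Y0\<close>, but the remainders can have different sizes. Enlarged by a
  null copy \<open>N\<close> of the line and by its image, each remainder embeds into the other, and
  Schroeder-Bernstein matches them. Only the null set \<open>X'\<close> is affected.\<close>

lemma ae_isomorphism:
  fixes \<pi> :: "'x \<Rightarrow> 'i::countable \<Rightarrow> real" and \<iota> :: "'x \<Rightarrow> real"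
  assumes \<iota>: "measurable_retract M borel \<iota> r"
    and \<sigma>: "sigma_finite_measure M" and nz: "emeasure M (space M) \<noteq> 0"
    and single: "\<And>x. x \<in> space M \<Longrightarrow> emeasure M {x} = 0"
    and Y [measurable]: "Y \<in> sets borel"
    and \<pi>m [measurable]: "\<pi> \<in> borel_measurable M" and \<pi>Y: "AE x in M. \<pi> x \<in> Y"
    and hm [measurable]: "h \<in> borel_measurable borel" and h\<pi>: "AE x in M. h (\<pi> x) = \<iota> x"
  shows "\<exists>\<theta> \<theta>'. measurable_retract M (restrict_space borel Y) \<theta> \<theta>' \<and>
      measurable_retract (restrict_space borel Y) M \<theta>' \<theta> \<and> (AE x in M. \<theta> x = \<pi> x)"
proof -
  have \<iota>m [measurable]: "\<iota> \<in> M \<rightarrow>\<^sub>M borel" and rm [measurable]: "r \<in> borel \<rightarrow>\<^sub>M M"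
    and r: "\<And>x. x \<in> space M \<Longrightarrow> r (\<iota> x) = x"
    using \<iota> by (auto simp: measurable_retract_def)
  have rs: "r t \<in> space M" for t using measurable_space[OF rm] by simp
  define s where "s y = r (h y)" for y
  have sm [measurable]: "s \<in> borel \<rightarrow>\<^sub>M M" unfolding s_def by measurable
  have ss: "s y \<in> space M" for y by (simp add: s_def rs)
  \<comment> \<open>On \<open>X0\<close>, \<open>h\<close> recovers \<open>\<iota> x\<close>, and
    hence \<open>x\<close>, from \<open>\<pi> x\<close>. \<open>Y0\<close> is the image of
    \<open>X0\<close> under \<open>\<pi>\<close>, expressed through the inverse \<open>s\<close> so
    that it is visibly Borel.\<close>
  define X0 where "X0 = {x \<in> space M. h (\<pi> x) = \<iota> x \<and> \<pi> x \<in> Y}"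
  define Y0 where "Y0 = {y. \<pi> (s y) = y} \<inter> {y \<in> space borel. \<iota> (s y) = h y} \<inter> Y"
  have X0 [measurable]: "X0 \<in> sets M" unfolding X0_def by measurable
  have "{y. \<pi> (s y) = y} \<in> sets borel" by (rule measurable_retract_image_product[OF \<pi>m sm])
  then have Y0 [measurable]: "Y0 \<in> sets borel" unfolding Y0_def by measurable
  have s\<pi>: "s (\<pi> x) = x" if "x \<in> X0" for x using that r by (auto simp: X0_def s_def)
  have \<pi>s: "\<pi> (s y) = y" if "y \<in> Y0" for y using that by (auto simp: Y0_def)
  have \<pi>X0: "\<pi> x \<in> Y0" if "x \<in> X0" for x using that s\<pi>[OF that] by (auto simp: Y0_def X0_def)
  have sY0: "s y \<in> X0" if "y \<in> Y0" for y using that ss by (auto simp: Y0_def X0_def)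
  have X0AE: "AE x in M. x \<in> X0" using \<pi>Y h\<pi> AE_space by eventually_elim (auto simp: X0_def)
  obtain X1 where X1 [measurable]: "X1 \<in> sets M" and X1X0: "X1 \<subseteq> X0" and pos: "0 < emeasure M X1" and fin: "emeasure M X1 < \<infinity>"
  proof -
    obtain A :: "nat \<Rightarrow> 'x set" where A: "range A \<subseteq> sets M" "(\<Union>i. A i) = space M" "\<And>i. emeasure M (A i) \<noteq> \<infinity>"
      using sigma_finite_measure.sigma_finite[OF \<sigma>] by auto
    have Am: "A i \<in> sets M" for i using A(1) by auto
    have e: "emeasure M (A i \<inter> X0) = emeasure M (A i)" for i
      by (rule emeasure_eq_AE) (use X0AE Am X0 in \<open>auto elim: eventually_mono\<close>)
    have "\<exists>i. emeasure M (A i) \<noteq> 0"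
    proof (rule ccontr)
      assume "\<not> (\<exists>i. emeasure M (A i) \<noteq> 0)"
      then have "(\<Union>i. A i) \<in> null_sets M" using Am by (intro null_sets_UN) auto
      then show False using A(2) nz by auto
    qed
    then obtain i where "emeasure M (A i) \<noteq> 0" by auto
    then show ?thesis
      using that[of "A i \<inter> X0"] e[of i] A(3)[of i] Am[of i] X0 by (simp add: zero_less_iff_neq_zero less_top)
  qed
  obtain E R where ER: "measurable_retract (borel :: real measure) M E R" and EX1: "range E \<subseteq> X1"
    and N0: "{x \<in> space M. E (R x) = x} \<in> null_sets M"
    using null_copy_of_real[OF \<iota> X1 pos fin single] by blast
  have Em [measurable]: "E \<in> borel \<rightarrow>\<^sub>M M" and Rm [measurable]: "R \<in> M \<rightarrow>\<^sub>M borel" and RE: "R (E t) = t" for t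
    using ER by (auto simp: measurable_retract_def)
  define N where "N = {x \<in> space M. E (R x) = x}"
  have N [measurable]: "N \<in> sets M" using N0 by (auto simp: N_def)
  have NX0: "N \<subseteq> X0" using EX1 X1X0 by (auto simp: N_def) (metis rangeI subsetD)
  have EN: "E t \<in> N" for t using RE measurable_space[OF Em, of t] by (simp add: N_def)
  \<comment> \<open>\<open>N\<close> and its image under \<open>\<pi>\<close>, the latter written as
    a preimage under \<open>s\<close>, are moved from the matched sets to the remainders.\<close>
  define X' where "X' = (space M - X0) \<union> N"
  define Y' where "Y' = (Y - Y0) \<union> (Y0 \<inter> s -` N)"
  have X' [measurable]: "X' \<in> sets M" unfolding X'_def by measurable
  have "s -` N \<inter> space borel \<in> sets borel" by measurable
  then have Y' [measurable]: "Y' \<in> sets borel" unfolding Y'_def by simp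
  have X's: "X' \<subseteq> space M" using X' by (rule sets.sets_into_space)
  have YY: "Y0 \<subseteq> Y" "Y' \<subseteq> Y" by (auto simp: Y0_def Y'_def)
  obtain a b where ab: "measurable_retract (borel :: ('i \<Rightarrow> real) measure) (borel :: real measure) a b"
    using retract_countable_product_real by blast
  then have [measurable]: "a \<in> borel_measurable borel" "b \<in> borel_measurable borel" and ba: "\<And>y. b (a y) = y"
    by (auto simp: measurable_retract_def)
  define x0 where "x0 = E 0"
  define y0 where "y0 = \<pi> x0"
  have x0: "x0 \<in> X'" "x0 \<in> space M" using EN X's by (auto simp: x0_def X'_def)
  have \<pi>E: "\<pi> (E t) \<in> Y'" for t
    using EN[of t] NX0 \<pi>X0[of "E t"] s\<pi>[of "E t"] by (auto simp: Y'_def)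
  then have y0: "y0 \<in> Y'" by (simp add: y0_def x0_def)
  \<comment> \<open>Both remainders embed into the line, and the line embeds into \<open>N\<close>
    by \<open>E\<close> and from there into \<open>Y'\<close> by \<open>\<pi>\<close>. The defaults
    \<open>x0\<close> and \<open>y0\<close> keep the left inverses inside the remainders where
    decoding leads outside.\<close>
  define i where "i x = \<pi> (E (\<iota> x))" for x
  define i' where "i' y = (if r (R (s y)) \<in> X' then r (R (s y)) else x0)" for y
  define j where "j y = E (a y)" for y
  define j' where "j' x = (if b (R x) \<in> Y' then b (R x) else y0)" for x
  have im [measurable]: "i \<in> M \<rightarrow>\<^sub>M borel" unfolding i_def by measurable
  have i'm [measurable]: "i' \<in> borel \<rightarrow>\<^sub>M M" unfolding i'_def using x0 by measurable
  have jm [measurable]: "j \<in> borel \<rightarrow>\<^sub>M M" unfolding j_def by measurable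
  have j'm [measurable]: "j' \<in> M \<rightarrow>\<^sub>M borel" unfolding j'_def by measurable
  let ?A = "restrict_space M X'" and ?B = "restrict_space borel Y'"
  have sA: "space ?A = X'" "space ?B = Y'" using X's by (auto simp: space_restrict_space)
  have "measurable_retract ?A ?B i i'"
    unfolding measurable_retract_def sA
  proof (intro conjI ballI)
    show "i \<in> ?A \<rightarrow>\<^sub>M ?B"
      using \<pi>E sA by (intro measurable_restrict_space2 measurable_restrict_space1 im) (auto simp: i_def)
    show "i' \<in> ?B \<rightarrow>\<^sub>M ?A"
      using x0 sA by (intro measurable_restrict_space2 measurable_restrict_space1 i'm) (auto simp: i'_def)
    fix x assume x: "x \<in> X'"
    have "s (\<pi> (E (\<iota> x))) = E (\<iota> x)" using EN NX0 s\<pi> by blast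
    then show "i' (i x) = x" using x X's r by (auto simp: i_def i'_def RE)
  qed
  moreover have "measurable_retract ?B ?A j j'"
    unfolding measurable_retract_def sA
  proof (intro conjI ballI)
    show "j \<in> ?B \<rightarrow>\<^sub>M ?A"
      using EN sA by (intro measurable_restrict_space2 measurable_restrict_space1 jm) (auto simp: j_def X'_def)
    show "j' \<in> ?A \<rightarrow>\<^sub>M ?B"
      using y0 sA by (intro measurable_restrict_space2 measurable_restrict_space1 j'm) (auto simp: j'_def)
    fix y assume "y \<in> Y'"
    then show "j' (j y) = y" by (simp add: j_def j'_def RE ba)
  qed
  moreover have "{y \<in> space ?B. i (i' y) = y} \<in> sets ?B"
  proof -
    have "{y. i (i' y) = y} \<in> sets borel" by (rule measurable_retract_image_product[OF im i'm])
    then have "{y. i (i' y) = y} \<inter> Y' \<in> sets borel" by measurable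
    moreover have "{y \<in> space ?B. i (i' y) = y} = {y. i (i' y) = y} \<inter> Y'" using sA by auto
    ultimately show ?thesis using Y' by (auto simp: sets_restrict_space_iff)
  qed
  moreover have "{x \<in> space ?A. j (j' x) = x} \<in> sets ?A"
  proof -
    have "{x \<in> space M. j (j' x) = x} \<in> sets M" by (rule measurable_retract_fixpoints[OF \<iota>]) measurable
    then have "{x \<in> space M. j (j' x) = x} \<inter> X' \<in> sets M" by measurable
    moreover have "{x \<in> space ?A. j (j' x) = x} = {x \<in> space M. j (j' x) = x} \<inter> X'" using sA X's by auto
    ultimately show ?thesis using X' X's by (auto simp: sets_restrict_space_iff)
  qed
  ultimately obtain \<eta> \<eta>' where \<eta>: "measurable_retract ?A ?B \<eta> \<eta>'" and \<eta>': "measurable_retract ?B ?A \<eta>' \<eta>"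
    using measurable_schroeder_bernstein by blast
  have \<eta>m [measurable]: "\<eta> \<in> ?A \<rightarrow>\<^sub>M ?B" and \<eta>'m [measurable]: "\<eta>' \<in> ?B \<rightarrow>\<^sub>M ?A"
    and \<eta>1: "\<And>x. x \<in> X' \<Longrightarrow> \<eta>' (\<eta> x) = x" and \<eta>2: "\<And>y. y \<in> Y' \<Longrightarrow> \<eta> (\<eta>' y) = y"
    using \<eta> \<eta>' sA by (auto simp: measurable_retract_def)
  have \<eta>s: "x \<in> X' \<Longrightarrow> \<eta> x \<in> Y'" "y \<in> Y' \<Longrightarrow> \<eta>' y \<in> X'" for x y
    using measurable_space[OF \<eta>m, of x] measurable_space[OF \<eta>'m, of y] sA by auto
  \<comment> \<open>Off the null set \<open>X'\<close> nothing is changed, which gives a.e. equality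
    with \<open>\<pi>\<close>.\<close>
  define \<theta> where "\<theta> x = (if x \<in> X' then \<eta> x else \<pi> x)" for x
  define \<theta>' where "\<theta>' y = (if y \<in> Y' then \<eta>' y else s y)" for y
  have out: "x \<in> space M \<Longrightarrow> x \<notin> X' \<Longrightarrow> x \<in> X0 \<and> x \<notin> N" for x by (auto simp: X'_def)
  have outY: "y \<in> Y \<Longrightarrow> y \<notin> Y' \<Longrightarrow> y \<in> Y0 \<and> s y \<notin> N" for y by (auto simp: Y'_def)
  have \<pi>out: "\<pi> x \<in> Y - Y'" if "x \<in> space M" "x \<notin> X'" for x
    using out[OF that] \<pi>X0[of x] s\<pi>[of x] YY by (auto simp: Y'_def)
  have sout: "s y \<in> space M - X'" if "y \<in> Y" "y \<notin> Y'" for y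
    using outY[OF that] sY0[of y] ss by (auto simp: X'_def)
  have \<theta>Y: "\<theta> x \<in> Y" if "x \<in> space M" for x using \<eta>s(1)[of x] \<pi>out[OF that] YY by (auto simp: \<theta>_def)
  have \<theta>'X: "\<theta>' y \<in> space M" if "y \<in> Y" for y using \<eta>s(2)[of y] ss X's by (auto simp: \<theta>'_def)
  have "\<eta> \<in> ?A \<rightarrow>\<^sub>M borel" using measurable_restrict_space2_iff[of \<eta> ?A borel Y'] \<eta>m by auto
  then have "\<theta> \<in> borel_measurable M" unfolding \<theta>_def
    using X' X's by (subst measurable_If_restrict_space_iff)
      (auto intro!: measurable_restrict_space1 simp: Int_absorb1 Collect_mem_eq)
  then have "\<theta> \<in> M \<rightarrow>\<^sub>M restrict_space borel Y"
    using \<theta>Y by (intro measurable_restrict_space2) auto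
  moreover have "\<theta>' \<in> restrict_space borel Y \<rightarrow>\<^sub>M M"
  proof -
    have "\<eta>' \<in> ?B \<rightarrow>\<^sub>M M" using measurable_restrict_space2_iff[of \<eta>' ?B M X'] \<eta>'m by auto
    then have "\<theta>' \<in> borel \<rightarrow>\<^sub>M M" unfolding \<theta>'_def
      by (subst measurable_If_restrict_space_iff) (auto intro!: measurable_restrict_space1)
    then show ?thesis by (rule measurable_restrict_space1)
  qed
  moreover have "\<theta>' (\<theta> x) = x" if x: "x \<in> space M" for x
  proof (cases "x \<in> X'")
    case True
    then show ?thesis using \<eta>s(1) \<eta>1 by (simp add: \<theta>_def \<theta>'_def)
  next
    case False
    then show ?thesis using \<pi>out[OF x False] s\<pi> out[OF x False] by (simp add: \<theta>_def \<theta>'_def)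
  qed
  moreover have "\<theta> (\<theta>' y) = y" if y: "y \<in> Y" for y
  proof (cases "y \<in> Y'")
    case True
    then show ?thesis using \<eta>s(2) \<eta>2 by (simp add: \<theta>_def \<theta>'_def)
  next
    case False
    then show ?thesis using sout[OF y False] \<pi>s outY[OF y False] by (simp add: \<theta>_def \<theta>'_def)
  qed
  moreover have "AE x in M. \<theta> x = \<pi> x"
  proof -
    have "AE x in M. x \<notin> N" using N0 unfolding N_def by (rule AE_not_in)
    then show ?thesis using X0AE by eventually_elim (simp add: \<theta>_def X'_def)
  qed
  ultimately show ?thesis
    unfolding measurable_retract_def by (intro exI[of _ \<theta>] exI[of _ \<theta>']) (auto simp: space_restrict_space)
qed

section \<open>The lifted topology\<close>

text \<open>\<open>f_finite\<close> will make compact sets have finite measure, and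
  \<open>f_continuous\<close> will make the pseudometrics continuous. With \<open>d 0\<close> the
  identity, the orbit coordinates with second index 0 are the functions \<open>f n\<close>
  themselves, up to a null set.\<close>

locale G_continuous_family = group G for G :: "('g, 'm) monoid_scheme" (structure) +
  fixes TG :: "'g topology" and M :: "'x measure" and S :: "'g \<Rightarrow> 'x \<Rightarrow> 'x"
    and f :: "nat \<Rightarrow> 'x \<Rightarrow> real" and d :: "nat \<Rightarrow> 'g"
  assumes polish: "polish_group G TG"
    and S_mp: "g \<in> carrier G \<Longrightarrow> S g \<in> mp_bij M"
    and S_mult: "g \<in> carrier G \<Longrightarrow> h \<in> carrier G \<Longrightarrow> AE x in M. S (g \<otimes> h) x = S g (S h x)"
    and S_one: "AE x in M. S \<one> x = x"
    and f_measurable [measurable]: "f n \<in> borel_measurable M"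
    and f_nonneg: "0 \<le> f n x" and f_le_1: "f n x \<le> 1"
    and f_finite: "0 < e \<Longrightarrow> emeasure M {x \<in> space M. e < f n x} < \<infinity>"
    and f_continuous: "0 < e \<Longrightarrow> \<exists>U. openin TG U \<and> \<one> \<in> U \<and> (\<forall>g\<in>U. AE x in M. \<bar>f n (S g x) - f n x\<bar> \<le> e)"
    and d_in_carrier: "d i \<in> carrier G"
    and d_is_dense: "openin TG U \<Longrightarrow> U \<noteq> {} \<Longrightarrow> \<exists>i. d i \<in> U"
    and d_0: "d 0 = \<one>"
begin

lemma topspace_TG: "topspace TG = carrier G"
  using polish by (simp add: polish_group_def)

text \<open>The essential supremum of the difference, taken as an infimum over real bounds so that
  it stays a real number; the bound 1 always qualifies.\<close>

definition rho :: "nat \<Rightarrow> 'g \<Rightarrow> 'g \<Rightarrow> real" where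
  "rho n g h = Inf {c. 0 \<le> c \<and> (AE x in M. \<bar>f n (S g x) - f n (S h x)\<bar> \<le> c)}"

lemma rho_le:
  assumes "0 \<le> c" "AE x in M. \<bar>f n (S g x) - f n (S h x)\<bar> \<le> c"
  shows "rho n g h \<le> c"
  unfolding rho_def by (rule cInf_lower) (use assms in \<open>auto intro: bdd_belowI[of _ 0]\<close>)

lemma rho_nonempty: "1 \<in> {c. 0 \<le> c \<and> (AE x in M. \<bar>f n (S g x) - f n (S h x)\<bar> \<le> c)}"
proof -
  have "\<bar>f n (S g x) - f n (S h x)\<bar> \<le> 1" for x
    using f_nonneg[of n "S g x"] f_nonneg[of n "S h x"] f_le_1[of n "S g x"] f_le_1[of n "S h x"]
    by (simp add: abs_le_iff)
  then show ?thesis by simp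
qed

lemma rho_ge_0: "0 \<le> rho n g h"
  unfolding rho_def by (rule cInf_greatest) (use rho_nonempty in blast)+

text \<open>The infimum is attained: countably many slightly larger bounds hold simultaneously off
  one null set.\<close>

lemma rho_AE: "AE x in M. \<bar>f n (S g x) - f n (S h x)\<bar> \<le> rho n g h"
proof -
  let ?C = "{c. 0 \<le> c \<and> (AE x in M. \<bar>f n (S g x) - f n (S h x)\<bar> \<le> c)}"
  have "AE x in M. \<bar>f n (S g x) - f n (S h x)\<bar> \<le> rho n g h + 1 / real (Suc k)" for k
  proof -
    have "Inf ?C < rho n g h + 1 / real (Suc k)" by (simp add: rho_def)
    then obtain c where c: "c \<in> ?C" "c < rho n g h + 1 / real (Suc k)"
      using cInf_lessD[of ?C] rho_nonempty by blast
    then have "AE x in M. \<bar>f n (S g x) - f n (S h x)\<bar> \<le> c" by simp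
    then show ?thesis by eventually_elim (use c(2) in simp)
  qed
  then have "AE x in M. \<forall>k. \<bar>f n (S g x) - f n (S h x)\<bar> \<le> rho n g h + 1 / real (Suc k)"
    unfolding AE_all_countable by blast
  then show ?thesis
  proof eventually_elim
    case (elim x)
    show ?case
    proof (rule field_le_epsilon)
      fix e :: real assume "0 < e"
      then obtain k where "1 / real (Suc k) < e" using nat_approx_posE by metis
      then show "\<bar>f n (S g x) - f n (S h x)\<bar> \<le> rho n g h + e" using elim[rule_format, of k] by simp
    qed
  qed
qed

text \<open>Up to null sets, translating by \<open>k\<close> substitutes \<open>S k x\<close> for
  \<open>x\<close>, which does not change what holds almost everywhere.\<close>

lemma rho_right_invariant:
  assumes g: "g \<in> carrier G" and h: "h \<in> carrier G" and k: "k \<in> carrier G"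
  shows "rho n (g \<otimes> k) (h \<otimes> k) = rho n g h"
proof -
  have "(AE x in M. \<bar>f n (S (g \<otimes> k) x) - f n (S (h \<otimes> k) x)\<bar> \<le> c) \<longleftrightarrow>
      (AE x in M. \<bar>f n (S g x) - f n (S h x)\<bar> \<le> c)" for c
  proof -
    have "(AE x in M. \<bar>f n (S (g \<otimes> k) x) - f n (S (h \<otimes> k) x)\<bar> \<le> c) \<longleftrightarrow>
      (AE x in M. \<bar>f n (S g (S k x)) - f n (S h (S k x))\<bar> \<le> c)"
    proof
      assume "AE x in M. \<bar>f n (S (g \<otimes> k) x) - f n (S (h \<otimes> k) x)\<bar> \<le> c"
      with S_mult[OF g k] S_mult[OF h k] show "AE x in M. \<bar>f n (S g (S k x)) - f n (S h (S k x))\<bar> \<le> c"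
        by eventually_elim simp
    next
      assume "AE x in M. \<bar>f n (S g (S k x)) - f n (S h (S k x))\<bar> \<le> c"
      with S_mult[OF g k] S_mult[OF h k] show "AE x in M. \<bar>f n (S (g \<otimes> k) x) - f n (S (h \<otimes> k) x)\<bar> \<le> c"
        by eventually_elim simp
    qed
    also have "\<dots> \<longleftrightarrow> (AE x in M. \<bar>f n (S g x) - f n (S h x)\<bar> \<le> c)"
      by (rule mp_bij_AE_iff[OF S_mp[OF k]])
    finally show ?thesis .
  qed
  then show ?thesis by (simp add: rho_def)
qed

text \<open>Right invariance moves the question from \<open>g\<close> to the identity, where it is
  the \<open>G\<close>-continuity of \<open>f n\<close>.\<close>

lemma rho_continuous_at:
  assumes g: "g \<in> carrier G" and e: "0 < e"
  shows "\<exists>U. openin TG U \<and> g \<in> U \<and> (\<forall>h\<in>U. rho n h g < e)"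
proof -
  obtain U where U: "openin TG U" "\<one> \<in> U" "\<forall>g\<in>U. AE x in M. \<bar>f n (S g x) - f n x\<bar> \<le> e/2"
    using f_continuous[of "e/2"] e by auto
  define V where "V = {h \<in> topspace TG. h \<otimes> inv g \<in> U}"
  have mult: "continuous_map (prod_topology TG TG) TG (\<lambda>(g, h). g \<otimes> h)"
    using polish by (simp add: polish_group_def)
  have "continuous_map TG (prod_topology TG TG) (\<lambda>h. (h, inv g))"
    using g by (intro continuous_map_pairedI continuous_map_id[unfolded id_def]) (simp add: topspace_TG)
  then have "continuous_map TG TG (\<lambda>h. h \<otimes> inv g)"
    using continuous_map_compose[OF _ mult] by (fastforce simp: comp_def)
  then have V: "openin TG V" unfolding V_def by (rule openin_continuous_map_preimage) (rule U(1))
  have "rho n h g < e" if h: "h \<in> V" for h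
  proof -
    have hU: "h \<in> carrier G" "h \<otimes> inv g \<in> U" using h by (auto simp: V_def topspace_TG)
    have "AE x in M. \<bar>f n (S (h \<otimes> inv g) x) - f n (S \<one> x)\<bar> \<le> e/2"
      using bspec[OF U(3) hU(2)] S_one by eventually_elim simp
    then have "rho n (h \<otimes> inv g) \<one> \<le> e/2" using e by (intro rho_le) auto
    moreover have "rho n ((h \<otimes> inv g) \<otimes> g) (\<one> \<otimes> g) = rho n (h \<otimes> inv g) \<one>"
      using hU g by (intro rho_right_invariant) auto
    moreover have "(h \<otimes> inv g) \<otimes> g = h" using hU g by (simp add: m_assoc)
    ultimately show ?thesis using g e by simp
  qed
  moreover have "g \<in> V" using g U(2) by (simp add: V_def topspace_TG)
  ultimately show ?thesis using V by blast
qed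

sublocale invariant_pseudometrics G TG rho d
proof
  show "topspace TG = carrier G" by (rule topspace_TG)
  show "continuous_map (prod_topology TG TG) TG (\<lambda>(g, h). g \<otimes> h)"
    using polish by (simp add: polish_group_def)
  show "rho n g g = 0" for n g
    using rho_le[of 0 n g g] rho_ge_0[of n g g] by simp
  show "rho n g h = rho n h g" for n g h
    by (simp add: rho_def abs_minus_commute)
  show "rho n g k \<le> rho n g h + rho n h k" for n g h k
  proof (rule rho_le)
    show "0 \<le> rho n g h + rho n h k" by (simp add: rho_ge_0)
    show "AE x in M. \<bar>f n (S g x) - f n (S k x)\<bar> \<le> rho n g h + rho n h k"
      using rho_AE[of n g h] rho_AE[of n h k] by eventually_elim linarith
  qed
qed (use rho_right_invariant rho_continuous_at d_in_carrier d_is_dense in auto)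

text \<open>Only the countably many group elements \<open>d i\<close> are sampled, so that all
  conditions defining \<open>Z\<close> hold off a single null set.\<close>

definition orbit_values :: "'x \<Rightarrow> nat \<times> nat \<Rightarrow> real" where
  "orbit_values x = (\<lambda>(n, i). f n (S (d i) x))"

lemma orbit_values_measurable [measurable]: "orbit_values \<in> borel_measurable M"
proof (rule measurable_coordinatewise_then_product)
  fix k :: "nat \<times> nat"
  obtain n i where k: "k = (n, i)" by force
  have [measurable]: "S (d i) \<in> M \<rightarrow>\<^sub>M M" using mp_bijD(1)[OF S_mp[OF d_in_carrier]] .
  show "(\<lambda>x. orbit_values x k) \<in> borel_measurable M" unfolding orbit_values_def k by simp
qed

lemma orbit_values_in_Z: "AE x in M. orbit_values x \<in> Z"
proof -
  have "AE x in M. \<forall>n i j. \<bar>f n (S (d i) x) - f n (S (d j) x)\<bar> \<le> rho n (d i) (d j)"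
    unfolding AE_all_countable using rho_AE by blast
  then show ?thesis by eventually_elim (auto simp: Z_def orbit_values_def f_nonneg f_le_1 abs_le_iff)
qed

text \<open>The samples determine the translate by any \<open>h\<close>: both sides differ from the
  sampled value at \<open>d j\<close> by at most \<open>rho n (d j) h\<close>, and
  \<open>d j\<close> can approach \<open>h\<close>. The exceptional null set depends on
  \<open>h\<close>.\<close>

lemma extend_orbit_values:
  assumes h: "h \<in> carrier G"
  shows "AE x in M. extend (orbit_values x) n h = f n (S h x)"
proof -
  have "AE x in M. \<forall>j. \<bar>f n (S (d j) x) - f n (S h x)\<bar> \<le> rho n (d j) h"
    unfolding AE_all_countable using rho_AE by blast
  then show ?thesis using orbit_values_in_Z
  proof eventually_elim
    case (elim x)
    have "\<bar>extend (orbit_values x) n h - f n (S h x)\<bar> \<le> 0 + e" if e: "e > 0" for e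
    proof -
      obtain j where j: "rho n (d j) h < e/2" using ex_d_close[OF h, of "e/2"] e by auto
      have "\<bar>extend (orbit_values x) n (d j) - extend (orbit_values x) n h\<bar> \<le> rho n (d j) h"
        by (rule extend_lipschitz[OF elim(2) d_closed h])
      moreover have "extend (orbit_values x) n (d j) = f n (S (d j) x)"
        using extend_d[OF elim(2)] by (simp add: orbit_values_def)
      ultimately show ?thesis using elim(1)[rule_format, of j] j by (simp add: abs_le_iff)
    qed
    then have "\<bar>extend (orbit_values x) n h - f n (S h x)\<bar> \<le> 0" by (rule field_le_epsilon)
    then show ?case by simp
  qed
qed

text \<open>For one fixed \<open>g\<close>, equivariance is a countable family of equalities at the
  points \<open>d i \<otimes> g\<close>. These need not belong to the sequence \<open>d\<close>,
  which is why the extension to arbitrary group elements is needed.\<close>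

lemma act_orbit_values:
  assumes g: "g \<in> carrier G"
  shows "AE x in M. act g (orbit_values x) = orbit_values (S g x)"
proof -
  have "AE x in M. extend (orbit_values x) n (d i \<otimes> g) = f n (S (d i) (S g x))" for n i
  proof -
    have "AE x in M. extend (orbit_values x) n (d i \<otimes> g) = f n (S (d i \<otimes> g) x)" using g by (intro extend_orbit_values) simp
    with S_mult[OF d_in_carrier g, of i] show ?thesis by eventually_elim simp
  qed
  then have "AE x in M. \<forall>n i. extend (orbit_values x) n (d i \<otimes> g) = f n (S (d i) (S g x))"
    unfolding AE_all_countable by blast
  then show ?thesis by eventually_elim (simp add: act_def orbit_values_def fun_eq_iff)
qed

lemma orbit_values_finite:
  assumes e: "0 < e"
  shows "emeasure M {x \<in> space M. e < orbit_values x k} < \<infinity>"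
proof -
  obtain n i where k: "k = (n, i)" by force
  have T: "S (d i) \<in> mp_bij M" using S_mp d_in_carrier by blast
  have A: "{x \<in> space M. e < f n x} \<in> sets M" by measurable
  have "{x \<in> space M. e < orbit_values x k} = S (d i) -` {x \<in> space M. e < f n x} \<inter> space M"
    using mp_bij_simps(1)[OF T] by (auto simp: orbit_values_def k)
  then show ?thesis using mp_bij_emeasure_vimage(1)[OF T A] f_finite[OF e] by simp
qed

end

section \<open>Transport of topology, Borel structure and the Radon property along a Borel
  isomorphism\<close>

lemma induces_borel_structure_measurable:
  assumes "induces_borel_structure T M" "induces_borel_structure T' M'" "continuous_map T T' f"
  shows "f \<in> M \<rightarrow>\<^sub>M M'"
proof (rule measurable_sigma_sets)
  show "sets M' = sigma_sets (space M') {U. openin T' U}" using assms(2) by (simp add: induces_borel_structure_def)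
  show "{U. openin T' U} \<subseteq> Pow (space M')"
    using assms(2) openin_subset by (force simp: induces_borel_structure_def)
  show "f \<in> space M \<rightarrow> space M'"
    using assms continuous_map_funspace by (fastforce simp: induces_borel_structure_def)
  fix U assume "U \<in> {U. openin T' U}"
  then have "openin T {x \<in> topspace T. f x \<in> U}" using assms(3) by (auto intro: openin_continuous_map_preimage)
  moreover have "f -` U \<inter> space M = {x \<in> topspace T. f x \<in> U}" using assms(1) by (auto simp: induces_borel_structure_def)
  ultimately show "f -` U \<inter> space M \<in> sets M" using assms(1) by (simp add: induces_borel_structure_def)
qed

lemma pullback_homeomorphic_maps:
  assumes \<theta>: "\<theta> \<in> A \<rightarrow> Y" and \<theta>': "\<theta>' \<in> Y \<rightarrow> A"
    and l: "\<And>x. x \<in> A \<Longrightarrow> \<theta>' (\<theta> x) = x" and r: "\<And>y. y \<in> Y \<Longrightarrow> \<theta> (\<theta>' y) = y"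
  shows "homeomorphic_maps (pullback_topology A \<theta> (top_of_set Y)) (top_of_set Y) \<theta> \<theta>'"
proof -
  have top: "topspace (pullback_topology A \<theta> (top_of_set Y)) = A"
    using \<theta> by (auto simp: topspace_pullback_topology)
  have "continuous_map (pullback_topology A \<theta> (top_of_set Y)) (top_of_set Y) \<theta>"
    unfolding continuous_map top using \<theta> by (auto simp: openin_pullback_topology)
  moreover have "continuous_map (top_of_set Y) (pullback_topology A \<theta> (top_of_set Y)) \<theta>'"
    unfolding continuous_map top
  proof (intro conjI allI impI)
    show "\<theta>' ` topspace (top_of_set Y) \<subseteq> A" using \<theta>' by auto
    fix U assume "openin (pullback_topology A \<theta> (top_of_set Y)) U"
    then obtain V where V: "openin (top_of_set Y) V" "U = \<theta> -` V \<inter> A" by (auto simp: openin_pullback_topology)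
    have "V \<subseteq> Y" using openin_subset[OF V(1)] by simp
    then have "{y \<in> topspace (top_of_set Y). \<theta>' y \<in> U} = V" using r \<theta>' by (auto simp: V(2))
    then show "openin (top_of_set Y) {y \<in> topspace (top_of_set Y). \<theta>' y \<in> U}" using V(1) by simp
  qed
  ultimately show ?thesis using l r top by (simp add: homeomorphic_maps_def)
qed

text \<open>The measurable left inverse shows that every measurable set of \<open>M\<close> is the
  preimage of a Borel set, and generating a sigma-algebra commutes with taking preimages.\<close>

lemma induces_borel_structure_pullback:
  fixes \<theta> :: "'x \<Rightarrow> 'b::topological_space"
  assumes \<theta>: "measurable_retract M (restrict_space borel Y) \<theta> \<theta>'" and Y: "Y \<in> sets borel"
  shows "sets M = {\<theta> -` B \<inter> space M | B. B \<in> sets borel}"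
    and "induces_borel_structure (pullback_topology (space M) \<theta> (top_of_set Y)) M"
proof -
  have \<theta>m: "\<theta> \<in> M \<rightarrow>\<^sub>M restrict_space borel Y" and \<theta>'m: "\<theta>' \<in> restrict_space borel Y \<rightarrow>\<^sub>M M"
    and l: "\<And>x. x \<in> space M \<Longrightarrow> \<theta>' (\<theta> x) = x"
    using \<theta> by (auto simp: measurable_retract_def)
  have \<theta>b: "\<theta> \<in> borel_measurable M" and \<theta>Y: "\<And>x. x \<in> space M \<Longrightarrow> \<theta> x \<in> Y"
    using \<theta>m by (auto simp: measurable_restrict_space2_iff)
  show *: "sets M = {\<theta> -` B \<inter> space M | B. B \<in> sets borel}"
  proof (intro equalityI subsetI)
    fix A assume A: "A \<in> sets M"
    have "\<theta>' -` A \<inter> space (restrict_space borel Y) \<in> sets (restrict_space borel Y)"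
      using \<theta>'m A by (rule measurable_sets)
    then have "\<theta>' -` A \<inter> Y \<in> sets borel" using Y by (simp add: sets_restrict_space_iff space_restrict_space)
    moreover have "A = \<theta> -` (\<theta>' -` A \<inter> Y) \<inter> space M"
      using l \<theta>Y sets.sets_into_space[OF A] by auto
    ultimately show "A \<in> {\<theta> -` B \<inter> space M | B. B \<in> sets borel}" by blast
  next
    fix A assume "A \<in> {\<theta> -` B \<inter> space M | B. B \<in> sets borel}"
    then show "A \<in> sets M" using \<theta>b by (auto intro: measurable_sets)
  qed
  have o: "{U. openin (pullback_topology (space M) \<theta> (top_of_set Y)) U} = {\<theta> -` V \<inter> space M | V. V \<in> {V. open V}}"
  proof (intro equalityI subsetI)
    fix U assume "U \<in> {U. openin (pullback_topology (space M) \<theta> (top_of_set Y)) U}"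
    then obtain V where V: "openin (top_of_set Y) V" "U = \<theta> -` V \<inter> space M" by (auto simp: openin_pullback_topology)
    then obtain W where "open W" "V = Y \<inter> W" by (auto simp: openin_open)
    then have "U = \<theta> -` W \<inter> space M" using V(2) \<theta>Y by auto
    then show "U \<in> {\<theta> -` V \<inter> space M | V. V \<in> {V. open V}}" using \<open>open W\<close> by auto
  next
    fix U assume "U \<in> {\<theta> -` V \<inter> space M | V. V \<in> {V. open V}}"
    then obtain V where "open V" "U = \<theta> -` V \<inter> space M" by auto
    then have "openin (top_of_set Y) (Y \<inter> V)" "U = \<theta> -` (Y \<inter> V) \<inter> space M" using \<theta>Y by (auto simp: openin_open)
    then show "U \<in> {U. openin (pullback_topology (space M) \<theta> (top_of_set Y)) U}" by (auto simp: openin_pullback_topology)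
  qed
  have "sets M = {\<theta> -` B \<inter> space M | B. B \<in> sigma_sets UNIV {V. open V}}"
    unfolding * borel_def by simp
  also have "\<dots> = sigma_sets (space M) {\<theta> -` V \<inter> space M | V. V \<in> {V. open V}}"
    by (rule sigma_sets_vimage_commute) simp
  finally have "sets M = sigma_sets (space M) {\<theta> -` V \<inter> space M | V. V \<in> {V. open V}}" .
  moreover have "topspace (pullback_topology (space M) \<theta> (top_of_set Y)) = space M"
    using \<theta>Y by (auto simp: topspace_pullback_topology)
  ultimately show "induces_borel_structure (pullback_topology (space M) \<theta> (top_of_set Y)) M"
    unfolding induces_borel_structure_def o by (rule conjI[rotated])
qed

lemma compactin_sets:
  assumes "Hausdorff_space T" "induces_borel_structure T M" "compactin T K"
  shows "K \<in> sets M"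
proof -
  have "closedin T K" using assms by (intro compactin_imp_closedin)
  then have "openin T (space M - K)" "K \<subseteq> space M" using assms(2) by (auto simp: closedin_def induces_borel_structure_def)
  then have "space M - K \<in> sets M" using assms(2) by (simp add: induces_borel_structure_def)
  then show ?thesis using sets.compl_sets[of "space M - K" M] \<open>K \<subseteq> space M\<close> by (simp add: double_diff)
qed

text \<open>Inner regularity is continuity from below along the compact exhaustion in
  \<open>sc\<close>. Outer regularity is local: on each \<open>W m\<close> the image measure is
  finite on a complete second countable space and so outer regular there, and the errors add up as a
  geometric series.\<close>

lemma radon_pullback:
  fixes \<theta> :: "'x \<Rightarrow> 'b::{second_countable_topology, complete_space}"
  assumes \<theta>: "measurable_retract M (restrict_space borel Y) \<theta> \<theta>'" and Y: "Y \<in> sets borel"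
    and T: "T = pullback_topology (space M) \<theta> (top_of_set Y)"
    and fin: "\<And>K. compactin T K \<Longrightarrow> emeasure M K < \<infinity>"
    and sc: "\<And>U. openin T U \<Longrightarrow> \<exists>K. incseq K \<and> (\<forall>m::nat. compactin T (K m) \<and> K m \<subseteq> U) \<and> (\<Union>m. K m) = U"
    and W: "\<And>m::nat. openin T (W m)" "\<And>m. emeasure M (W m) < \<infinity>" "(\<Union>m. W m) = space M"
  shows "radon T M"
proof -
  have indT: "induces_borel_structure T M" and setsM: "sets M = {\<theta> -` B \<inter> space M | B. B \<in> sets borel}"
    unfolding T by (rule induces_borel_structure_pullback[OF \<theta> Y])+
  have op: "U \<in> sets M" if "openin T U" for U using indT that by (simp add: induces_borel_structure_def)
  have topT: "topspace T = space M" using indT by (simp add: induces_borel_structure_def)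
  have haus: "Hausdorff_space T"
  proof -
    have inj: "inj_on \<theta> (space M)" using \<theta> by (auto simp: measurable_retract_def intro: inj_on_inverseI)
    have c: "continuous_map T euclidean \<theta>"
      unfolding continuous_map topT
    proof (intro conjI allI impI)
      fix V :: "'b set" assume "openin euclidean V"
      then have "openin (top_of_set Y) (Y \<inter> V)" by (simp add: openin_open_Int)
      moreover have "{x \<in> space M. \<theta> x \<in> V} = \<theta> -` (Y \<inter> V) \<inter> space M"
        using \<theta> measurable_space[of \<theta> M "restrict_space borel Y"] by (auto simp: measurable_retract_def space_restrict_space)
      ultimately show "openin T {x \<in> space M. \<theta> x \<in> V}" unfolding T openin_pullback_topology by blast
    qed simp
    show ?thesis
      by (rule Hausdorff_space_injective_preimage[OF _ c]) (use inj topT in auto)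
  qed
  have cp: "K \<in> sets M" if "compactin T K" for K by (rule compactin_sets[OF haus indT that])
  have \<theta>b: "\<theta> \<in> borel_measurable M" and \<theta>Y: "\<And>x. x \<in> space M \<Longrightarrow> \<theta> x \<in> Y"
    using \<theta> by (auto simp: measurable_retract_def measurable_restrict_space2_iff)
  have inner: "emeasure M U = (SUP K\<in>{K. compactin T K \<and> K \<subseteq> U}. emeasure M K)" if U: "openin T U" for U
  proof (rule antisym)
    obtain K where K: "incseq K" "\<And>m::nat. compactin T (K m)" "\<And>m. K m \<subseteq> U" "(\<Union>m. K m) = U"
      using sc[OF U] by blast
    have "range K \<subseteq> sets M" using K(2) cp by blast
    then have "emeasure M U = (SUP m. emeasure M (K m))"
      using SUP_emeasure_incseq[of K M] K(1,4) by simp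
    also have "\<dots> \<le> (SUP K\<in>{K. compactin T K \<and> K \<subseteq> U}. emeasure M K)"
      using K by (intro SUP_mono) auto
    finally show "emeasure M U \<le> (SUP K\<in>{K. compactin T K \<and> K \<subseteq> U}. emeasure M K)" .
    show "(SUP K\<in>{K. compactin T K \<and> K \<subseteq> U}. emeasure M K) \<le> emeasure M U"
      by (rule SUP_least) (use op[OF U] in \<open>auto intro: emeasure_mono\<close>)
  qed
  have outer: "emeasure M A = (INF U\<in>{U. openin T U \<and> A \<subseteq> U}. emeasure M U)" if A: "A \<in> sets M" for A
  proof (rule antisym)
    show "emeasure M A \<le> (INF U\<in>{U. openin T U \<and> A \<subseteq> U}. emeasure M U)"
      by (rule INF_greatest) (auto intro: emeasure_mono op)
    show "(INF U\<in>{U. openin T U \<and> A \<subseteq> U}. emeasure M U) \<le> emeasure M A"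
    proof (rule ennreal_le_epsilon)
      fix e :: real assume e: "0 < e"
      obtain B where B: "B \<in> sets borel" "A = \<theta> -` B \<inter> space M" using A unfolding setsM by blast
      have "\<exists>V. open V \<and> B \<subseteq> V \<and> emeasure M (\<theta> -` V \<inter> W m - A) \<le> ennreal (e * (1/2) ^ Suc m)" for m
      proof -
        have Wm: "W m \<in> sets M" "W m \<subseteq> space M" using op[OF W(1)] sets.sets_into_space by auto
        define \<nu> where "\<nu> = distr (restrict_space M (W m)) borel \<theta>"
        have \<theta>r: "\<theta> \<in> borel_measurable (restrict_space M (W m))" using \<theta>b by (rule measurable_restrict_space1)
        have \<nu>: "emeasure \<nu> C = emeasure M (\<theta> -` C \<inter> W m)" if C: "C \<in> sets borel" for C
        proof -
          have "emeasure \<nu> C = emeasure (restrict_space M (W m)) (\<theta> -` C \<inter> W m)"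
            unfolding \<nu>_def using Wm C \<theta>r by (subst emeasure_distr) (auto simp: space_restrict_space2)
          then show ?thesis using Wm by (subst (asm) emeasure_restrict_space) auto
        qed
        have sets\<nu>: "sets \<nu> = sets borel" by (simp add: \<nu>_def)
        have "emeasure \<nu> UNIV \<le> emeasure M (W m)"
          using \<nu>[of UNIV] by simp
        then have fin\<nu>: "emeasure \<nu> C < \<infinity>" for C
          using W(2)[of m] emeasure_mono[of C UNIV \<nu>] sets\<nu> by (simp add: order_le_less_trans)
        have "emeasure \<nu> B = (INF V \<in> {V. B \<subseteq> V \<and> open V}. emeasure \<nu> V)"
          by (rule outer_regular[OF sets\<nu> _ B(1)]) (use fin\<nu>[of "space \<nu>"] in auto)
        moreover have "emeasure \<nu> B < emeasure \<nu> B + ennreal (e * (1/2) ^ Suc m)"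
          using fin\<nu>[of B] e by (simp add: ennreal_zero_less_mult_iff)
        ultimately have "(INF V \<in> {V. B \<subseteq> V \<and> open V}. emeasure \<nu> V) < emeasure \<nu> B + ennreal (e * (1/2) ^ Suc m)"
          by simp
        then obtain V where V: "B \<subseteq> V" "open V" "emeasure \<nu> V < emeasure \<nu> B + ennreal (e * (1/2) ^ Suc m)"
          unfolding INF_less_iff by auto
        have "\<theta> -` V \<inter> W m - A = (\<theta> -` V \<inter> W m) - (\<theta> -` B \<inter> W m)" using B(2) Wm by auto
        also have "emeasure M \<dots> = emeasure \<nu> (V - B)"
        proof -
          have "(\<theta> -` V \<inter> W m) - (\<theta> -` B \<inter> W m) = \<theta> -` (V - B) \<inter> W m" by auto
          then show ?thesis using \<nu>[of "V - B"] V(2) B(1) by auto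
        qed
        also have "\<dots> = emeasure \<nu> V - emeasure \<nu> B"
          using V B fin\<nu>[of B] sets\<nu> by (intro emeasure_Diff) auto
        also have "\<dots> \<le> ennreal (e * (1/2) ^ Suc m)"
          using V(3) by (intro ennreal_minus_le_iff[THEN iffD2]) (auto simp: add.commute less_imp_le)
        finally show ?thesis using V by blast
      qed
      then obtain V where V: "\<And>m. open (V m)" "\<And>m. B \<subseteq> V m"
        "\<And>m. emeasure M (\<theta> -` V m \<inter> W m - A) \<le> ennreal (e * (1/2) ^ Suc m)" by metis
      define U where "U = (\<Union>m. \<theta> -` V m \<inter> W m)"
      have oV: "openin T (\<theta> -` V m \<inter> W m)" for m
      proof -
        have "openin T (\<theta> -` (Y \<inter> V m) \<inter> space M)"
          unfolding T openin_pullback_topology using V(1)[of m] openin_open by blast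
        then have "openin T ((\<theta> -` (Y \<inter> V m) \<inter> space M) \<inter> W m)" using W(1) by (rule openin_Int)
        moreover have "(\<theta> -` (Y \<inter> V m) \<inter> space M) \<inter> W m = \<theta> -` V m \<inter> W m"
          using W(3) \<theta>Y by auto
        ultimately show ?thesis by simp
      qed
      then have U: "openin T U" unfolding U_def by auto
      have AU: "A \<subseteq> U" using W(3) V(2) B(2) by (auto simp: U_def) blast
      have "emeasure M (U - A) \<le> (\<Sum>m. emeasure M (\<theta> -` V m \<inter> W m - A))"
      proof -
        have "U - A = (\<Union>m. \<theta> -` V m \<inter> W m - A)" by (auto simp: U_def)
        moreover have "range (\<lambda>m. \<theta> -` V m \<inter> W m - A) \<subseteq> sets M" using op[OF oV] A by auto
        ultimately show ?thesis using emeasure_subadditive_countably[of "\<lambda>m. \<theta> -` V m \<inter> W m - A" M] by simp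
      qed
      also have "\<dots> \<le> (\<Sum>m. ennreal (e * (1/2) ^ Suc m))" by (intro suminf_le V(3)) auto
      also have "\<dots> = ennreal e"
      proof -
        have "(\<lambda>m. e * (1/2) ^ Suc m) sums (e * 1)" by (rule sums_mult[OF power_half_series])
        then show ?thesis using e by (intro suminf_ennreal_eq) auto
      qed
      finally have UA: "emeasure M (U - A) \<le> ennreal e" .
      have "(INF U\<in>{U. openin T U \<and> A \<subseteq> U}. emeasure M U) \<le> emeasure M U"
        by (rule INF_lower) (use U AU in auto)
      also have "\<dots> = emeasure M A + emeasure M (U - A)"
        using AU A op[OF U] by (subst plus_emeasure) (auto simp: Un_absorb1)
      also have "\<dots> \<le> emeasure M A + ennreal e" using UA by (rule add_left_mono)
      finally show "(INF U\<in>{U. openin T U \<and> A \<subseteq> U}. emeasure M U) \<le> emeasure M A + ennreal e" .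
    qed
  qed
  show ?thesis unfolding radon_def using fin inner outer by auto
qed

context G_continuous_family
begin

text \<open>Topology and action are those of \<open>Y\<close>, carried over by
  \<open>\<theta>\<close>. The measure is not examined on \<open>Y\<close>: that the action
  preserves it follows from a.e. equality with \<open>S g\<close>.\<close>

lemma lifted_topology:
  assumes \<theta>: "measurable_retract M (restrict_space borel Y) \<theta> \<theta>'"
    and \<theta>': "measurable_retract (restrict_space borel Y) M \<theta>' \<theta>"
    and AE\<theta>: "AE x in M. \<theta> x = orbit_values x"
  shows "\<exists>T. polish_topology T \<and> locally_compact_space T \<and> induces_borel_structure T M \<and> radon T M \<and>
    (\<exists>\<beta>. group_action G (space M) \<beta> \<and> continuous_map (prod_topology TG T) T (\<lambda>(g, x). \<beta> g x) \<and>
      (\<forall>g\<in>carrier G. \<beta> g \<in> mp_bij M \<and> (AE x in M. \<beta> g x = S g x)))"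
proof -
  define T where "T = pullback_topology (space M) \<theta> (top_of_set Y)"
  have l: "\<theta>' (\<theta> x) = x" if "x \<in> space M" for x using \<theta> that by (simp add: measurable_retract_def)
  have r: "\<theta> (\<theta>' y) = y" if "y \<in> Y" for y using \<theta>' that by (simp add: measurable_retract_def space_restrict_space)
  have \<theta>m: "\<theta> \<in> M \<rightarrow>\<^sub>M restrict_space borel Y" and \<theta>'m: "\<theta>' \<in> restrict_space borel Y \<rightarrow>\<^sub>M M"
    using \<theta> by (auto simp: measurable_retract_def)
  have \<theta>Y: "\<theta> x \<in> Y" if "x \<in> space M" for x
    using measurable_space[OF \<theta>m that] by (simp add: space_restrict_space)
  have \<theta>'X: "\<theta>' y \<in> space M" if "y \<in> Y" for y
    using measurable_space[OF \<theta>'m, of y] that by (simp add: space_restrict_space)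
  have \<theta>b: "\<theta> \<in> borel_measurable M" using \<theta>m by (simp add: measurable_restrict_space2_iff)
  have hm: "homeomorphic_maps T (top_of_set Y) \<theta> \<theta>'"
    unfolding T_def using \<theta>Y \<theta>'X l r by (intro pullback_homeomorphic_maps) auto
  have c\<theta>: "continuous_map T (top_of_set Y) \<theta>" and c\<theta>': "continuous_map (top_of_set Y) T \<theta>'"
    using hm by (auto simp: homeomorphic_maps_def)
  have hs: "T homeomorphic_space top_of_set Y" using hm unfolding homeomorphic_space_def by blast
  have polT: "polish_topology T"
    using polish_Y homeomorphic_completely_metrizable_space[OF hs] homeomorphic_separable_space[OF hs]
    by (simp add: polish_topology_def)
  have lcT: "locally_compact_space T"
    using locally_compact_Y homeomorphic_locally_compact_space[OF hs] by simp
  have ind: "induces_borel_structure T M"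
    unfolding T_def by (rule induces_borel_structure_pullback(2)[OF \<theta> borel_Y])
  then have topT: "topspace T = space M" by (simp add: induces_borel_structure_def)
  \<comment> \<open>A point of \<open>Y\<close> is nonnegative and not 0, so some coordinate exceeds
    some \<open>1 / real (Suc m)\<close>. These countably many open sets have preimages of finite
    measure; finitely many cover a given compact set, and all together give the cover for outer
    regularity.\<close>
  define O' where "O' = (\<lambda>(k :: nat \<times> nat, m :: nat). {z :: nat \<times> nat \<Rightarrow> real. 1 / real (Suc m) < z k})"
  have open_O': "open (O' p)" for p
    unfolding O'_def case_prod_unfold
    by (intro open_Collect_less continuous_on_const continuous_on_product_coordinates)
  have cover: "y \<in> (\<Union>p. O' p)" if y: "y \<in> Y" for y
  proof -
    have "y \<noteq> (\<lambda>_. 0)" "\<And>k. 0 \<le> y k" using y by (auto simp: Y_def Z_def)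
    then obtain k where "0 < y k" by (metis less_eq_real_def ext)
    then obtain m where "1 / real (Suc m) < y k" using nat_approx_posE by metis
    then have "y \<in> O' (k, m)" by (simp add: O'_def)
    then show ?thesis by blast
  qed
  define W where "W p = {x \<in> space M. \<theta> x \<in> O' p}" for p
  have W_open: "openin T (W p)" for p
  proof -
    have "openin T {x \<in> topspace T. \<theta> x \<in> Y \<inter> O' p}"
      by (rule openin_continuous_map_preimage[OF c\<theta>]) (simp add: openin_open_Int open_O')
    moreover have "{x \<in> topspace T. \<theta> x \<in> Y \<inter> O' p} = W p" using \<theta>Y topT by (auto simp: W_def)
    ultimately show ?thesis by simp
  qed
  have W_sets: "W p \<in> sets M" for p using W_open[of p] ind by (simp add: induces_borel_structure_def)
  have W_fin: "emeasure M (W p) < \<infinity>" for p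
  proof -
    obtain k m where p: "p = (k, m)" by (metis surj_pair)
    have om: "(\<lambda>x. orbit_values x k) \<in> borel_measurable M"
      by (rule measurable_product_then_coordinatewise) (rule orbit_values_measurable)
    have "emeasure M (W p) = emeasure M {x \<in> space M. 1 / real (Suc m) < orbit_values x k}"
    proof (rule emeasure_eq_AE)
      show "AE x in M. (x \<in> W p) = (x \<in> {x \<in> space M. 1 / real (Suc m) < orbit_values x k})"
        using AE\<theta> by eventually_elim (simp add: W_def O'_def p)
      show "{x \<in> space M. 1 / real (Suc m) < orbit_values x k} \<in> sets M" using om by measurable
    qed (rule W_sets)
    then show ?thesis using orbit_values_finite[of "1 / real (Suc m)" k] by simp
  qed
  have rad: "radon T M"
  proof (rule radon_pullback[OF \<theta> borel_Y T_def])
    fix K assume K: "compactin T K"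
    have K_M: "K \<subseteq> space M" using compactin_subset_topspace[OF K] topT by simp
    have "compactin (top_of_set Y) (\<theta> ` K)" by (rule image_compactin[OF K c\<theta>])
    then have cK: "compact (\<theta> ` K)" "\<theta> ` K \<subseteq> Y" by (auto simp: compactin_subtopology compactin_euclidean_iff)
    then have cov: "\<theta> ` K \<subseteq> (\<Union>p\<in>UNIV. O' p)" using cover by blast
    obtain C where C: "C \<subseteq> UNIV" "finite C" "\<theta> ` K \<subseteq> (\<Union>p\<in>C. O' p)"
      by (rule compactE_image[OF cK(1) open_O' cov])
    have "K \<subseteq> (\<Union>p\<in>C. W p)" using C(3) K_M by (fastforce simp: W_def)
    then have "emeasure M K \<le> emeasure M (\<Union>p\<in>C. W p)"
      by (rule emeasure_mono) (use C(2) W_sets in blast)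
    also have "\<dots> \<le> (\<Sum>p\<in>C. emeasure M (W p))"
      by (rule emeasure_subadditive_finite) (use C(2) W_sets in auto)
    also have "\<dots> < \<infinity>" using C(2) W_fin by (simp add: ennreal_sum_less_top less_top)
    finally show "emeasure M K < \<infinity>" .
  next
    fix U assume U: "openin T U"
    have US: "U \<subseteq> space M" using openin_subset[OF U] topT by simp
    have "openin (top_of_set Y) {y \<in> topspace (top_of_set Y). \<theta>' y \<in> U}"
      by (rule openin_continuous_map_preimage[OF c\<theta>' U])
    then obtain K where K: "incseq K" "\<And>m. compact (K m)" "\<And>m. K m \<subseteq> {y \<in> Y. \<theta>' y \<in> U}"
      "(\<Union>m. K m) = {y \<in> Y. \<theta>' y \<in> U}"
      using sigma_compact_open[of "{y \<in> Y. \<theta>' y \<in> U}"] by auto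
    show "\<exists>K. incseq K \<and> (\<forall>m::nat. compactin T (K m) \<and> K m \<subseteq> U) \<and> (\<Union>m. K m) = U"
    proof (intro exI[of _ "\<lambda>m. \<theta>' ` K m"] conjI allI)
      show "incseq (\<lambda>m. \<theta>' ` K m)" using K(1) by (auto simp: incseq_def intro!: image_mono)
      show "compactin T (\<theta>' ` K m)" for m
      proof (rule image_compactin[OF _ c\<theta>'])
        show "compactin (top_of_set Y) (K m)" using K(2,3)[of m] by (auto simp: compactin_subtopology compactin_euclidean_iff)
      qed
      show "\<theta>' ` K m \<subseteq> U" for m using K(3) by auto
      have "(\<Union>m. \<theta>' ` K m) = \<theta>' ` {y \<in> Y. \<theta>' y \<in> U}" unfolding K(4)[symmetric] by auto
      also have "\<dots> = U"
      proof
        show "U \<subseteq> \<theta>' ` {y \<in> Y. \<theta>' y \<in> U}"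
        proof
          fix x assume "x \<in> U"
          then show "x \<in> \<theta>' ` {y \<in> Y. \<theta>' y \<in> U}" using l[of x] US \<theta>Y[of x] by (intro image_eqI[of _ _ "\<theta> x"]) auto
        qed
      qed auto
      finally show "(\<Union>m. \<theta>' ` K m) = U" .
    qed
  next
    show "openin T (W (from_nat m))" "emeasure M (W (from_nat m)) < \<infinity>" for m by (rule W_open W_fin)+
    show "(\<Union>m. W (from_nat m)) = space M"
    proof
      show "space M \<subseteq> (\<Union>m. W (from_nat m))"
      proof
        fix x assume x: "x \<in> space M"
        then obtain p where "\<theta> x \<in> O' p" using cover[OF \<theta>Y] by blast
        then have "x \<in> W (from_nat (to_nat p))" using x by (simp add: W_def)
        then show "x \<in> (\<Union>m. W (from_nat m))" by blast
      qed
    qed (auto simp: W_def)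
  qed
  define \<beta> where "\<beta> g = (\<lambda>x\<in>space M. \<theta>' (act g (\<theta> x)))" for g
  have \<beta>X: "\<beta> g x \<in> space M" if "g \<in> carrier G" "x \<in> space M" for g x
    using that act_Y \<theta>Y \<theta>'X by (simp add: \<beta>_def)
  have \<beta>mult: "\<beta> (g \<otimes> h) x = \<beta> g (\<beta> h x)" if "g \<in> carrier G" "h \<in> carrier G" "x \<in> space M" for g h x
  proof -
    have y: "\<theta> x \<in> Y" "\<theta> x \<in> Z" using \<theta>Y that(3) by (auto simp: Y_def)
    show ?thesis
      using that \<beta>X[OF that(2,3)] act_mult[OF y(2) that(1,2)] r[OF act_Y[OF y(1) that(2)]] by (simp add: \<beta>_def)
  qed
  have \<beta>one: "\<beta> \<one> x = x" if "x \<in> space M" for x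
    using that \<theta>Y[OF that] act_one[of "\<theta> x"] l by (simp add: \<beta>_def Y_def)
  have \<beta>inv: "\<beta> (inv g) (\<beta> g x) = x" "\<beta> g (\<beta> (inv g) x) = x" if "g \<in> carrier G" "x \<in> space M" for g x
    using that \<beta>mult[of "inv g" g x] \<beta>mult[of g "inv g" x] \<beta>one by auto
  have bij: "bij_betw (\<beta> g) (space M) (space M)" if "g \<in> carrier G" for g
    by (rule bij_betw_byWitness[of _ "\<beta> (inv g)"]) (use that \<beta>inv \<beta>X in auto)
  then have Bij: "\<beta> g \<in> Bij (space M)" if "g \<in> carrier G" for g
    using that by (simp add: Bij_def \<beta>_def)
  have ga: "group_action G (space M) \<beta>"
  proof (intro group_action.intro group_hom.intro group_hom_axioms.intro is_group group_BijGroup)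
    show "\<beta> \<in> hom G (BijGroup (space M))"
    proof (rule homI)
      fix g h assume gh: "g \<in> carrier G" "h \<in> carrier G"
      have "\<beta> (g \<otimes> h) = compose (space M) (\<beta> g) (\<beta> h)"
        by (rule extensionalityI[of _ "space M"]) (use gh \<beta>mult in \<open>auto simp: compose_eq \<beta>_def\<close>)
      then show "\<beta> (g \<otimes> h) = \<beta> g \<otimes>\<^bsub>BijGroup (space M)\<^esub> \<beta> h"
        using Bij gh by (simp add: BijGroup_def)
    qed (simp add: BijGroup_def Bij)
  qed
  have cont: "continuous_map (prod_topology TG T) T (\<lambda>(g, x). \<beta> g x)"
  proof -
    have 1: "continuous_map (prod_topology TG T) (prod_topology TG (top_of_set Y)) (\<lambda>p. (fst p, \<theta> (snd p)))"
      by (intro continuous_map_pairedI continuous_map_fst continuous_map_compose[OF continuous_map_snd c\<theta>, unfolded comp_def])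
    have "prod_topology TG (top_of_set Y) = subtopology (prod_topology TG (top_of_set Z)) (topspace TG \<times> Y)"
    proof -
      have "top_of_set Y = subtopology (top_of_set Z) Y"
        by (simp add: subtopology_subtopology Y_def Int_absorb1 Diff_subset)
      then show ?thesis using prod_topology_subtopology(2)[of TG "top_of_set Z" Y] by simp
    qed
    then have "continuous_map (prod_topology TG (top_of_set Y)) (top_of_set Z) (\<lambda>(g, z). act g z)"
      using continuous_map_from_subtopology[OF continuous_act] by simp
    then have 2: "continuous_map (prod_topology TG (top_of_set Y)) (top_of_set Y) (\<lambda>(g, z). act g z)"
      using act_Y by (auto simp: continuous_map_in_subtopology topspace_G)
    have "continuous_map (prod_topology TG T) T (\<theta>' \<circ> ((\<lambda>(g, z). act g z) \<circ> (\<lambda>p. (fst p, \<theta> (snd p)))))"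
      by (intro continuous_map_compose[OF _ c\<theta>'] continuous_map_compose[OF 1 2])
    then show ?thesis
      by (rule continuous_map_eq) (auto simp: topT \<beta>_def)
  qed
  have AE\<beta>: "AE x in M. \<beta> g x = S g x" if g: "g \<in> carrier G" for g
  proof -
    \<comment> \<open>Both \<open>x\<close> and \<open>S g x\<close> must be points at which
      \<open>\<theta>\<close> is the orbit map; for the second this uses that \<open>S g\<close>
      preserves null sets.\<close>
    have "AE x in M. \<theta> (S g x) = orbit_values (S g x)" by (rule mp_bij_AE(1)[OF S_mp[OF g] AE\<theta>])
    then show ?thesis using AE\<theta> act_orbit_values[OF g] AE_space
    proof eventually_elim
      case (elim x)
      then have "\<beta> g x = \<theta>' (\<theta> (S g x))" by (simp add: \<beta>_def)
      then show ?case using l mp_bij_simps(1)[OF S_mp[OF g] elim(4)] by simp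
    qed
  qed
  have \<beta>m: "\<beta> g \<in> M \<rightarrow>\<^sub>M M" if g: "g \<in> carrier G" for g
  proof (rule induces_borel_structure_measurable[OF ind ind])
    have "continuous_map T (prod_topology TG T) (\<lambda>x. (g, x))"
      using g by (intro continuous_map_pairedI continuous_map_id[unfolded id_def]) (simp add: topspace_TG)
    then show "continuous_map T T (\<beta> g)"
      using continuous_map_compose[OF _ cont] by (fastforce simp: comp_def)
  qed
  have mp: "\<beta> g \<in> mp_bij M" if g: "g \<in> carrier G" for g
  proof (rule mp_bij_of_AE[OF Bij[OF g] \<beta>m[OF g] _ S_mp[OF g] AE\<beta>[OF g]])
    have "inv_into (space M) (\<beta> g) x = \<beta> (inv g) x" if "x \<in> space M" for x
      using inv_into_f_eq[OF bij_betw_imp_inj_on[OF bij[OF g]]] \<beta>X[of "inv g" x] \<beta>inv(2)[OF g that] g that by simp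
    then show "inv_into (space M) (\<beta> g) \<in> M \<rightarrow>\<^sub>M M"
      using \<beta>m[of "inv g"] g by (simp cong: measurable_cong)
  qed
  show ?thesis
    using polT lcT ind rad ga cont mp AE\<beta> by blast
qed

end

section \<open>From approximating functions to the lifted action\<close>

lemma INF_rat_greater: "(INF q :: rat. if x < of_rat q then ereal (of_rat q) else \<infinity>) = ereal x"
proof (rule antisym)
  show "ereal x \<le> (INF q :: rat. if x < of_rat q then ereal (of_rat q) else \<infinity>)"
    by (rule INF_greatest) auto
  show "(INF q :: rat. if x < of_rat q then ereal (of_rat q) else \<infinity>) \<le> ereal x"
  proof (rule dense_ge)
    fix y assume "ereal x < y"
    then obtain z where "ereal z < y" "x < z" using ereal_dense2[of "ereal x" y] by auto
    moreover obtain q where "x < of_rat q" "of_rat q < z" using of_rat_dense[OF \<open>x < z\<close>] by auto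
    ultimately have "(if x < of_rat q then ereal (of_rat q) else \<infinity>) \<le> y"
      using less_trans[of "ereal (of_rat q)" "ereal z" y] by simp
    then show "(INF q :: rat. if x < of_rat q then ereal (of_rat q) else \<infinity>) \<le> y"
      by (rule order_trans[rotated]) (rule INF_lower, simp)
  qed
qed

lemma ex_dense_sequence:
  assumes "separable_space X" "a \<in> topspace X"
  obtains d :: "nat \<Rightarrow> 'a" where "d 0 = a" "\<And>i. d i \<in> topspace X"
    "\<And>U. openin X U \<Longrightarrow> U \<noteq> {} \<Longrightarrow> \<exists>i. d i \<in> U"
proof -
  obtain C where C: "countable C" "C \<subseteq> topspace X" "X closure_of C = topspace X"
    using assms(1) by (auto simp: separable_space_def)
  have "C \<noteq> {}" using C(3) assms(2) by auto
  define d where "d = case_nat a (from_nat_into C)"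
  have "d i \<in> topspace X" for i
    using from_nat_into[OF \<open>C \<noteq> {}\<close>] C(2) assms(2) by (cases i) (auto simp: d_def)
  moreover have "\<exists>i. d i \<in> U" if U: "openin X U" "U \<noteq> {}" for U
  proof -
    obtain x where "x \<in> U" using U(2) by blast
    then have "x \<in> X closure_of C" using C(3) openin_subset[OF U(1)] by auto
    then obtain c where "c \<in> C" "c \<in> U" using U(1) \<open>x \<in> U\<close> by (auto simp: in_closure_of)
    then obtain j where "from_nat_into C j = c" using from_nat_into_surj[OF C(1)] by blast
    then have "d (Suc j) \<in> U" using \<open>c \<in> U\<close> by (simp add: d_def)
    then show ?thesis ..
  qed
  ultimately show ?thesis using that[of d] by (simp add: d_def)
qed

text \<open>The hypothesis \<open>approx\<close> is what the density conditions have in common: sets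
  of finite measure are, up to small measure, superlevel sets of \<open>G\<close>-continuous
  functions. Applied to enough sets to reconstruct \<open>\<iota>\<close>, it provides the a.e.
  inverse of the orbit map.\<close>

lemma lift_exists:
  fixes G :: "('g, 'm) monoid_scheme" and TG :: "'g topology" and M :: "'x measure"
  assumes G: "polish_group G TG" and M: "standard_sigma_finite M" and \<alpha>: "\<alpha> \<in> hom G (Aut M)"
    and approx: "\<And>A e. A \<in> sets M \<Longrightarrow> emeasure M A < \<infinity> \<Longrightarrow> 0 < e \<Longrightarrow>
      \<exists>f :: 'x \<Rightarrow> real. f \<in> borel_measurable M \<and> (\<forall>x. 0 \<le> f x \<and> f x \<le> 1) \<and>
        (\<forall>\<delta>>0. emeasure M {x \<in> space M. \<delta> < f x} < \<infinity>) \<and>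
        (\<forall>\<delta>>0. \<exists>U. openin TG U \<and> \<one>\<^bsub>G\<^esub> \<in> U \<and>
           (\<forall>g\<in>U. \<forall>T\<in>\<alpha> g. AE x in M. \<bar>f x - f (inv_into (space M) T x)\<bar> \<le> \<delta>)) \<and>
        emeasure M {x \<in> space M. (1/2 < f x) \<noteq> (x \<in> A)} < ennreal e"
  shows "\<exists>T. polish_topology T \<and> locally_compact_space T \<and> induces_borel_structure T M \<and>
            radon T M \<and> lifts_to_continuous_action G TG M T \<alpha>"
proof -
  have grp: "group G" and topG: "topspace TG = carrier G" and sepG: "separable_space TG"
    using G by (auto simp: polish_group_def polish_topology_def)
  interpret G: group G by fact
  obtain S where S_mp: "\<And>g. g \<in> carrier G \<Longrightarrow> S g \<in> mp_bij M"
    and S\<alpha>: "\<And>g. g \<in> carrier G \<Longrightarrow> \<alpha> g = aut_class M (S g)"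
    and S_mult: "\<And>g h. g \<in> carrier G \<Longrightarrow> h \<in> carrier G \<Longrightarrow> AE x in M. S (g \<otimes>\<^bsub>G\<^esub> h) x = S g (S h x)"
    and S_one: "AE x in M. S \<one>\<^bsub>G\<^esub> x = x"
    using hom_Aut_representatives[OF grp \<alpha>] by blast
  have sb: "standard_borel M" and \<sigma>: "sigma_finite_measure M" and at: "atomless M" and nz: "emeasure M (space M) \<noteq> 0"
    using M by (auto simp: standard_sigma_finite_def)
  obtain T0 where T0: "polish_topology T0" "induces_borel_structure T0 M" using sb by (auto simp: standard_borel_def)
  have "space M \<noteq> {}" using sb by (auto simp: standard_borel_def)
  then obtain \<iota> r where \<iota>: "measurable_retract M (borel :: real measure) \<iota> r"
    using retract_polish_real[OF T0] by blast
  have \<iota>m [measurable]: "\<iota> \<in> borel_measurable M" and r\<iota>: "\<And>x. x \<in> space M \<Longrightarrow> r (\<iota> x) = x"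
    using \<iota> by (auto simp: measurable_retract_def)
  have single: "emeasure M {x} = 0" if x: "x \<in> space M" for x
  proof (rule ccontr)
    have "{x} = \<iota> -` {\<iota> x} \<inter> space M" using x r\<iota> by auto metis
    then have "{x} \<in> sets M" by simp
    moreover assume "emeasure M {x} \<noteq> 0"
    ultimately obtain B where B: "B \<subseteq> {x}" "0 < emeasure M B" "emeasure M B < emeasure M {x}"
      using at by (auto simp: atomless_def zero_less_iff_neq_zero)
    then have "B = {} \<or> B = {x}" by auto
    then show False using B by auto
  qed
  obtain E :: "nat \<Rightarrow> 'x set" where E: "range E \<subseteq> sets M" "(\<Union>i. E i) = space M" "\<And>i. emeasure M (E i) \<noteq> \<infinity>"
    using sigma_finite_measure.sigma_finite[OF \<sigma>] by auto
  have Em [measurable]: "E m \<in> sets M" for m using E(1) by auto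
  \<comment> \<open>The sets where \<open>\<iota> x < of_rat q\<close> determine
    \<open>\<iota>\<close>; they are cut down by \<open>E m\<close> because only sets of finite
    measure can be approximated.\<close>
  define A where "A = (\<lambda>(q :: rat, m). {x \<in> space M. \<iota> x < of_rat q} \<inter> E m)"
  have Am: "A p \<in> sets M" for p unfolding A_def by (cases p) simp
  have Afin: "emeasure M (A p) < \<infinity>" for p
  proof -
    obtain q m where p: "p = (q, m)" by (metis surj_pair)
    have "emeasure M (A p) \<le> emeasure M (E m)" by (rule emeasure_mono) (auto simp: A_def p)
    also have "\<dots> < \<infinity>" using E(3) by (simp add: less_top)
    finally show ?thesis .
  qed
  \<comment> \<open>A whole sequence of approximations is kept for each set, with errors
    \<open>(1/2) ^ j\<close> summable for Borel-Cantelli.\<close>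
  define good where "good p j f \<longleftrightarrow> f \<in> borel_measurable M \<and> (\<forall>x. 0 \<le> f x \<and> f x \<le> 1) \<and>
        (\<forall>\<delta>>0. emeasure M {x \<in> space M. \<delta> < f x} < \<infinity>) \<and>
        (\<forall>\<delta>>0. \<exists>U. openin TG U \<and> \<one>\<^bsub>G\<^esub> \<in> U \<and>
           (\<forall>g\<in>U. \<forall>T\<in>\<alpha> g. AE x in M. \<bar>f x - f (inv_into (space M) T x)\<bar> \<le> \<delta>)) \<and>
        emeasure M {x \<in> space M. (1/2 < f x) \<noteq> (x \<in> A p)} < ennreal ((1/2) ^ j)"
    for p and j :: nat and f :: "'x \<Rightarrow> real"
  have "\<forall>p j. \<exists>f. good p j f"
    unfolding good_def by (intro allI approx Am Afin) simp
  then obtain F where F: "good p j (F p j)" for p j by metis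
  have F_meas: "F p j \<in> borel_measurable M" and F_range: "0 \<le> F p j x \<and> F p j x \<le> 1"
    and F_fin: "0 < \<delta> \<Longrightarrow> emeasure M {x \<in> space M. \<delta> < F p j x} < \<infinity>"
    and F_cont: "0 < \<delta> \<Longrightarrow> \<exists>U. openin TG U \<and> \<one>\<^bsub>G\<^esub> \<in> U \<and>
           (\<forall>g\<in>U. \<forall>T\<in>\<alpha> g. AE x in M. \<bar>F p j x - F p j (inv_into (space M) T x)\<bar> \<le> \<delta>)"
    and F_approx: "emeasure M {x \<in> space M. (1/2 < F p j x) \<noteq> (x \<in> A p)} < ennreal ((1/2) ^ j)"
    for p j x \<delta>
    using F[of p j] unfolding good_def by blast+
  define f where "f n = (case from_nat n of (p, j) \<Rightarrow> F p j)" for n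
  have f_eq: "f (to_nat (p, j)) = F p j" for p j by (simp add: f_def)
  have f_F: "\<exists>p j. f n = F p j" for n unfolding f_def by (metis case_prod_beta)
  obtain d :: "nat \<Rightarrow> 'g" where d: "d 0 = \<one>\<^bsub>G\<^esub>" "\<And>i. d i \<in> topspace TG"
    "\<And>U. openin TG U \<Longrightarrow> U \<noteq> {} \<Longrightarrow> \<exists>i. d i \<in> U"
    by (rule ex_dense_sequence[OF sepG, of "\<one>\<^bsub>G\<^esub>"]) (use topG in auto)
  have d_carrier: "d i \<in> carrier G" for i using d(2)[of i] topG by simp
  interpret G_continuous_family G TG M S f d
  proof
    fix n e assume e: "(0::real) < e"
    obtain p j where fn: "f n = F p j" using f_F by blast
    show "emeasure M {x \<in> space M. e < f n x} < \<infinity>" using F_fin[OF e] fn by simp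
    obtain U where U: "openin TG U" "\<one>\<^bsub>G\<^esub> \<in> U"
      "\<forall>g\<in>U. \<forall>T\<in>\<alpha> g. AE x in M. \<bar>F p j x - F p j (inv_into (space M) T x)\<bar> \<le> e"
      using F_cont[OF e] by blast
    have "AE x in M. \<bar>f n (S g x) - f n x\<bar> \<le> e" if g: "g \<in> U" for g
    proof -
      have gG: "g \<in> carrier G" using openin_subset[OF U(1)] g topG by auto
      have "S g \<in> \<alpha> g" using S\<alpha>[OF gG] S_mp[OF gG] by (simp add: aut_class_iff)
      then have "AE x in M. \<bar>f n x - f n (inv_into (space M) (S g) x)\<bar> \<le> e" using U(3) g fn by auto
      \<comment> \<open>Substituting \<open>S g x\<close> for \<open>x\<close> replaces the inverse
        by \<open>S g\<close> itself.\<close>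
      then have "AE x in M. \<bar>f n (S g x) - f n (inv_into (space M) (S g) (S g x))\<bar> \<le> e"
        by (rule mp_bij_AE(1)[OF S_mp[OF gG]])
      then show ?thesis using AE_space by eventually_elim (simp add: mp_bij_simps(3)[OF S_mp[OF gG]])
    qed
    then show "\<exists>U. openin TG U \<and> \<one>\<^bsub>G\<^esub> \<in> U \<and> (\<forall>g\<in>U. AE x in M. \<bar>f n (S g x) - f n x\<bar> \<le> e)"
      using U by blast
  next
    fix n x
    show "f n \<in> borel_measurable M" "0 \<le> f n x" "f n x \<le> 1"
      using f_F[of n] F_meas F_range by auto
  qed (use G S_mp S_mult S_one d(1,3) d_carrier in auto)
  \<comment> \<open>\<open>P y p\<close> decodes membership in \<open>A p\<close> from the
    coordinates with second index 0, where \<open>d 0\<close> is the identity. \<open>h\<close> then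
    takes the infimum of the rationals above \<open>\<iota> x\<close>; \<open>m\<close> is
    quantified away since the sets \<open>E m\<close> cover the space.\<close>
  define P where "P y p \<longleftrightarrow> (\<exists>J :: nat. \<forall>j\<ge>J. 1/2 < y (to_nat (p, j), 0 :: nat))" for y :: "nat \<times> nat \<Rightarrow> real" and p :: "rat \<times> nat"
  define h where "h y = real_of_ereal (INF q. if \<exists>m. P y (q, m) then ereal (of_rat q) else \<infinity>)" for y
  have hm: "h \<in> borel_measurable borel"
  proof -
    define c where "c k y = y k" for k :: "nat \<times> nat" and y :: "nat \<times> nat \<Rightarrow> real"
    have [measurable]: "c k \<in> borel_measurable borel" for k
      unfolding c_def by (rule measurable_product_then_coordinatewise) simp
    have [measurable]: "Measurable.pred borel (\<lambda>y. P y p)" for p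
      unfolding P_def c_def[symmetric] by measurable
    show ?thesis unfolding h_def by measurable
  qed
  \<comment> \<open>By Borel-Cantelli almost every point is misclassified by only finitely many of
    the approximations to each set.\<close>
  have ev: "AE x in M. \<forall>p. \<exists>J. \<forall>j\<ge>J. (1/2 < F p j x) = (x \<in> A p)"
    unfolding AE_all_countable
  proof
    fix p
    define D where "D j = {x \<in> space M. (1/2 < F p j x) \<noteq> (x \<in> A p)}" for j
    have Dm: "D j \<in> sets M" for j
    proof -
      have [measurable]: "F p j \<in> borel_measurable M" "A p \<in> sets M" by (rule F_meas Am)+
      show ?thesis unfolding D_def by measurable
    qed
    have Dj: "emeasure M (D j) < ennreal ((1/2) ^ j)" for j using F_approx by (simp add: D_def)
    have "AE x in M. eventually (\<lambda>j. x \<in> space M - D j) sequentially"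
    proof (rule borel_cantelli_AE1[OF Dm])
      show "emeasure M (D j) < \<infinity>" for j using Dj[of j] less_trans ennreal_less_top by fastforce
      show "summable (\<lambda>j. measure M (D j))"
      proof (rule summable_comparison_test')
        show "summable (\<lambda>j. (1/2::real) ^ j)" by (simp add: summable_geometric)
        show "norm (measure M (D j)) \<le> (1/2) ^ j" for j
          using Dj[of j] by (simp add: measure_def enn2real_leI less_imp_le)
      qed
    qed
    then show "AE x in M. \<exists>J. \<forall>j\<ge>J. (1/2 < F p j x) = (x \<in> A p)"
      by eventually_elim (auto simp: eventually_sequentially D_def)
  qed
  have PA: "AE x in M. \<forall>p. P (orbit_values x) p \<longleftrightarrow> x \<in> A p"
    using ev S_one
  proof eventually_elim
    case (elim x)
    have o: "orbit_values x (to_nat (p, j), 0) = F p j x" for p j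
      using elim(2) by (simp add: orbit_values_def d(1) f_eq)
    show ?case
    proof
      fix p
      obtain J where J: "\<forall>j\<ge>J. (1/2 < F p j x) = (x \<in> A p)" using elim(1) by blast
      show "P (orbit_values x) p \<longleftrightarrow> x \<in> A p"
      proof
        assume "P (orbit_values x) p"
        then obtain J' where "\<forall>j\<ge>J'. 1/2 < F p j x" by (auto simp: P_def o)
        then show "x \<in> A p" using J by (metis nle_le)
      next
        assume "x \<in> A p"
        then show "P (orbit_values x) p" using J by (auto simp: P_def o)
      qed
    qed
  qed
  have h\<iota>: "AE x in M. h (orbit_values x) = \<iota> x"
    using PA AE_space
  proof eventually_elim
    case (elim x)
    have *: "(\<exists>m. P (orbit_values x) (q, m)) \<longleftrightarrow> \<iota> x < of_rat q" for q
      using elim E(2) by (auto simp: A_def)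
    show ?case unfolding h_def * INF_rat_greater by simp
  qed
  \<comment> \<open>Every point lies in some \<open>A p\<close>, so almost every orbit has a
    coordinate above 1/2 and is not 0.\<close>
  have oY: "AE x in M. orbit_values x \<in> Y"
    using PA AE_space orbit_values_in_Z
  proof eventually_elim
    case (elim x)
    obtain m where m: "x \<in> E m" using elim(2) E(2) by blast
    obtain q where "\<iota> x < of_rat q" using of_rat_dense[of "\<iota> x" "\<iota> x + 1"] by auto
    then have "P (orbit_values x) (q, m)" using m elim by (simp add: A_def)
    then obtain k where "1/2 < orbit_values x k" by (auto simp: P_def)
    then have "orbit_values x k \<noteq> 0" by linarith
    then have "orbit_values x \<noteq> (\<lambda>_. 0)" by metis
    then show ?case using elim(3) by (simp add: Y_def)
  qed
  obtain \<theta> \<theta>' where "measurable_retract M (restrict_space borel Y) \<theta> \<theta>'"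
      "measurable_retract (restrict_space borel Y) M \<theta>' \<theta>" "AE x in M. \<theta> x = orbit_values x"
    using ae_isomorphism[OF \<iota> \<sigma> nz single borel_Y orbit_values_measurable oY hm h\<iota>] by blast
  from lifted_topology[OF this] obtain T \<beta> where T: "polish_topology T" "locally_compact_space T"
      "induces_borel_structure T M" "radon T M" "group_action G (space M) \<beta>"
      "continuous_map (prod_topology TG T) T (\<lambda>(g, x). \<beta> g x)"
      "\<forall>g\<in>carrier G. \<beta> g \<in> mp_bij M \<and> (AE x in M. \<beta> g x = S g x)" by blast
  have "aut_class M (\<beta> g) = \<alpha> g" if "g \<in> carrier G" for g
    using aut_class_eqI[of "\<beta> g" M "S g"] T(7) S_mp S\<alpha> that by auto
  then have "lifts_to_continuous_action G TG M T \<alpha>"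
    unfolding lifts_to_continuous_action_def using T(5-7) by blast
  then show ?thesis using T(1-4) by blast
qed

section \<open>Density in Lebesgue spaces\<close>

lemma Linf_norm_AE: "Linf_norm M f < ereal e \<Longrightarrow> AE x in M. cmod (f x) \<le> e"
  using esssup_AE[of "\<lambda>x. ereal (cmod (f x))" M] unfolding Linf_norm_def
  by eventually_elim (metis ereal_less_eq(3) less_imp_le order_trans)

lemma Linf_norm_le:
  assumes "f \<in> borel_measurable M" "AE x in M. cmod (f x) \<le> c"
  shows "Linf_norm M f \<le> ereal c"
  unfolding Linf_norm_def by (rule esssup_I) (use assms in auto)

text \<open>The sum is at most twice the maximum. This crude bound holds for every positive exponent
  and takes the place of Minkowski's inequality.\<close>

lemma powr_triangle:
  fixes a b :: real
  assumes "0 < p" "0 \<le> a" "0 \<le> b" "c \<le> a + b" "0 \<le> c"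
  shows "c powr p \<le> 2 powr p * (a powr p + b powr p)"
proof -
  have "c powr p \<le> (2 * max a b) powr p" using assms by (intro powr_mono2) auto
  also have "\<dots> = 2 powr p * (max a b) powr p" using assms by (simp add: powr_mult)
  also have "(max a b) powr p \<le> a powr p + b powr p" by (cases "a \<le> b") (auto simp: max_def)
  finally show ?thesis by simp
qed

lemma nn_integral_powr_triangle:
  fixes f g h :: "'x \<Rightarrow> complex"
  assumes p: "0 < p" and [measurable]: "f \<in> borel_measurable M" "g \<in> borel_measurable M"
    and le: "\<And>x. x \<in> space M \<Longrightarrow> cmod (h x) \<le> cmod (f x) + cmod (g x)"
  shows "(\<integral>\<^sup>+ x. ennreal (cmod (h x) powr p) \<partial>M) \<le>
    ennreal (2 powr p) * ((\<integral>\<^sup>+ x. ennreal (cmod (f x) powr p) \<partial>M) + (\<integral>\<^sup>+ x. ennreal (cmod (g x) powr p) \<partial>M))"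
proof -
  have "(\<integral>\<^sup>+ x. ennreal (cmod (h x) powr p) \<partial>M) \<le>
      (\<integral>\<^sup>+ x. ennreal (2 powr p) * (ennreal (cmod (f x) powr p) + ennreal (cmod (g x) powr p)) \<partial>M)"
    by (intro nn_integral_mono)
      (use powr_triangle[OF p _ _ le] in \<open>simp add: ennreal_mult'[symmetric] ennreal_plus[symmetric] del: ennreal_plus\<close>)
  also have "\<dots> = ennreal (2 powr p) * ((\<integral>\<^sup>+ x. ennreal (cmod (f x) powr p) \<partial>M) + (\<integral>\<^sup>+ x. ennreal (cmod (g x) powr p) \<partial>M))"
    by (subst nn_integral_cmult) (auto simp: nn_integral_add)
  finally show ?thesis .
qed

lemma Lp_nn_integral:
  assumes "f \<in> borel_measurable M"
  shows "f \<in> Lp M p \<longleftrightarrow> (\<integral>\<^sup>+ x. ennreal (cmod (f x) powr p) \<partial>M) < \<infinity>"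
  using assms by (simp add: Lp_def integrable_iff_bounded)

lemma Lp_norm_less_iff:
  assumes "0 < p" "f \<in> borel_measurable M" "0 < e" "f \<in> Lp M p"
  shows "Lp_norm M p f < e \<longleftrightarrow> (\<integral>\<^sup>+ x. ennreal (cmod (f x) powr p) \<partial>M) < ennreal (e powr p)"
proof -
  define I where "I = (\<integral>x. cmod (f x) powr p \<partial>M)"
  have I0: "0 \<le> I" unfolding I_def by (rule integral_nonneg_AE) simp
  have "(\<integral>\<^sup>+ x. ennreal (cmod (f x) powr p) \<partial>M) = ennreal I"
    unfolding I_def using assms(4) by (intro nn_integral_eq_integral) (auto simp: Lp_def)
  moreover have "Lp_norm M p f < e \<longleftrightarrow> I < e powr p"
  proof
    assume "Lp_norm M p f < e"
    then have "(I powr (1/p)) powr p < e powr p"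
      using assms(1) by (intro powr_less_mono2) (auto simp: Lp_norm_def I_def)
    then show "I < e powr p" using assms(1) I0 by (simp add: powr_powr)
  next
    assume "I < e powr p"
    then have "I powr (1/p) < (e powr p) powr (1/p)" using assms(1) I0 by (intro powr_less_mono2) auto
    then show "Lp_norm M p f < e" using assms(1,3) by (simp add: powr_powr Lp_norm_def I_def)
  qed
  ultimately show ?thesis using I0 by (simp add: ennreal_less_iff)
qed

lemma Lp_diff:
  assumes p: "0 < p" and "f \<in> Lp M p" "g \<in> Lp M p"
  shows "(\<lambda>x. f x - g x) \<in> Lp M p"
proof -
  have [measurable]: "f \<in> borel_measurable M" "g \<in> borel_measurable M" using assms by (auto simp: Lp_def)
  have "(\<integral>\<^sup>+ x. ennreal (cmod (f x - g x) powr p) \<partial>M) \<le> ennreal (2 powr p) *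
      ((\<integral>\<^sup>+ x. ennreal (cmod (f x) powr p) \<partial>M) + (\<integral>\<^sup>+ x. ennreal (cmod (g x) powr p) \<partial>M))"
    by (rule nn_integral_powr_triangle[OF p]) (auto intro: norm_triangle_ineq4)
  also have "\<dots> < \<infinity>" using assms(2,3) by (auto simp: Lp_nn_integral ennreal_mult_less_top)
  finally show ?thesis by (simp add: Lp_nn_integral)
qed

text \<open>Linearity passes from indicators to simple functions, dominated convergence from there
  to all of the space. \<open>N\<close> is the \<open>p\<close>-th power of the norm, so combining
  two errors costs a factor \<open>2 powr p\<close>.\<close>

lemma Lp_dense_of_indicators:
  assumes p: "0 < p" and F: "F \<subseteq> Lp M p"
    and zero: "(\<lambda>_. 0) \<in> F"
    and add: "\<And>f g. f \<in> F \<Longrightarrow> g \<in> F \<Longrightarrow> (\<lambda>x. f x + g x) \<in> F"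
    and scale: "\<And>f c. f \<in> F \<Longrightarrow> (\<lambda>x. c * f x) \<in> F"
    and ind: "\<And>A e. A \<in> sets M \<Longrightarrow> emeasure M A < \<infinity> \<Longrightarrow> 0 < e \<Longrightarrow>
      \<exists>h\<in>F. (\<integral>\<^sup>+ x. ennreal (cmod (indicator A x - h x) powr p) \<partial>M) < ennreal e"
  shows "Lp_dense M p F"
proof -
  define N where "N f = (\<integral>\<^sup>+ x. ennreal (cmod (f x) powr p) \<partial>M)" for f
  define App where "App f \<longleftrightarrow> f \<in> borel_measurable M \<and> (\<forall>e>0. \<exists>h\<in>F. N (\<lambda>x. f x - h x) < ennreal e)" for f
  have Fm: "h \<in> borel_measurable M" if "h \<in> F" for h using F that by (auto simp: Lp_def)
  have p2: "0 < 2 powr p" by simp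
  have close: "\<exists>h\<in>F. N (\<lambda>x. f x - h x) < ennreal e"
    if e: "0 < e" and ap: "\<And>e. 0 < e \<Longrightarrow> \<exists>u v h. u \<in> borel_measurable M \<and> v \<in> borel_measurable M \<and> h \<in> F \<and>
      (\<forall>x\<in>space M. f x - h x = u x + v x) \<and> N u < ennreal e \<and> N v < ennreal e" for f e
  proof -
    \<comment> \<open>Two errors \<open>e'\<close>, multiplied by the triangle constant
      \<open>2 powr p\<close>, add up to \<open>e\<close>.\<close>
    define e' where "e' = e / (2 * 2 powr p)"
    have e': "0 < e'" using e by (simp add: e'_def)
    obtain u v h where u: "u \<in> borel_measurable M" "v \<in> borel_measurable M" "h \<in> F"
      "\<forall>x\<in>space M. f x - h x = u x + v x" "N u < ennreal e'" "N v < ennreal e'" using ap[OF e'] by blast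
    have "N (\<lambda>x. f x - h x) \<le> ennreal (2 powr p) * (N u + N v)"
      unfolding N_def by (rule nn_integral_powr_triangle[OF p u(1,2)]) (use u(4) in \<open>simp add: norm_triangle_ineq\<close>)
    also have "\<dots> < ennreal (2 powr p) * (ennreal e' + ennreal e')"
      using u(5,6) by (intro ennreal_mult_strict_left_mono add_strict_mono) auto
    also have "\<dots> = ennreal e"
      using e' by (simp add: ennreal_plus[symmetric] ennreal_mult'[symmetric] e'_def del: ennreal_plus)
    finally show ?thesis using u(3) by blast
  qed
  have App_add: "App (\<lambda>x. f x + g x)" if fg: "App f" "App g" for f g
    unfolding App_def
  proof (intro conjI allI impI)
    have [measurable]: "f \<in> borel_measurable M" "g \<in> borel_measurable M" using fg by (auto simp: App_def)
    show "(\<lambda>x. f x + g x) \<in> borel_measurable M" by measurable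
    fix e :: real assume "0 < e"
    then show "\<exists>h\<in>F. N (\<lambda>x. f x + g x - h x) < ennreal e"
    proof (rule close)
      fix e :: real assume "0 < e"
      then obtain h k where hk: "h \<in> F" "N (\<lambda>x. f x - h x) < ennreal e" "k \<in> F" "N (\<lambda>x. g x - k x) < ennreal e"
        using fg unfolding App_def by meson
      have [measurable]: "h \<in> borel_measurable M" "k \<in> borel_measurable M" using Fm hk by auto
      show "\<exists>u v h. u \<in> borel_measurable M \<and> v \<in> borel_measurable M \<and> h \<in> F \<and>
          (\<forall>x\<in>space M. f x + g x - h x = u x + v x) \<and> N u < ennreal e \<and> N v < ennreal e"
        using hk add[OF hk(1,3)]
        by (intro exI[of _ "\<lambda>x. f x - h x"] exI[of _ "\<lambda>x. g x - k x"] exI[of _ "\<lambda>x. h x + k x"]) simp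
    qed
  qed
  have App_scale: "App (\<lambda>x. c * f x)" if f: "App f" for c f
    unfolding App_def
  proof (intro conjI allI impI)
    have [measurable]: "f \<in> borel_measurable M" using f by (auto simp: App_def)
    show "(\<lambda>x. c * f x) \<in> borel_measurable M" by measurable
    fix e :: real assume e: "0 < e"
    \<comment> \<open>The added 1 covers \<open>c = 0\<close> and makes the final inequality
      strict.\<close>
    define e' where "e' = e / (cmod c powr p + 1)"
    have c: "0 < cmod c powr p + 1" by (simp add: add_nonneg_pos)
    then have e': "0 < e'" using e by (simp add: e'_def)
    then obtain h where h: "h \<in> F" "N (\<lambda>x. f x - h x) < ennreal e'" using f unfolding App_def by blast
    have [measurable]: "h \<in> borel_measurable M" using Fm h by auto
    have "N (\<lambda>x. c * f x - c * h x) = (\<integral>\<^sup>+ x. ennreal (cmod c powr p) * ennreal (cmod (f x - h x) powr p) \<partial>M)"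
      unfolding N_def by (intro nn_integral_cong)
        (simp add: ennreal_mult'[symmetric] powr_mult[symmetric] norm_mult[symmetric] right_diff_distrib)
    also have "\<dots> = ennreal (cmod c powr p) * N (\<lambda>x. f x - h x)"
      unfolding N_def by (rule nn_integral_cmult) measurable
    also have "\<dots> \<le> ennreal (cmod c powr p) * ennreal e'" using h(2) by (intro mult_left_mono) auto
    also have "\<dots> = ennreal (cmod c powr p * e')" using e' by (simp add: ennreal_mult')
    also have "\<dots> < ennreal e"
    proof (rule ennreal_lessI[OF e])
      have "cmod c powr p * e < e * (cmod c powr p + 1)" using e by (simp add: distrib_left mult.commute)
      then show "cmod c powr p * e' < e" using c by (simp add: e'_def pos_divide_less_eq)
    qed
    finally show "\<exists>h\<in>F. N (\<lambda>x. c * f x - h x) < ennreal e"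
      using scale[OF h(1), of c] by (intro bexI[of _ "\<lambda>x. c * h x"])
  qed
  have App_zero: "App (\<lambda>_. 0)"
    unfolding App_def using zero p by (auto simp: N_def intro!: bexI[of _ "\<lambda>_. 0"])
  have App_sum: "App (\<lambda>x. \<Sum>y\<in>I. f y x)" if "finite I" "\<And>y. y \<in> I \<Longrightarrow> App (f y)" for I :: "complex set" and f
    using that by (induction I rule: finite_induct) (auto intro: App_zero App_add)
  have App_ind: "App (indicator A)" if "A \<in> sets M" "emeasure M A < \<infinity>" for A
    unfolding App_def N_def using ind[OF that] that(1) by auto
  have App_cong: "App g" if "App f" "\<And>x. x \<in> space M \<Longrightarrow> f x = g x" for f g
  proof -
    have "N (\<lambda>x. f x - h x) = N (\<lambda>x. g x - h x)" for h
      unfolding N_def using that(2) by (auto intro!: nn_integral_cong)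
    moreover have "g \<in> borel_measurable M" using that by (auto simp: App_def cong: measurable_cong)
    ultimately show ?thesis using that(1) by (simp add: App_def)
  qed
  have App_simple: "App s" if s: "simple_function M s" and Ns: "N s < \<infinity>" for s :: "'a \<Rightarrow> complex"
  proof -
    have sm [measurable]: "s \<in> borel_measurable M" using s by (rule borel_measurable_simple_function)
    have "App (\<lambda>x. \<Sum>y\<in>s ` space M. y * indicator (s -` {y} \<inter> space M) x)"
    proof (rule App_sum)
      show "finite (s ` space M)" using s by (simp add: simple_function_def)
      fix y
      show "App (\<lambda>x. y * indicator (s -` {y} \<inter> space M) x)"
      \<comment> \<open>The level set of 0 may have infinite measure but contributes nothing; the
        others have finite measure because \<open>N s\<close> is finite.\<close>
      proof (cases "y = 0")
        case True
        then show ?thesis using App_zero by simp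
      next
        case False
        have A: "s -` {y} \<inter> space M \<in> sets M" by measurable
        have "ennreal (cmod y powr p) * emeasure M (s -` {y} \<inter> space M) =
            (\<integral>\<^sup>+ x. ennreal (cmod y powr p) * indicator (s -` {y} \<inter> space M) x \<partial>M)"
          using A by (simp add: nn_integral_cmult_indicator)
        also have "\<dots> \<le> N s" unfolding N_def by (intro nn_integral_mono) (auto simp: indicator_def)
        finally have "ennreal (cmod y powr p) * emeasure M (s -` {y} \<inter> space M) < \<infinity>" using Ns by (rule le_less_trans)
        then have "emeasure M (s -` {y} \<inter> space M) < \<infinity>" using False by (auto simp: ennreal_mult_less_top)
        then show ?thesis using A by (intro App_scale App_ind)
      qed
    qed
    then show ?thesis
    proof (rule App_cong)
      fix x assume x: "x \<in> space M"
      have "s x = (\<Sum>y\<in>s ` space M. indicator (s -` {y} \<inter> space M) x *\<^sub>R y)"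
        by (rule simple_function_indicator_representation_banach[OF s x])
      also have "\<dots> = (\<Sum>y\<in>s ` space M. y * indicator (s -` {y} \<inter> space M) x)"
        by (intro sum.cong) (auto simp: indicator_def)
      finally show "(\<Sum>y\<in>s ` space M. y * indicator (s -` {y} \<inter> space M) x) = s x" by (rule sym)
    qed
  qed
  have App_Lp: "App f" if f: "f \<in> Lp M p" for f
    unfolding App_def
  proof (intro conjI allI impI)
    show fm [measurable]: "f \<in> borel_measurable M" using f by (simp add: Lp_def)
    have Nf: "N f < \<infinity>" using f Lp_nn_integral[OF fm] by (simp add: N_def)
    obtain s where s: "\<And>i. simple_function M (s i)" "\<And>x. x \<in> space M \<Longrightarrow> (\<lambda>i. s i x) \<longlonglongrightarrow> f x"
      "\<And>i x. x \<in> space M \<Longrightarrow> dist (s i x) 0 \<le> 2 * dist (f x) 0"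
      using borel_measurable_implies_sequence_metric[OF fm, of 0] by blast
    have sm [measurable]: "s i \<in> borel_measurable M" for i using s(1) by (rule borel_measurable_simple_function)
    \<comment> \<open>The constant 3 in the dominating function arises because \<open>s i\<close> is
      bounded by twice \<open>f\<close>.\<close>
    have dom: "(\<lambda>i. \<integral>\<^sup>+ x. ennreal (cmod (f x - s i x) powr p) \<partial>M) \<longlonglongrightarrow> (\<integral>\<^sup>+ x. 0 \<partial>M)"
    proof (rule nn_integral_dominated_convergence[where w = "\<lambda>x. ennreal (3 powr p) * ennreal (cmod (f x) powr p)"])
      show "AE x in M. ennreal (cmod (f x - s i x) powr p) \<le> ennreal (3 powr p) * ennreal (cmod (f x) powr p)" for i
      proof (rule AE_I2)
        fix x assume x: "x \<in> space M"
        have "cmod (f x - s i x) \<le> 3 * cmod (f x)"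
          using s(3)[OF x, of i] norm_triangle_ineq4[of "f x" "s i x"] by simp
        then have "cmod (f x - s i x) powr p \<le> (3 * cmod (f x)) powr p" using p by (intro powr_mono2) auto
        then show "ennreal (cmod (f x - s i x) powr p) \<le> ennreal (3 powr p) * ennreal (cmod (f x) powr p)"
          by (simp add: ennreal_mult'[symmetric] powr_mult)
      qed
      show "(\<integral>\<^sup>+ x. ennreal (3 powr p) * ennreal (cmod (f x) powr p) \<partial>M) < \<infinity>"
        using Nf by (subst nn_integral_cmult) (auto simp: N_def ennreal_mult_less_top)
      show "AE x in M. (\<lambda>i. ennreal (cmod (f x - s i x) powr p)) \<longlonglongrightarrow> 0"
      proof (rule AE_I2)
        fix x assume x: "x \<in> space M"
        have "(\<lambda>i. cmod (f x - s i x)) \<longlonglongrightarrow> 0"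
          using tendsto_norm_zero[OF tendsto_diff[OF tendsto_const[of "f x"] s(2)[OF x], simplified]] by simp
        then have "(\<lambda>i. cmod (f x - s i x) powr p) \<longlonglongrightarrow> 0 powr p"
          using p by (intro tendsto_powr2) (auto intro: tendsto_const)
        then have "(\<lambda>i. ennreal (cmod (f x - s i x) powr p)) \<longlonglongrightarrow> ennreal (0 powr p)" by (rule tendsto_ennrealI)
        then show "(\<lambda>i. ennreal (cmod (f x - s i x) powr p)) \<longlonglongrightarrow> 0" using p by simp
      qed
    qed measurable
    fix e :: real assume "0 < e"
    then show "\<exists>h\<in>F. N (\<lambda>x. f x - h x) < ennreal e"
    proof (rule close)
      fix e :: real assume e: "0 < e"
      have "\<forall>\<^sub>F i in sequentially. N (\<lambda>x. f x - s i x) < ennreal e"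
        unfolding N_def using order_tendstoD(2)[OF dom, of "ennreal e"] e by simp
      then obtain i where i: "N (\<lambda>x. f x - s i x) < ennreal e" by (auto simp: eventually_sequentially)
      have "N (s i) \<le> ennreal (2 powr p) * (N f + N (\<lambda>x. f x - s i x))"
        unfolding N_def
      proof (rule nn_integral_powr_triangle[OF p])
        show "cmod (s i x) \<le> cmod (f x) + cmod (f x - s i x)" for x
          using norm_triangle_ineq4[of "f x" "f x - s i x"] by simp
      qed measurable
      also have "\<dots> < \<infinity>"
      proof -
        have "N (\<lambda>x. f x - s i x) < \<infinity>" using i by (rule less_trans) simp
        then show ?thesis using Nf by (simp add: ennreal_mult_less_top)
      qed
      finally have "App (s i)" using s(1) by (intro App_simple)
      then obtain h where h: "h \<in> F" "N (\<lambda>x. s i x - h x) < ennreal e" using e unfolding App_def by blast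
      have [measurable]: "h \<in> borel_measurable M" using Fm h by auto
      show "\<exists>u v h. u \<in> borel_measurable M \<and> v \<in> borel_measurable M \<and> h \<in> F \<and>
          (\<forall>x\<in>space M. f x - h x = u x + v x) \<and> N u < ennreal e \<and> N v < ennreal e"
        using h i by (intro exI[of _ "\<lambda>x. f x - s i x"] exI[of _ "\<lambda>x. s i x - h x"] exI[of _ h]) simp
    qed
  qed
  show ?thesis
    unfolding Lp_dense_def
  proof (intro conjI ballI allI impI F)
    fix f and e :: real assume f: "f \<in> Lp M p" and e: "0 < e"
    have "0 < e powr p" using e by simp
    then obtain h where h: "h \<in> F" "N (\<lambda>x. f x - h x) < ennreal (e powr p)"
      using App_Lp[OF f] unfolding App_def by meson
    have d: "(\<lambda>x. f x - h x) \<in> Lp M p" using Lp_diff[OF p f] F h(1) by auto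
    then have "Lp_norm M p (\<lambda>x. f x - h x) < e"
      using Lp_norm_less_iff[OF p _ e d] h(2) by (simp add: N_def Lp_def)
    then show "\<exists>h\<in>F. Lp_norm M p (\<lambda>x. f x - h x) < e" using h(1) by blast
  qed
qed

text \<open>Truncating the real part to the interval from 0 to 1 is a contraction, so
  \<open>G\<close>-continuity survives. Markov's inequality then bounds both the superlevel sets and
  the set of points misclassified by the threshold 1/2.\<close>

lemma approx_of_Lp_dense:
  fixes TG :: "'g topology" and M :: "'x measure"
  assumes G: "polish_group G TG" and p: "0 < p"
    and dense: "Lp_dense M p (G_continuous_functions G TG M \<alpha> \<inter> Lp M p)"
    and A [measurable]: "A \<in> sets M" and Afin: "emeasure M A < \<infinity>" and e: "0 < e"
  shows "\<exists>f :: 'x \<Rightarrow> real. f \<in> borel_measurable M \<and> (\<forall>x. 0 \<le> f x \<and> f x \<le> 1) \<and>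
        (\<forall>\<delta>>0. emeasure M {x \<in> space M. \<delta> < f x} < \<infinity>) \<and>
        (\<forall>\<delta>>0. \<exists>U. openin TG U \<and> \<one>\<^bsub>G\<^esub> \<in> U \<and>
           (\<forall>g\<in>U. \<forall>T\<in>\<alpha> g. AE x in M. \<bar>f x - f (inv_into (space M) T x)\<bar> \<le> \<delta>)) \<and>
        emeasure M {x \<in> space M. (1/2 < f x) \<noteq> (x \<in> A)} < ennreal e"
proof -
  define u :: "'x \<Rightarrow> complex" where "u = indicator A"
  have um [measurable]: "u \<in> borel_measurable M" by (simp add: u_def)
  have "(\<integral>\<^sup>+ x. ennreal (cmod (u x) powr p) \<partial>M) = (\<integral>\<^sup>+ x. indicator A x \<partial>M)"
    using p by (intro nn_integral_cong) (auto simp: u_def indicator_def)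
  then have uL: "u \<in> Lp M p" using Afin by (simp add: Lp_nn_integral)
  \<comment> \<open>Misclassified points have error at least 1/2, so Markov's inequality will give
    the bound \<open>(2 * \<epsilon>) powr p\<close>, which is \<open>e\<close> for this
    choice.\<close>
  define \<epsilon> where "\<epsilon> = e powr (1/p) / 2"
  have \<epsilon>: "0 < \<epsilon>" using e by (simp add: \<epsilon>_def)
  obtain h where h: "h \<in> G_continuous_functions G TG M \<alpha>" "h \<in> Lp M p" "Lp_norm M p (\<lambda>x. u x - h x) < \<epsilon>"
    using dense uL \<epsilon> unfolding Lp_dense_def by blast
  have hm [measurable]: "h \<in> borel_measurable M" using h(2) by (simp add: Lp_def)
  have d: "(\<lambda>x. u x - h x) \<in> Lp M p" by (rule Lp_diff[OF p uL h(2)])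
  have Nd: "(\<integral>\<^sup>+ x. ennreal (cmod (u x - h x) powr p) \<partial>M) < ennreal (\<epsilon> powr p)"
    using Lp_norm_less_iff[OF p _ \<epsilon> d] h(3) by simp
  define f where "f x = min 1 (max 0 (Re (h x)))" for x
  have f_h: "f x \<le> cmod (h x)" for x
    using complex_Re_le_cmod[of "h x"] by (auto simp: f_def intro: min.coboundedI2)
  have f_diff: "\<bar>f x - f y\<bar> \<le> cmod (h x - h y)" for x y
  proof -
    have "\<bar>f x - f y\<bar> \<le> \<bar>Re (h x - h y)\<bar>" by (auto simp: f_def min_def max_def)
    then show ?thesis using abs_Re_le_cmod[of "h x - h y"] by simp
  qed
  have markov: "emeasure M {x \<in> space M. c < v x} \<le> ennreal (1 / c powr p) * (\<integral>\<^sup>+ x. ennreal (v x powr p) \<partial>M)"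
    if [measurable]: "v \<in> borel_measurable M" and c: "0 < c" for v and c :: real
  proof -
    have "emeasure M {x \<in> space M. c < v x} \<le> emeasure M ({x \<in> space M. 1 \<le> ennreal (1 / c powr p) * ennreal (v x powr p)})"
    proof (rule emeasure_mono)
      show "{x \<in> space M. c < v x} \<subseteq> {x \<in> space M. 1 \<le> ennreal (1 / c powr p) * ennreal (v x powr p)}"
      proof safe
        fix x assume "c < v x"
        then have "c powr p \<le> v x powr p" using c p by (intro powr_mono2) auto
        then have "1 \<le> 1 / c powr p * v x powr p" using c by (simp add: field_simps)
        then show "1 \<le> ennreal (1 / c powr p) * ennreal (v x powr p)"
          by (simp add: ennreal_mult'[symmetric] ennreal_1[symmetric] del: ennreal_1)
      qed
    qed measurable
    also have "\<dots> \<le> ennreal (1 / c powr p) * (\<integral>\<^sup>+ x. ennreal (v x powr p) * indicator (space M) x \<partial>M)"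
      by (rule nn_integral_Markov_inequality) measurable
    also have "(\<integral>\<^sup>+ x. ennreal (v x powr p) * indicator (space M) x \<partial>M) = (\<integral>\<^sup>+ x. ennreal (v x powr p) \<partial>M)"
      by (intro nn_integral_cong) simp
    finally show ?thesis .
  qed
  have fm [measurable]: "f \<in> borel_measurable M" unfolding f_def by measurable
  have fin: "emeasure M {x \<in> space M. \<delta> < f x} < \<infinity>" if \<delta>: "0 < \<delta>" for \<delta>
  proof -
    have "emeasure M {x \<in> space M. \<delta> < f x} \<le> emeasure M {x \<in> space M. \<delta> < cmod (h x)}"
      by (rule emeasure_mono) (use f_h in \<open>auto intro: less_le_trans\<close>)
    also have "\<dots> \<le> ennreal (1 / \<delta> powr p) * (\<integral>\<^sup>+ x. ennreal (cmod (h x) powr p) \<partial>M)"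
      by (rule markov[OF _ \<delta>]) measurable
    also have "\<dots> < \<infinity>" using h(2) by (simp add: Lp_nn_integral ennreal_mult_less_top)
    finally show ?thesis .
  qed
  have cont: "\<exists>U. openin TG U \<and> \<one>\<^bsub>G\<^esub> \<in> U \<and>
      (\<forall>g\<in>U. \<forall>T\<in>\<alpha> g. AE x in M. \<bar>f x - f (inv_into (space M) T x)\<bar> \<le> \<delta>)" if \<delta>: "0 < \<delta>" for \<delta>
  proof -
    have "\<forall>\<^sub>F g in nhdsin TG \<one>\<^bsub>G\<^esub>. \<forall>T\<in>\<alpha> g. Linf_norm M (\<lambda>x. h x - h (inv_into (space M) T x)) < ereal \<delta>"
      using h(1) \<delta> by (simp add: G_continuous_functions_def)
    moreover have "\<one>\<^bsub>G\<^esub> \<in> topspace TG" using G by (simp add: polish_group_def group.is_monoid monoid.one_closed)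
    ultimately obtain U where U: "openin TG U" "\<one>\<^bsub>G\<^esub> \<in> U"
      "\<forall>g\<in>U. \<forall>T\<in>\<alpha> g. Linf_norm M (\<lambda>x. h x - h (inv_into (space M) T x)) < ereal \<delta>"
      unfolding eventually_nhdsin by blast
    have "AE x in M. \<bar>f x - f (inv_into (space M) T x)\<bar> \<le> \<delta>" if "g \<in> U" "T \<in> \<alpha> g" for g T
      using Linf_norm_AE[OF U(3)[rule_format, OF that]]
      by eventually_elim (rule order_trans[OF f_diff])
    then show ?thesis using U by blast
  qed
  have "emeasure M {x \<in> space M. (1/2 < f x) \<noteq> (x \<in> A)} < ennreal e"
  proof -
    have "{x \<in> space M. (1/2 < f x) \<noteq> (x \<in> A)} \<subseteq> {x \<in> space M. 1 \<le> ennreal (2 powr p) * ennreal (cmod (u x - h x) powr p)}"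
    proof
      fix x assume "x \<in> {x \<in> space M. (1/2 < f x) \<noteq> (x \<in> A)}"
      then have x: "x \<in> space M" and ne: "(1/2 < f x) \<noteq> (x \<in> A)" by auto
      have "1/2 \<le> cmod (u x - h x)"
      proof (cases "x \<in> A")
        case True
        then have "Re (u x - h x) \<ge> 1/2" using ne by (auto simp: u_def f_def min_def max_def split: if_splits)
        then show ?thesis using complex_Re_le_cmod[of "u x - h x"] by linarith
      next
        case False
        then have "1/2 < f x" "u x = 0" using ne by (auto simp: u_def)
        then show ?thesis using f_h[of x] by simp
      qed
      then have "1 \<le> 2 * cmod (u x - h x)" by simp
      then have "1 powr p \<le> (2 * cmod (u x - h x)) powr p" using p by (intro powr_mono2) auto
      then have "1 \<le> 2 powr p * cmod (u x - h x) powr p" by (simp add: powr_mult)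
      then have "1 \<le> ennreal (2 powr p) * ennreal (cmod (u x - h x) powr p)"
        by (simp add: ennreal_mult'[symmetric] ennreal_1[symmetric] del: ennreal_1)
      then show "x \<in> {x \<in> space M. 1 \<le> ennreal (2 powr p) * ennreal (cmod (u x - h x) powr p)}"
        using x by simp
    qed
    then have "emeasure M {x \<in> space M. (1/2 < f x) \<noteq> (x \<in> A)} \<le>
        emeasure M {x \<in> space M. 1 \<le> ennreal (2 powr p) * ennreal (cmod (u x - h x) powr p)}"
      by (rule emeasure_mono) measurable
    also have "\<dots> \<le> ennreal (2 powr p) * (\<integral>\<^sup>+ x. ennreal (cmod (u x - h x) powr p) * indicator (space M) x \<partial>M)"
      by (rule nn_integral_Markov_inequality) measurable
    also have "(\<integral>\<^sup>+ x. ennreal (cmod (u x - h x) powr p) * indicator (space M) x \<partial>M) = (\<integral>\<^sup>+ x. ennreal (cmod (u x - h x) powr p) \<partial>M)"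
      by (intro nn_integral_cong) simp
    also have "ennreal (2 powr p) * \<dots> < ennreal (2 powr p) * ennreal (\<epsilon> powr p)"
      using Nd by (intro ennreal_mult_strict_left_mono) auto
    also have "\<dots> = ennreal e"
    proof -
      have "2 powr p * \<epsilon> powr p = (2 * \<epsilon>) powr p" using \<epsilon> by (simp add: powr_mult)
      also have "\<dots> = e" using e p by (simp add: \<epsilon>_def powr_powr)
      finally show ?thesis by (simp add: ennreal_mult'[symmetric])
    qed
    finally show ?thesis .
  qed
  then show ?thesis using fin cont by (intro exI[of _ f]) (auto simp: f_def)
qed

section \<open>Compactly supported continuous functions\<close>

definition compactly_supported :: "'x topology \<Rightarrow> ('x \<Rightarrow> complex) set" where
  "compactly_supported T = {f. continuous_map T euclidean f \<and> (\<exists>K. compactin T K \<and> (\<forall>x\<in>topspace T - K. f x = 0))}"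

lemma compactly_supported_bounded:
  assumes f: "f \<in> compactly_supported T"
  shows "\<exists>B. \<forall>x\<in>topspace T. cmod (f x) \<le> B"
proof -
  obtain K where K: "continuous_map T euclidean f" "compactin T K" "\<forall>x\<in>topspace T - K. f x = 0"
    using f by (auto simp: compactly_supported_def)
  have "compact (f ` K)" using image_compactin[OF K(2,1)] by (simp add: compactin_euclidean_iff)
  then obtain B where B: "\<forall>y\<in>f ` K. cmod y \<le> B" using compact_imp_bounded bounded_iff by metis
  have "cmod (f x) \<le> max B 0" if "x \<in> topspace T" for x
  proof (cases "x \<in> K")
    case True
    then show ?thesis using B by (auto intro: max.coboundedI1)
  qed (use K(3) that in auto)
  then show ?thesis by blast
qed

lemma compactly_supported_measurable:
  assumes f: "f \<in> compactly_supported T" and T: "induces_borel_structure T M"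
  shows "f \<in> borel_measurable M"
proof (rule borel_measurableI)
  fix V :: "complex set" assume "open V"
  then have "openin T {x \<in> topspace T. f x \<in> V}"
    using f by (intro openin_continuous_map_preimage[of _ euclidean]) (auto simp: compactly_supported_def)
  moreover have "f -` V \<inter> space M = {x \<in> topspace T. f x \<in> V}" using T by (auto simp: induces_borel_structure_def)
  ultimately show "f -` V \<inter> space M \<in> sets M" using T by (simp add: induces_borel_structure_def)
qed

lemma compactly_supported_Lp:
  assumes f: "f \<in> compactly_supported T" and T: "induces_borel_structure T M" "radon T M" "Hausdorff_space T"
    and p: "0 < p"
  shows "f \<in> Lp M p"
proof -
  obtain K where K: "compactin T K" "\<forall>x\<in>topspace T - K. f x = 0" using f by (auto simp: compactly_supported_def)
  obtain B where B: "\<forall>x\<in>topspace T. cmod (f x) \<le> B" using compactly_supported_bounded[OF f] by blast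
  have fm [measurable]: "f \<in> borel_measurable M" by (rule compactly_supported_measurable[OF f T(1)])
  have top: "topspace T = space M" using T(1) by (simp add: induces_borel_structure_def)
  have "integrable M (\<lambda>x. cmod (f x) powr p)"
  proof (rule integrableI_bounded_set)
    show "K \<in> sets M" by (rule compactin_sets[OF T(3,1) K(1)])
    show "emeasure M K < \<infinity>" using T(2) K(1) by (simp add: radon_def)
    show "AE x in M. x \<in> K \<longrightarrow> norm (cmod (f x) powr p) \<le> B powr p"
      using B p top by (intro AE_I2) (auto intro: powr_mono2)
    show "AE x in M. x \<notin> K \<longrightarrow> cmod (f x) powr p = 0" using K(2) p top by (intro AE_I2) auto
  qed measurable
  then show ?thesis by (simp add: Lp_def)
qed

text \<open>The tube lemma controls only the points of the compact set \<open>K\<close> that carries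
  \<open>f\<close>. A point outside \<open>K\<close> that is moved into it is compared from its
  image in \<open>K\<close>, for which the neighbourhood of the identity is made stable under
  inversion.\<close>

lemma compactly_supported_G_continuous:
  fixes TG :: "'g topology" and M :: "'x measure"
  assumes G: "polish_group G TG" and T: "induces_borel_structure T M"
    and lift: "lifts_to_continuous_action G TG M T \<alpha>" and f: "f \<in> compactly_supported T"
  shows "f \<in> G_continuous_functions G TG M \<alpha>"
proof -
  interpret G: group G using G by (simp add: polish_group_def)
  have topG: "topspace TG = carrier G" and cinv: "continuous_map TG TG (\<lambda>g. inv\<^bsub>G\<^esub> g)"
    using G by (auto simp: polish_group_def)
  have top: "topspace T = space M" using T by (simp add: induces_borel_structure_def)
  obtain \<beta> where ga: "group_action G (space M) \<beta>"
    and c\<beta>: "continuous_map (prod_topology TG T) T (\<lambda>(g, x). \<beta> g x)"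
    and \<beta>: "\<And>g. g \<in> carrier G \<Longrightarrow> \<beta> g \<in> mp_bij M" "\<And>g. g \<in> carrier G \<Longrightarrow> aut_class M (\<beta> g) = \<alpha> g"
    using lift by (auto simp: lifts_to_continuous_action_def)
  interpret ga: group_action G "space M" \<beta> by (rule ga)
  have \<beta>X: "\<beta> g x \<in> space M" if "g \<in> carrier G" "x \<in> space M" for g x
    using mp_bij_simps(1)[OF \<beta>(1)] that by blast
  have \<beta>1: "\<beta> \<one>\<^bsub>G\<^esub> x = x" if "x \<in> space M" for x
    using ga.id_eq_one that by (metis restrict_apply')
  have \<beta>inv: "\<beta> g (\<beta> (inv\<^bsub>G\<^esub> g) x) = x" if "g \<in> carrier G" "x \<in> space M" for g x
    using ga.composition_rule[OF that(2,1) G.inv_closed[OF that(1)]] \<beta>1[OF that(2)] that(1) by simp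
  have inv\<beta>: "inv_into (space M) (\<beta> g) x = \<beta> (inv\<^bsub>G\<^esub> g) x" if "g \<in> carrier G" "x \<in> space M" for g x
    using mp_bij_simps(3)[OF \<beta>(1)[OF that(1)] \<beta>X[of "inv\<^bsub>G\<^esub> g" x]] \<beta>inv[OF that] that by simp
  obtain K where K: "continuous_map T euclidean f" "compactin T K" "\<forall>x\<in>space M - K. f x = 0"
    using f top by (auto simp: compactly_supported_def)
  have KM: "K \<subseteq> space M" using compactin_subset_topspace[OF K(2)] top by simp
  have fm [measurable]: "f \<in> borel_measurable M" by (rule compactly_supported_measurable[OF f T])
  obtain B where B: "\<forall>x\<in>topspace T. cmod (f x) \<le> B" using compactly_supported_bounded[OF f] by blast
  have "Linf_norm M f \<le> ereal B" using B top by (intro Linf_norm_le fm AE_I2) auto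
  then have "f \<in> Linf M" using fm by (auto simp: Linf_def intro: le_less_trans)
  moreover have "\<forall>\<^sub>F g in nhdsin TG \<one>\<^bsub>G\<^esub>. \<forall>S\<in>\<alpha> g. Linf_norm M (\<lambda>x. f x - f (inv_into (space M) S x)) < \<epsilon>"
    if \<epsilon>: "0 < \<epsilon>" for \<epsilon> :: ereal
  proof -
    \<comment> \<open>A real number strictly below \<open>\<epsilon>\<close>, which may be infinite;
      the slack turns a bound by \<open>e\<close> into a strict one.\<close>
    obtain e where e: "0 < ereal e" "ereal e < \<epsilon>" using ereal_dense2[OF \<epsilon>] by auto
    define W where "W = {q \<in> topspace (prod_topology T TG). cmod (f (fst q) - f (\<beta> (snd q) (fst q))) < e}"
    have "continuous_map (prod_topology T TG) euclideanreal (\<lambda>q. cmod (f (fst q) - f (\<beta> (snd q) (fst q))))"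
    proof (intro continuous_map_norm continuous_map_diff)
      show "continuous_map (prod_topology T TG) euclidean (\<lambda>q. f (fst q))"
        using continuous_map_compose[OF continuous_map_fst K(1)] by (simp add: comp_def)
      have "continuous_map (prod_topology T TG) (prod_topology TG T) (\<lambda>q. (snd q, fst q))"
        by (intro continuous_map_pairedI continuous_map_fst continuous_map_snd)
      from continuous_map_compose[OF continuous_map_compose[OF this c\<beta>] K(1)]
      show "continuous_map (prod_topology T TG) euclidean (\<lambda>q. f (\<beta> (snd q) (fst q)))"
        by (simp add: comp_def)
    qed
    then have W: "openin (prod_topology T TG) W"
      unfolding W_def using openin_continuous_map_preimage[of _ euclideanreal _ "{..<e}"] by fastforce
    have "K \<times> {\<one>\<^bsub>G\<^esub>} \<subseteq> W" using KM \<beta>1 e(1) by (auto simp: W_def top topG)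
    then obtain U V where UV: "openin T U" "openin TG V" "K \<subseteq> U" "\<one>\<^bsub>G\<^esub> \<in> V" "U \<times> V \<subseteq> W"
      using tube_lemma_left[OF W K(2), of "\<one>\<^bsub>G\<^esub>"] topG by auto
    have KV: "cmod (f x - f (\<beta> g x)) < e" if "x \<in> K" "g \<in> V" for x g
      using UV(3,5) that by (auto simp: W_def subset_iff)
    define V' where "V' = V \<inter> {g \<in> topspace TG. inv\<^bsub>G\<^esub> g \<in> V}"
    have "openin TG V'" unfolding V'_def
      by (intro openin_Int UV openin_continuous_map_preimage[OF cinv])
    moreover have "\<one>\<^bsub>G\<^esub> \<in> V'" using UV(4) topG by (simp add: V'_def)
    moreover have "Linf_norm M (\<lambda>x. f x - f (inv_into (space M) S x)) < \<epsilon>" if g: "g \<in> V'" and S: "S \<in> \<alpha> g" for g S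
    proof -
      have gG: "g \<in> carrier G" and gV: "g \<in> V" "inv\<^bsub>G\<^esub> g \<in> V" using g topG by (auto simp: V'_def)
      have "S \<in> aut_class M (\<beta> g)" using S \<beta>(2)[OF gG] by simp
      then have S': "S \<in> mp_bij M" "AE x in M. \<beta> g x = S x" by (simp_all add: aut_class_iff)
      have bound: "cmod (f x - f (\<beta> (inv\<^bsub>G\<^esub> g) x)) \<le> e" if x: "x \<in> space M" for x
      proof (cases "x \<in> K")
        case True
        then show ?thesis using KV gV(2) by (simp add: less_imp_le)
      next
        case False
        define y where "y = \<beta> (inv\<^bsub>G\<^esub> g) x"
        have y: "y \<in> space M" "\<beta> g y = x" using \<beta>X \<beta>inv gG x by (auto simp: y_def)
        show ?thesis
        proof (cases "y \<in> K")
          case True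
          then show ?thesis using KV[OF True gV(1)] y(2) by (simp add: y_def[symmetric] norm_minus_commute less_imp_le)
        next
          case n: False
          then show ?thesis using K(3) False x y(1) e(1) by (simp add: y_def[symmetric])
        qed
      qed
      have "AE x in M. inv_into (space M) (\<beta> g) x = inv_into (space M) S x"
        by (rule AE_inv_into_eq[OF mp_bijD(3)[OF \<beta>(1)[OF gG]] S'])
      then have "AE x in M. cmod (f x - f (inv_into (space M) S x)) \<le> e"
        using AE_space by eventually_elim (use bound inv\<beta>[OF gG] in metis)
      moreover have "(\<lambda>x. f x - f (inv_into (space M) S x)) \<in> borel_measurable M"
        using mp_bijD(2)[OF S'(1)] by measurable
      ultimately have "Linf_norm M (\<lambda>x. f x - f (inv_into (space M) S x)) \<le> ereal e" by (intro Linf_norm_le)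
      then show ?thesis using e(2) by (rule le_less_trans)
    qed
    ultimately show ?thesis unfolding eventually_nhdsin by blast
  qed
  ultimately show ?thesis by (simp add: G_continuous_functions_def)
qed

text \<open>Outer regularity puts \<open>A\<close> into an open \<open>U\<close>, and inner
  regularity of \<open>U\<close> yields a compact \<open>K\<close> in it, with \<open>U - A\<close>
  and \<open>U - K\<close> small. A Urysohn function between \<open>K\<close> and \<open>U\<close>
  differs from the indicator of \<open>A\<close> only on these two sets, and there by at most
  1.\<close>

lemma compactly_supported_dense:
  fixes M :: "'x measure"
  assumes T: "polish_topology T" "locally_compact_space T" "induces_borel_structure T M" "radon T M" and p: "0 < p"
  shows "Lp_dense M p (compactly_supported T)"
proof (rule Lp_dense_of_indicators[OF p])
  have top: "topspace T = space M" using T(3) by (simp add: induces_borel_structure_def)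
  have met: "metrizable_space T"
    using T(1) by (simp add: polish_topology_def completely_metrizable_imp_metrizable_space)
  then have haus: "Hausdorff_space T" by (rule metrizable_imp_Hausdorff_space)
  have norm: "normal_space T" using met by (rule metrizable_imp_normal_space)
  show "compactly_supported T \<subseteq> Lp M p" using compactly_supported_Lp[OF _ T(3,4) haus p] by blast
  show "(\<lambda>_. 0) \<in> compactly_supported T" by (auto simp: compactly_supported_def intro!: exI[of _ "{}"])
  show "(\<lambda>x. f x + g x) \<in> compactly_supported T" if fg: "f \<in> compactly_supported T" "g \<in> compactly_supported T" for f g
  proof -
    obtain K L where "compactin T K" "\<forall>x\<in>topspace T - K. f x = 0" "compactin T L" "\<forall>x\<in>topspace T - L. g x = 0"
      "continuous_map T euclidean f" "continuous_map T euclidean g"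
      using fg by (auto simp: compactly_supported_def)
    then show ?thesis unfolding compactly_supported_def
      by (auto intro!: continuous_map_add exI[of _ "K \<union> L"] compactin_Un)
  qed
  show "(\<lambda>x. c * f x) \<in> compactly_supported T" if f: "f \<in> compactly_supported T" for f c
  proof -
    have "continuous_map euclidean euclidean (\<lambda>z. c * z)" by (simp add: continuous_on_mult_left)
    then have "continuous_map T euclidean (\<lambda>x. c * f x)"
      using f continuous_map_compose[of T euclidean f euclidean "\<lambda>z. c * z"] by (simp add: compactly_supported_def comp_def)
    then show ?thesis using f by (auto simp: compactly_supported_def)
  qed
  fix A and e :: real assume A: "A \<in> sets M" and Afin: "emeasure M A < \<infinity>" and e: "0 < e"
  have op: "V \<in> sets M" if "openin T V" for V using T(3) that by (simp add: induces_borel_structure_def)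
  have e2: "0 < ennreal (e/3)" using e by simp
  have lt: "x < x + ennreal (e/3)" if "x < \<infinity>" for x :: ennreal
    using that e by (simp add: ennreal_zero_less_mult_iff)
  have "(INF U\<in>{U. openin T U \<and> A \<subseteq> U}. emeasure M U) < emeasure M A + ennreal (e/3)"
    using T(4) A lt[OF Afin] by (simp add: radon_def)
  then obtain U where U: "openin T U" "A \<subseteq> U" "emeasure M U < emeasure M A + ennreal (e/3)"
    unfolding INF_less_iff by auto
  have Ufin: "emeasure M U < \<infinity>" using U(3) Afin by (auto intro: less_trans simp: ennreal_add_less_top)
  have "\<exists>K. compactin T K \<and> K \<subseteq> U \<and> emeasure M U \<le> emeasure M K + ennreal (e/3)"
  \<comment> \<open>Subtraction of extended nonnegative reals truncates at 0, so for small
    \<open>U\<close> the empty set serves as \<open>K\<close>.\<close>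
  proof (cases "emeasure M U < ennreal (e/3)")
    case True
    then show ?thesis by (intro exI[of _ "{}"]) (simp add: less_imp_le)
  next
    case False
    have "emeasure M U - ennreal (e/3) < emeasure M U"
      using Ufin False e by (intro ennreal_between) (auto simp: not_less intro: less_le_trans[OF e2])
    also have "emeasure M U = (SUP K\<in>{K. compactin T K \<and> K \<subseteq> U}. emeasure M K)" using T(4) U(1) by (simp add: radon_def)
    finally obtain K where K: "compactin T K" "K \<subseteq> U" "emeasure M U - ennreal (e/3) < emeasure M K"
      unfolding less_SUP_iff by auto
    have "emeasure M U \<le> emeasure M K + ennreal (e/3)"
      using less_imp_le[OF K(3)] by (simp add: ennreal_minus_le_iff add.commute)
    then show ?thesis using K by blast
  qed
  then obtain K where K: "compactin T K" "K \<subseteq> U" "emeasure M U \<le> emeasure M K + ennreal (e/3)" by blast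
  have Ks: "K \<in> sets M" by (rule compactin_sets[OF haus T(3) K(1)])
  obtain V L where VL: "openin T V" "compactin T L" "K \<subseteq> V" "V \<subseteq> L"
    using locally_compact_space_compact_closed_compact[of T] haus T(2) K(1) by blast
  \<comment> \<open>Being inside \<open>L\<close> gives compact support, being inside
    \<open>U\<close> the error estimate.\<close>
  define V' where "V' = V \<inter> U"
  have V': "openin T V'" "K \<subseteq> V'" "V' \<subseteq> L" "V' \<subseteq> U" using VL U K by (auto simp: V'_def)
  have cl: "closedin T (topspace T - V')" using V'(1) by blast
  have clK: "closedin T K" using haus K(1) by (rule compactin_imp_closedin)
  have disj: "disjnt (topspace T - V') K" using V'(2) by (auto simp: disjnt_def)
  obtain f where f: "continuous_map T (top_of_set {0..1::real}) f" "f ` (topspace T - V') \<subseteq> {0}" "f ` K \<subseteq> {1}"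
    by (rule Urysohn_lemma[OF norm cl clK disj, of 0 1]) auto
  have f01: "0 \<le> f x" "f x \<le> 1" if "x \<in> space M" for x
    using continuous_map_funspace[OF f(1)] that top by auto
  define h where "h x = complex_of_real (f x)" for x
  have hC: "h \<in> compactly_supported T"
  proof -
    have 1: "continuous_map T euclideanreal f" using f(1) by (simp add: continuous_map_in_subtopology)
    have 2: "continuous_map euclideanreal euclidean complex_of_real" by (simp add: continuous_on_of_real)
    have "continuous_map T euclidean h" using continuous_map_compose[OF 1 2] by (simp add: h_def[abs_def] comp_def)
    moreover have "\<forall>x\<in>topspace T - L. h x = 0" using f(2) V'(3) by (auto simp: h_def)
    ultimately show ?thesis using VL(2) by (auto simp: compactly_supported_def)
  qed
  have "(\<integral>\<^sup>+ x. ennreal (cmod (indicator A x - h x) powr p) \<partial>M) \<le>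
      (\<integral>\<^sup>+ x. indicator (U - A) x + indicator (U - K) x \<partial>M)"
  proof (rule nn_integral_mono)
    fix x assume x: "x \<in> space M"
    have "indicator A x - h x = complex_of_real (indicator A x - f x)" by (simp add: h_def indicator_def)
    then have *: "cmod (indicator A x - h x) = \<bar>indicator A x - f x\<bar>" by (simp only: norm_of_real)
    have le1: "\<bar>indicator A x - f x\<bar> powr p \<le> 1"
      using f01[OF x] p by (intro powr_le1) (auto simp: indicator_def abs_le_iff)
    show "ennreal (cmod (indicator A x - h x) powr p) \<le> indicator (U - A) x + indicator (U - K) x"
    proof (cases "x \<in> (U - A) \<union> (U - K)")
      case True
      then have "1 \<le> (indicator (U - A) x + indicator (U - K) x :: ennreal)" by (auto simp: indicator_def)
      moreover have "ennreal (cmod (indicator A x - h x) powr p) \<le> 1" using le1 * by simp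
      ultimately show ?thesis by (rule order_trans[rotated])
    next
      case False
      then have "x \<in> A \<inter> K \<or> (x \<notin> U)" by auto
      then have "indicator A x = f x"
      proof
        assume "x \<in> A \<inter> K"
        then show ?thesis using f(3) by auto
      next
        assume "x \<notin> U"
        then show ?thesis using f(2) V'(4) U(2) x top by (auto simp: indicator_def image_subset_iff)
      qed
      then show ?thesis using p by (simp add: *)
    qed
  qed
  also have "\<dots> = emeasure M (U - A) + emeasure M (U - K)"
    using op[OF U(1)] A Ks by (subst nn_integral_add) auto
  also have "\<dots> \<le> ennreal (e/3) + ennreal (e/3)"
  proof (rule add_mono)
    have "emeasure M (U - A) = emeasure M U - emeasure M A"
      using Afin A op[OF U(1)] U(2) by (intro emeasure_Diff) auto
    then show "emeasure M (U - A) \<le> ennreal (e/3)"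
      using U(3) Ufin by (auto simp: ennreal_minus_le_iff add.commute less_imp_le)
    have "emeasure M K < \<infinity>" using T(4) K(1) by (simp add: radon_def)
    then have "emeasure M (U - K) = emeasure M U - emeasure M K"
      using Ks op[OF U(1)] K(2) by (intro emeasure_Diff) auto
    then show "emeasure M (U - K) \<le> ennreal (e/3)"
      using K(3) Ufin by (auto simp: ennreal_minus_le_iff add.commute)
  qed
  also have "\<dots> < ennreal e" using e by (simp add: ennreal_plus[symmetric] ennreal_less_iff del: ennreal_plus)
  finally show "\<exists>h\<in>compactly_supported T. (\<integral>\<^sup>+ x. ennreal (cmod (indicator A x - h x) powr p) \<partial>M) < ennreal e"
    using hC by blast
qed

lemma Lp_dense_of_lift:
  assumes "polish_group G TG" and T: "polish_topology T" "locally_compact_space T" "induces_borel_structure T M"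
    "radon T M" "lifts_to_continuous_action G TG M T \<alpha>" and p: "0 < p"
  shows "Lp_dense M p (G_continuous_functions G TG M \<alpha> \<inter> Lp M p)"
proof -
  have "Lp_dense M p (compactly_supported T)" by (rule compactly_supported_dense[OF T(1-4) p])
  moreover have "compactly_supported T \<subseteq> G_continuous_functions G TG M \<alpha> \<inter> Lp M p"
    using compactly_supported_G_continuous[OF assms(1) T(3,5)] calculation by (auto simp: Lp_dense_def)
  ultimately show ?thesis unfolding Lp_dense_def by blast
qed

theorem theorem3:
  fixes G :: "('g, 'm) monoid_scheme" and TG :: "'g topology"
    and M :: "'x measure" and \<alpha> :: "'g \<Rightarrow> ('x \<Rightarrow> 'x) set"
  assumes "polish_group G TG"
    and "standard_sigma_finite M"
    and "boolean_action G TG M \<alpha>"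
  shows "let \<G> = G_continuous_functions G TG M \<alpha> in
    (Lp_dense M 1 (\<G> \<inter> Lp M 1) \<longleftrightarrow> Lp_dense M 2 (\<G> \<inter> Lp M 2)) \<and>
    (Lp_dense M 2 (\<G> \<inter> Lp M 2) \<longleftrightarrow>
       (\<exists>T. polish_topology T \<and> locally_compact_space T \<and> induces_borel_structure T M \<and>
            radon T M \<and> lifts_to_continuous_action G TG M T \<alpha>))"
proof -
  let ?\<G> = "G_continuous_functions G TG M \<alpha>"
  have \<alpha>: "\<alpha> \<in> hom G (Aut M)" using assms(3) by (simp add: boolean_action_def)
  \<comment> \<open>Each density condition is compared with the existence of the lift, uniformly for
    all positive exponents; the equivalence of the two conditions follows through the lift.\<close>
  have "(Lp_dense M p (?\<G> \<inter> Lp M p) \<longleftrightarrow>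
       (\<exists>T. polish_topology T \<and> locally_compact_space T \<and> induces_borel_structure T M \<and>
            radon T M \<and> lifts_to_continuous_action G TG M T \<alpha>))" if p: "0 < p" for p
  proof
    assume "Lp_dense M p (?\<G> \<inter> Lp M p)"
    from approx_of_Lp_dense[OF assms(1) p this]
    show "\<exists>T. polish_topology T \<and> locally_compact_space T \<and> induces_borel_structure T M \<and>
            radon T M \<and> lifts_to_continuous_action G TG M T \<alpha>"
      by (rule lift_exists[OF assms(1,2) \<alpha>])
  next
    assume "\<exists>T. polish_topology T \<and> locally_compact_space T \<and> induces_borel_structure T M \<and>
            radon T M \<and> lifts_to_continuous_action G TG M T \<alpha>"
    then show "Lp_dense M p (?\<G> \<inter> Lp M p)" using Lp_dense_of_lift[OF assms(1) _ _ _ _ _ p] by blast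
  qed
  from this[of 1] this[of 2] show ?thesis by (simp add: Let_def)
qed

end
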